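(* Let $k$ be a field, let $\mathcal{A}$ be the category of augmented $k$-algebras, and let $E:\mathcal{A}\to\mathcal{A}^{\mathrm{op}}$ be the functor $\Lambda\mapsto\operatorname{Ext}^*_\Lambda(k,k)$. Then $E$ has no right adjoint and no left adjoint.
   Context: Objects of $\mathcal{A}$ are pairs $(\Lambda,\varepsilon_\Lambda)$ with $\Lambda$ a unital $k$-algebra and $\varepsilon_\Lambda:\Lambda\to k$ a $k$-algebra homomorphism; morphisms $(\Lambda,\varepsilon_\Lambda)\to(\Gamma,\varepsilon_\Gamma)$ are $k$-algebra homomorphisms $f:\Lambda\to\Gamma$ with $\varepsilon_\Lambda=\varepsilon_\Gamma\circ f$. The field $k$ is a $\Lambda$-module via $\varepsilon_\Lambda$. $E(\Lambda)=\operatorname{Ext}^*_\Lambda(k,k)$ is a $k$-algebra under the Yoneda product, augmented by the map killing all elements of positive degree. $E$ is a contravariant endofunctor of $\mathcal{A}$, regarded as a covariant functor $\mathcal{A}\to\mathcal{A}^{\mathrm{op}}$: for $f:\Lambda\to\Gamma$ the map $E(f):E(\Gamma)\to E(\Lambda)$ is change of rings, sending the class of an exact sequence $0\to k\to N_{n-1}\to\cdots\to N_0\to k\to0$ of $\Gamma$-modules to the class of the same sequence regarded as a sequence of $\Lambda$-modules via $f$. *)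

theory Defs
  imports "HOL-Algebra.Module" "HOL-Library.Equipollence"
begin

section \<open>Categories, functors, adjunctions\<close>

text \<open>Hom-sets are indexed by source and target, and need not be disjoint; the action of a functor
  on arrows therefore takes source and target as arguments. \<^term>\<open>Comp C X Y Z g f\<close> is the composite
  of \<^term>\<open>f \<in> Mor C X Y\<close> and \<^term>\<open>g \<in> Mor C Y Z\<close>.\<close>

record ('o, 'a) category =
  Ob :: "'o set"
  Mor :: "'o \<Rightarrow> 'o \<Rightarrow> 'a set"
  Id :: "'o \<Rightarrow> 'a"
  Comp :: "'o \<Rightarrow> 'o \<Rightarrow> 'o \<Rightarrow> 'a \<Rightarrow> 'a \<Rightarrow> 'a"

definition is_category :: "('o, 'a) category \<Rightarrow> bool" where
  "is_category C \<longleftrightarrow>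
     (\<forall>X\<in>Ob C. Id C X \<in> Mor C X X) \<and>
     (\<forall>X\<in>Ob C. \<forall>Y\<in>Ob C. \<forall>Z\<in>Ob C. \<forall>f\<in>Mor C X Y. \<forall>g\<in>Mor C Y Z. Comp C X Y Z g f \<in> Mor C X Z) \<and>
     (\<forall>X\<in>Ob C. \<forall>Y\<in>Ob C. \<forall>f\<in>Mor C X Y. Comp C X X Y f (Id C X) = f \<and> Comp C X Y Y (Id C Y) f = f) \<and>
     (\<forall>W\<in>Ob C. \<forall>X\<in>Ob C. \<forall>Y\<in>Ob C. \<forall>Z\<in>Ob C. \<forall>f\<in>Mor C W X. \<forall>g\<in>Mor C X Y. \<forall>h\<in>Mor C Y Z.
        Comp C W Y Z h (Comp C W X Y g f) = Comp C W X Z (Comp C X Y Z h g) f)"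

definition op_cat :: "('o, 'a) category \<Rightarrow> ('o, 'a) category" where
  "op_cat C = \<lparr>Ob = Ob C, Mor = (\<lambda>X Y. Mor C Y X), Id = Id C,
               Comp = (\<lambda>X Y Z g f. Comp C Z Y X f g)\<rparr>"

record ('o, 'a, 'p, 'b) functor_data =
  obj_map :: "'o \<Rightarrow> 'p"
  mor_map :: "'o \<Rightarrow> 'o \<Rightarrow> 'a \<Rightarrow> 'b"

definition is_functor ::
  "('o, 'a) category \<Rightarrow> ('p, 'b) category \<Rightarrow> ('o, 'a, 'p, 'b) functor_data \<Rightarrow> bool" where
  "is_functor C D F \<longleftrightarrow>
     (\<forall>X\<in>Ob C. obj_map F X \<in> Ob D) \<and>
     (\<forall>X\<in>Ob C. \<forall>Y\<in>Ob C. \<forall>f\<in>Mor C X Y. mor_map F X Y f \<in> Mor D (obj_map F X) (obj_map F Y)) \<and>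
     (\<forall>X\<in>Ob C. mor_map F X X (Id C X) = Id D (obj_map F X)) \<and>
     (\<forall>X\<in>Ob C. \<forall>Y\<in>Ob C. \<forall>Z\<in>Ob C. \<forall>f\<in>Mor C X Y. \<forall>g\<in>Mor C Y Z.
        mor_map F X Z (Comp C X Y Z g f) =
        Comp D (obj_map F X) (obj_map F Y) (obj_map F Z) (mor_map F Y Z g) (mor_map F X Y f))"

text \<open>\<^term>\<open>adjunction C D F G \<phi>\<close>: the functor \<open>F : C \<rightarrow> D\<close> is left adjoint to \<open>G : D \<rightarrow> C\<close> through the
  bijections \<open>\<phi> X Y : Mor D (F X) Y \<rightarrow> Mor C X (G Y)\<close>, natural in \<open>X\<close> and \<open>Y\<close>.\<close>

definition adjunction ::
  "('o, 'a) category \<Rightarrow> ('p, 'b) category \<Rightarrow> ('o, 'a, 'p, 'b) functor_data \<Rightarrow>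
   ('p, 'b, 'o, 'a) functor_data \<Rightarrow> ('o \<Rightarrow> 'p \<Rightarrow> 'b \<Rightarrow> 'a) \<Rightarrow> bool" where
  "adjunction C D F G \<phi> \<longleftrightarrow>
     is_functor C D F \<and> is_functor D C G \<and>
     (\<forall>X\<in>Ob C. \<forall>Y\<in>Ob D. bij_betw (\<phi> X Y) (Mor D (obj_map F X) Y) (Mor C X (obj_map G Y))) \<and>
     (\<forall>X\<in>Ob C. \<forall>X'\<in>Ob C. \<forall>Y\<in>Ob D. \<forall>Y'\<in>Ob D.
        \<forall>f\<in>Mor C X' X. \<forall>g\<in>Mor D Y Y'. \<forall>u\<in>Mor D (obj_map F X) Y.
          \<phi> X' Y' (Comp D (obj_map F X') Y Y' g (Comp D (obj_map F X') (obj_map F X) Y u (mor_map F X' X f))) =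
          Comp C X' (obj_map G Y) (obj_map G Y') (mor_map G Y Y' g) (Comp C X' X (obj_map G Y) (\<phi> X Y u) f))"

definition has_right_adjoint ::
  "('o, 'a) category \<Rightarrow> ('p, 'b) category \<Rightarrow> ('o, 'a, 'p, 'b) functor_data \<Rightarrow> bool" where
  "has_right_adjoint C D F \<longleftrightarrow> (\<exists>G \<phi>. adjunction C D F G \<phi>)"

definition has_left_adjoint ::
  "('o, 'a) category \<Rightarrow> ('p, 'b) category \<Rightarrow> ('o, 'a, 'p, 'b) functor_data \<Rightarrow> bool" where
  "has_left_adjoint C D F \<longleftrightarrow> (\<exists>L \<phi>. adjunction D C L F \<phi>)"


section \<open>The universe\<close>

text \<open>The type \<open>'u\<close> serves as a universe: its small subsets are those of cardinality less than
  \<open>|'u|\<close>. All that is required is that \<open>|'u|\<close> is an uncountable strong limit cardinal, which holds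
  in particular for every Grothendieck universe with an infinite element. It makes the category of
  small augmented algebras closed under \<open>Ext\<^sup>*(k,k)\<close>, whose cardinality is in general
  that of a power set.\<close>

abbreviation small :: "'u set \<Rightarrow> bool" where
  "small A \<equiv> A \<prec> (UNIV :: 'u set)"

definition universe :: "'u itself \<Rightarrow> bool" where
  "universe _ \<longleftrightarrow> (UNIV :: nat set) \<prec> (UNIV :: 'u set) \<and>
     (\<forall>A :: 'u set. small A \<longrightarrow> Pow A \<prec> (UNIV :: 'u set))"


section \<open>The category of augmented algebras\<close>

record ('k, 'u) aug_alg = "('k, 'u) module" +
  aug :: "'u \<Rightarrow> 'k"

text \<open>The locale \<^locale>\<open>algebra\<close> of the library is not used, as it is restricted to commutative
  algebras.\<close>

definition augmented_algebra :: "('k, 'm) ring_scheme \<Rightarrow> ('k, 'u) aug_alg \<Rightarrow> bool" where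
  "augmented_algebra K \<Lambda> \<longleftrightarrow>
     ring \<Lambda> \<and> module K \<Lambda> \<and>
     (\<forall>c\<in>carrier K. \<forall>x\<in>carrier \<Lambda>. \<forall>y\<in>carrier \<Lambda>.
        c \<odot>\<^bsub>\<Lambda>\<^esub> (x \<otimes>\<^bsub>\<Lambda>\<^esub> y) = (c \<odot>\<^bsub>\<Lambda>\<^esub> x) \<otimes>\<^bsub>\<Lambda>\<^esub> y \<and>
        c \<odot>\<^bsub>\<Lambda>\<^esub> (x \<otimes>\<^bsub>\<Lambda>\<^esub> y) = x \<otimes>\<^bsub>\<Lambda>\<^esub> (c \<odot>\<^bsub>\<Lambda>\<^esub> y)) \<and>
     aug \<Lambda> \<in> ring_hom \<Lambda> K \<and>
     (\<forall>c\<in>carrier K. \<forall>x\<in>carrier \<Lambda>. aug \<Lambda> (c \<odot>\<^bsub>\<Lambda>\<^esub> x) = c \<otimes>\<^bsub>K\<^esub> aug \<Lambda> x)"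

definition aug_hom ::
  "('k, 'm) ring_scheme \<Rightarrow> ('k, 'u) aug_alg \<Rightarrow> ('k, 'u) aug_alg \<Rightarrow> ('u \<Rightarrow> 'u) set" where
  "aug_hom K \<Lambda> \<Gamma> =
     {f \<in> extensional (carrier \<Lambda>). f \<in> ring_hom \<Lambda> \<Gamma> \<and>
        (\<forall>c\<in>carrier K. \<forall>x\<in>carrier \<Lambda>. f (c \<odot>\<^bsub>\<Lambda>\<^esub> x) = c \<odot>\<^bsub>\<Gamma>\<^esub> f x) \<and>
        (\<forall>x\<in>carrier \<Lambda>. aug \<Gamma> (f x) = aug \<Lambda> x)}"

definition aug_cat :: "('k, 'm) ring_scheme \<Rightarrow> (('k, 'u) aug_alg, 'u \<Rightarrow> 'u) category" where
  "aug_cat K =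
     \<lparr>Ob = {\<Lambda>. augmented_algebra K \<Lambda> \<and> small (carrier \<Lambda>)},
      Mor = aug_hom K,
      Id = (\<lambda>\<Lambda>. restrict id (carrier \<Lambda>)),
      Comp = (\<lambda>\<Lambda> \<Gamma> \<Delta> g f. compose (carrier \<Lambda>) g f)\<rparr>"

lemma is_category_aug_cat:
  fixes K :: "('k, 'm) ring_scheme"
  shows "is_category (aug_cat K :: (('k, 'u) aug_alg, 'u \<Rightarrow> 'u) category)"
proof -
  have comp: "compose (carrier X) g f \<in> aug_hom K X Z"
    if fg: "f \<in> aug_hom K X Y" "g \<in> aug_hom K Y Z" and X: "augmented_algebra K X"
    for X Y Z :: "('k, 'u) aug_alg" and f g
  proof -
    interpret X: ring X using X by (simp add: augmented_algebra_def)
    interpret M: module K X using X by (simp add: augmented_algebra_def)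
    show ?thesis
      using fg by (auto simp: aug_hom_def compose_def ring_hom_def Pi_iff)
  qed
  have ident: "restrict id (carrier X) \<in> aug_hom K X X" if X: "augmented_algebra K X"
    for X :: "('k, 'u) aug_alg"
  proof -
    interpret X: ring X using X by (simp add: augmented_algebra_def)
    interpret M: module K X using X by (simp add: augmented_algebra_def)
    show ?thesis by (auto simp: aug_hom_def ring_hom_def)
  qed
  have carr: "f x \<in> carrier Y" if "f \<in> aug_hom K X Y" "x \<in> carrier X"
    for X Y :: "('k, 'u) aug_alg" and f x
    using that by (auto simp: aug_hom_def ring_hom_def)
  have ext: "f x = undefined" if "f \<in> aug_hom K X Y" "x \<notin> carrier X"
    for X Y :: "('k, 'u) aug_alg" and f x
    using that by (auto simp: aug_hom_def extensional_def)
  show ?thesis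
    unfolding is_category_def aug_cat_def
    by (auto simp: comp ident fun_eq_iff carr ext) (auto simp: compose_def fun_eq_iff carr ext)
qed


section \<open>Modules and Yoneda extensions\<close>

text \<open>Left modules over a not necessarily commutative ring (the library locale \<^locale>\<open>module\<close>
  assumes commutativity). As for \<^locale>\<open>module\<close>, the fields \<open>mult\<close> and \<open>one\<close> of the module
  record are ignored.\<close>

definition left_module :: "('r, 'm) ring_scheme \<Rightarrow> ('r, 'a) module \<Rightarrow> bool" where
  "left_module R M \<longleftrightarrow>
     ring R \<and> abelian_group M \<and>
     (\<forall>r\<in>carrier R. \<forall>x\<in>carrier M. r \<odot>\<^bsub>M\<^esub> x \<in> carrier M) \<and>
     (\<forall>r\<in>carrier R. \<forall>s\<in>carrier R. \<forall>x\<in>carrier M.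
        (r \<oplus>\<^bsub>R\<^esub> s) \<odot>\<^bsub>M\<^esub> x = r \<odot>\<^bsub>M\<^esub> x \<oplus>\<^bsub>M\<^esub> s \<odot>\<^bsub>M\<^esub> x) \<and>
     (\<forall>r\<in>carrier R. \<forall>x\<in>carrier M. \<forall>y\<in>carrier M.
        r \<odot>\<^bsub>M\<^esub> (x \<oplus>\<^bsub>M\<^esub> y) = r \<odot>\<^bsub>M\<^esub> x \<oplus>\<^bsub>M\<^esub> r \<odot>\<^bsub>M\<^esub> y) \<and>
     (\<forall>r\<in>carrier R. \<forall>s\<in>carrier R. \<forall>x\<in>carrier M.
        (r \<otimes>\<^bsub>R\<^esub> s) \<odot>\<^bsub>M\<^esub> x = r \<odot>\<^bsub>M\<^esub> (s \<odot>\<^bsub>M\<^esub> x)) \<and>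
     (\<forall>x\<in>carrier M. \<one>\<^bsub>R\<^esub> \<odot>\<^bsub>M\<^esub> x = x)"

definition lin_maps ::
  "('r, 'm) ring_scheme \<Rightarrow> ('r, 'a) module \<Rightarrow> ('r, 'b) module \<Rightarrow> ('a \<Rightarrow> 'b) set" where
  "lin_maps R M N =
     {f \<in> carrier M \<rightarrow> carrier N.
        (\<forall>x\<in>carrier M. \<forall>y\<in>carrier M. f (x \<oplus>\<^bsub>M\<^esub> y) = f x \<oplus>\<^bsub>N\<^esub> f y) \<and>
        (\<forall>r\<in>carrier R. \<forall>x\<in>carrier M. f (r \<odot>\<^bsub>M\<^esub> x) = r \<odot>\<^bsub>N\<^esub> f x)}"

definition direct_sum :: "('r, 'a) module \<Rightarrow> ('r, 'b) module \<Rightarrow> ('r, 'a \<times> 'b) module" where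
  "direct_sum M N =
     \<lparr>carrier = carrier M \<times> carrier N, mult = undefined, one = undefined,
      zero = (\<zero>\<^bsub>M\<^esub>, \<zero>\<^bsub>N\<^esub>),
      add = (\<lambda>(x, y) (x', y'). (x \<oplus>\<^bsub>M\<^esub> x', y \<oplus>\<^bsub>N\<^esub> y')),
      smult = (\<lambda>r (x, y). (r \<odot>\<^bsub>M\<^esub> x, r \<odot>\<^bsub>N\<^esub> y))\<rparr>"

text \<open>An \<open>n\<close>-extension of \<open>A\<close> by \<open>B\<close> is, for \<open>n > 0\<close>, an exact sequence
  \<open>0 \<rightarrow> B \<rightarrow> N (n-1) \<rightarrow> \<dots> \<rightarrow> N 0 \<rightarrow> A \<rightarrow> 0\<close>, written \<open>Seq N d i p\<close> with \<open>i : B \<rightarrow> N (n-1)\<close>,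
  \<open>d j : N (j+1) \<rightarrow> N j\<close> and \<open>p : N 0 \<rightarrow> A\<close>. For \<open>n = 0\<close> it is a linear map \<open>A \<rightarrow> B\<close>, in accordance
  with \<open>Ext\<^sup>0 = Hom\<close>. The values of \<open>N\<close> and \<open>d\<close> beyond the length of the sequence are irrelevant.\<close>

datatype ('u, 'a, 'b) extn =
    Hom "'a \<Rightarrow> 'b"
  | Seq "nat \<Rightarrow> ('u, 'u) module" "nat \<Rightarrow> 'u \<Rightarrow> 'u" "'b \<Rightarrow> 'u" "'u \<Rightarrow> 'a"

fun is_ext ::
  "('u, 'm) ring_scheme \<Rightarrow> nat \<Rightarrow> ('u, 'a) module \<Rightarrow> ('u, 'b) module \<Rightarrow> ('u, 'a, 'b) extn \<Rightarrow> bool" where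
  "is_ext \<Lambda> n A B (Hom f) \<longleftrightarrow> n = 0 \<and> f \<in> lin_maps \<Lambda> A B"
| "is_ext \<Lambda> n A B (Seq N d i p) \<longleftrightarrow>
     0 < n \<and>
     (\<forall>j<n. left_module \<Lambda> (N j) \<and> small (carrier (N j))) \<and>
     i \<in> lin_maps \<Lambda> B (N (n - 1)) \<and>
     (\<forall>j. Suc j < n \<longrightarrow> d j \<in> lin_maps \<Lambda> (N (Suc j)) (N j)) \<and>
     p \<in> lin_maps \<Lambda> (N 0) A \<and>
     inj_on i (carrier B) \<and>
     p ` carrier (N 0) = carrier A \<and>
     (\<forall>j<n. (if Suc j = n then i ` carrier B else d j ` carrier (N (Suc j))) =
            {x \<in> carrier (N j). if j = 0 then p x = \<zero>\<^bsub>A\<^esub> else d (j - 1) x = \<zero>\<^bsub>N (j - 1)\<^esub>})"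

text \<open>\<^term>\<open>ext_mor \<Lambda> n A B A' B' a b S T\<close>: there is a morphism of extensions from \<open>S\<close> (of \<open>A\<close> by
  \<open>B\<close>) to \<open>T\<close> (of \<open>A'\<close> by \<open>B'\<close>) which is \<open>a : A \<rightarrow> A'\<close> on the right end and \<open>b : B \<rightarrow> B'\<close> on the
  left end.\<close>

fun ext_mor_comp ::
  "('u, 'm) ring_scheme \<Rightarrow> nat \<Rightarrow> ('u, 'a) module \<Rightarrow> ('u, 'b) module \<Rightarrow>
   ('a \<Rightarrow> 'c) \<Rightarrow> ('b \<Rightarrow> 'd) \<Rightarrow> ('u, 'a, 'b) extn \<Rightarrow> ('u, 'c, 'd) extn \<Rightarrow> bool" where
  "ext_mor_comp \<Lambda> n A B a b (Hom f) (Hom g) \<longleftrightarrow> (\<forall>x\<in>carrier A. b (f x) = g (a x))"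
| "ext_mor_comp \<Lambda> n A B a b (Seq N d i p) (Seq N' d' i' p') \<longleftrightarrow>
     (\<exists>h. (\<forall>j<n. h j \<in> lin_maps \<Lambda> (N j) (N' j)) \<and>
          (\<forall>y\<in>carrier B. h (n - 1) (i y) = i' (b y)) \<and>
          (\<forall>j. Suc j < n \<longrightarrow> (\<forall>x\<in>carrier (N (Suc j)). h j (d j x) = d' j (h (Suc j) x))) \<and>
          (\<forall>x\<in>carrier (N 0). a (p x) = p' (h 0 x)))"
| "ext_mor_comp \<Lambda> n A B a b _ _ \<longleftrightarrow> False"

definition ext_mor ::
  "('u, 'm) ring_scheme \<Rightarrow> nat \<Rightarrow> ('u, 'a) module \<Rightarrow> ('u, 'b) module \<Rightarrow>
   ('u, 'c) module \<Rightarrow> ('u, 'd) module \<Rightarrow>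
   ('a \<Rightarrow> 'c) \<Rightarrow> ('b \<Rightarrow> 'd) \<Rightarrow> ('u, 'a, 'b) extn \<Rightarrow> ('u, 'c, 'd) extn \<Rightarrow> bool" where
  "ext_mor \<Lambda> n A B A' B' a b S T \<longleftrightarrow>
     is_ext \<Lambda> n A B S \<and> is_ext \<Lambda> n A' B' T \<and> ext_mor_comp \<Lambda> n A B a b S T"

text \<open>Yoneda equivalence is the equivalence relation generated by the morphisms which are the
  identity on both ends.\<close>

definition ext_class ::
  "('u, 'm) ring_scheme \<Rightarrow> nat \<Rightarrow> ('u, 'a) module \<Rightarrow> ('u, 'b) module \<Rightarrow>
   ('u, 'a, 'b) extn \<Rightarrow> ('u, 'a, 'b) extn set" where
  "ext_class \<Lambda> n A B S =
     {T. is_ext \<Lambda> n A B T \<and> equivclp (ext_mor \<Lambda> n A B A B id id) S T}"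

definition ext_classes ::
  "('u, 'm) ring_scheme \<Rightarrow> nat \<Rightarrow> ('u, 'a) module \<Rightarrow> ('u, 'b) module \<Rightarrow> ('u, 'a, 'b) extn set set" where
  "ext_classes \<Lambda> n A B = ext_class \<Lambda> n A B ` {S. is_ext \<Lambda> n A B S}"


section \<open>The algebra \<open>Ext\<^sup>*(k,k)\<close>\<close>

definition trivial_module :: "('k, 'm) ring_scheme \<Rightarrow> ('k, 'u) aug_alg \<Rightarrow> ('u, 'k) module" where
  "trivial_module K \<Lambda> =
     \<lparr>carrier = carrier K, mult = mult K, one = one K, zero = zero K, add = add K,
      smult = (\<lambda>r c. aug \<Lambda> r \<otimes>\<^bsub>K\<^esub> c)\<rparr>"

text \<open>The class of \<open>S\<close> is \<open>b\<^sub>*[D]\<close> as soon as there is a morphism \<open>D \<rightarrow> S\<close> which is \<open>b\<close> on the left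
  end and the identity on the right end. Scalars act on \<open>Ext\<^sup>n(k,k)\<close> by \<open>(c\<cdot>)\<^sub>*\<close>, and the zero class is
  the image of \<open>0\<^sub>*\<close>.\<close>

definition ext_push ::
  "('k, 'm) ring_scheme \<Rightarrow> ('k, 'u) aug_alg \<Rightarrow> nat \<Rightarrow> ('k \<Rightarrow> 'k) \<Rightarrow>
   ('u, 'k, 'k) extn set \<Rightarrow> ('u, 'k, 'k) extn set" where
  "ext_push K \<Lambda> n b \<alpha> = (let k = trivial_module K \<Lambda> in
     \<Union> {ext_class \<Lambda> n k k T | S T. S \<in> \<alpha> \<and> ext_mor \<Lambda> n k k k k id b S T})"

definition ext_zero ::
  "('k, 'm) ring_scheme \<Rightarrow> ('k, 'u) aug_alg \<Rightarrow> nat \<Rightarrow> ('u, 'k, 'k) extn set" where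
  "ext_zero K \<Lambda> n = (let k = trivial_module K \<Lambda> in
     ext_push K \<Lambda> n (\<lambda>_. \<zero>\<^bsub>K\<^esub>) {S. is_ext \<Lambda> n k k S})"

text \<open>The Baer sum of the classes of \<open>S\<close> and \<open>T\<close> is \<open>\<nabla>\<^sub>* \<Delta>\<^sup>* [S \<oplus> T]\<close>. A morphism
  \<open>D \<rightarrow> S \<oplus> T\<close> from an extension of \<open>k\<close> by \<open>k \<oplus> k\<close> that is the identity on the left end and \<open>\<Delta>\<close> on
  the right end is the same as a pair of morphisms \<open>D \<rightarrow> S\<close>, \<open>D \<rightarrow> T\<close> over the two projections
  \<open>k \<oplus> k \<rightarrow> k\<close> and the identity of \<open>k\<close>.\<close>

definition baer_sum ::
  "('k, 'm) ring_scheme \<Rightarrow> ('k, 'u) aug_alg \<Rightarrow> nat \<Rightarrow>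
   ('u, 'k, 'k) extn set \<Rightarrow> ('u, 'k, 'k) extn set \<Rightarrow> ('u, 'k, 'k) extn set" where
  "baer_sum K \<Lambda> n \<alpha> \<beta> = (let k = trivial_module K \<Lambda>; kk = direct_sum k k in
     \<Union> {ext_class \<Lambda> n k k U | S T D U. S \<in> \<alpha> \<and> T \<in> \<beta> \<and>
          ext_mor \<Lambda> n k kk k k id fst D S \<and>
          ext_mor \<Lambda> n k kk k k id snd D T \<and>
          ext_mor \<Lambda> n k kk k k id (\<lambda>(x, y). x \<oplus>\<^bsub>K\<^esub> y) D U})"

definition ext_module ::
  "('k, 'm) ring_scheme \<Rightarrow> ('k, 'u) aug_alg \<Rightarrow> nat \<Rightarrow> ('k, ('u, 'k, 'k) extn set) module" where
  "ext_module K \<Lambda> n =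
     \<lparr>carrier = ext_classes \<Lambda> n (trivial_module K \<Lambda>) (trivial_module K \<Lambda>),
      mult = undefined, one = undefined,
      zero = ext_zero K \<Lambda> n,
      add = baer_sum K \<Lambda> n,
      smult = (\<lambda>c. ext_push K \<Lambda> n (\<lambda>x. c \<otimes>\<^bsub>K\<^esub> x))\<rparr>"

text \<open>\<^term>\<open>yoneda_comp \<Lambda> k m n S T U\<close>: the extension \<open>U\<close> represents the Yoneda product of \<open>S\<close> in degree
  \<open>m\<close> and \<open>T\<close> in degree \<open>n\<close>. In positive degrees the sequences are spliced,
  \<open>0 \<rightarrow> k \<rightarrow> S \<rightarrow> T \<rightarrow> k \<rightarrow> 0\<close>; the product with a map \<open>k \<rightarrow> k\<close> is the push-out of \<open>T\<close>,
  respectively the pull-back of \<open>S\<close>, along that map.\<close>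

fun yoneda_comp ::
  "('u, 'm) ring_scheme \<Rightarrow> ('u, 'k) module \<Rightarrow> nat \<Rightarrow> nat \<Rightarrow>
   ('u, 'k, 'k) extn \<Rightarrow> ('u, 'k, 'k) extn \<Rightarrow> ('u, 'k, 'k) extn \<Rightarrow> bool" where
  "yoneda_comp \<Lambda> k m n (Hom f) T U \<longleftrightarrow> ext_mor \<Lambda> n k k k k id f T U"
| "yoneda_comp \<Lambda> k m n (Seq N d i p) (Hom g) U \<longleftrightarrow> ext_mor \<Lambda> m k k k k g id U (Seq N d i p)"
| "yoneda_comp \<Lambda> k m n (Seq N d i p) (Seq N' d' i' p') U \<longleftrightarrow>
     U = Seq (\<lambda>j. if j < n then N' j else N (j - n))
             (\<lambda>j. if Suc j < n then d' j else if Suc j = n then i' \<circ> p else d (j - n))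
             i p'"

definition yoneda_product ::
  "('k, 'm) ring_scheme \<Rightarrow> ('k, 'u) aug_alg \<Rightarrow> nat \<Rightarrow> nat \<Rightarrow>
   ('u, 'k, 'k) extn set \<Rightarrow> ('u, 'k, 'k) extn set \<Rightarrow> ('u, 'k, 'k) extn set" where
  "yoneda_product K \<Lambda> m n \<alpha> \<beta> = (let k = trivial_module K \<Lambda> in
     \<Union> {ext_class \<Lambda> (m + n) k k U | S T U. S \<in> \<alpha> \<and> T \<in> \<beta> \<and> yoneda_comp \<Lambda> k m n S T U})"

text \<open>The direct sum of the \<open>Ext\<^sup>n(k,k)\<close>, that is, families of finite support. The augmentation takes
  the class of \<open>f : k \<rightarrow> k\<close> in degree \<open>0\<close> to the scalar \<open>f 1\<close>.\<close>

definition ext_algebra ::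
  "('k, 'm) ring_scheme \<Rightarrow> ('k, 'u) aug_alg \<Rightarrow> ('k, nat \<Rightarrow> ('u, 'k, 'k) extn set) aug_alg" where
  "ext_algebra K \<Lambda> =
     \<lparr>carrier = {x. (\<forall>n. x n \<in> carrier (ext_module K \<Lambda> n)) \<and> finite {n. x n \<noteq> \<zero>\<^bsub>ext_module K \<Lambda> n\<^esub>}},
      mult = (\<lambda>x y n. finsum (ext_module K \<Lambda> n) (\<lambda>i. yoneda_product K \<Lambda> i (n - i) (x i) (y (n - i))) {..n}),
      one = (\<lambda>n. if n = 0 then ext_class \<Lambda> 0 (trivial_module K \<Lambda>) (trivial_module K \<Lambda>) (Hom id)
                 else \<zero>\<^bsub>ext_module K \<Lambda> n\<^esub>),
      zero = (\<lambda>n. \<zero>\<^bsub>ext_module K \<Lambda> n\<^esub>),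
      add = (\<lambda>x y n. x n \<oplus>\<^bsub>ext_module K \<Lambda> n\<^esub> y n),
      smult = (\<lambda>c x n. c \<odot>\<^bsub>ext_module K \<Lambda> n\<^esub> x n),
      aug = (\<lambda>x. THE c. \<exists>f. Hom f \<in> x 0 \<and> c = f \<one>\<^bsub>K\<^esub>)\<rparr>"

text \<open>Change of rings along \<open>f : \<Lambda> \<rightarrow> \<Gamma>\<close>.\<close>

fun restrict_scalars :: "('u \<Rightarrow> 'u) \<Rightarrow> ('u, 'a, 'b) extn \<Rightarrow> ('u, 'a, 'b) extn" where
  "restrict_scalars f (Hom g) = Hom g"
| "restrict_scalars f (Seq N d i p) =
     Seq (\<lambda>j. (N j)\<lparr>smult := (\<lambda>r x. f r \<odot>\<^bsub>N j\<^esub> x)\<rparr>) d i p"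

definition ext_map ::
  "('k, 'm) ring_scheme \<Rightarrow> ('k, 'u) aug_alg \<Rightarrow> ('u \<Rightarrow> 'u) \<Rightarrow>
   (nat \<Rightarrow> ('u, 'k, 'k) extn set) \<Rightarrow> nat \<Rightarrow> ('u, 'k, 'k) extn set" where
  "ext_map K \<Lambda> f x = (\<lambda>n. let k = trivial_module K \<Lambda> in
     \<Union> (ext_class \<Lambda> n k k ` restrict_scalars f ` x n))"


section \<open>The functor \<open>E\<close>\<close>

text \<open>The elements of \<^term>\<open>ext_algebra K \<Lambda>\<close> are families of equivalence classes and thus do not belong
  to \<open>'u\<close>; the algebra is carried over to a subset of \<open>'u\<close> along a chosen injection. This
  determines \<open>E\<close> up to natural isomorphism.\<close>

definition transport :: "('a \<Rightarrow> 'b) \<Rightarrow> ('k, 'a) aug_alg \<Rightarrow> ('k, 'b) aug_alg" where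
  "transport h X = (let h' = inv_into (carrier X) h in
     \<lparr>carrier = h ` carrier X,
      mult = (\<lambda>x y. h (h' x \<otimes>\<^bsub>X\<^esub> h' y)),
      one = h \<one>\<^bsub>X\<^esub>,
      zero = h \<zero>\<^bsub>X\<^esub>,
      add = (\<lambda>x y. h (h' x \<oplus>\<^bsub>X\<^esub> h' y)),
      smult = (\<lambda>c x. h (c \<odot>\<^bsub>X\<^esub> h' x)),
      aug = (\<lambda>x. aug X (h' x))\<rparr>)"

definition ext_embedding ::
  "('k, 'm) ring_scheme \<Rightarrow> ('k, 'u) aug_alg \<Rightarrow> (nat \<Rightarrow> ('u, 'k, 'k) extn set) \<Rightarrow> 'u" where
  "ext_embedding K \<Lambda> = (SOME h. inj_on h (carrier (ext_algebra K \<Lambda>)))"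

definition E_functor ::
  "('k, 'm) ring_scheme \<Rightarrow>
   (('k, 'u) aug_alg, 'u \<Rightarrow> 'u, ('k, 'u) aug_alg, 'u \<Rightarrow> 'u) functor_data" where
  "E_functor K =
     \<lparr>obj_map = (\<lambda>\<Lambda>. transport (ext_embedding K \<Lambda>) (ext_algebra K \<Lambda>)),
      mor_map = (\<lambda>\<Lambda> \<Gamma> f. \<lambda>x \<in> ext_embedding K \<Gamma> ` carrier (ext_algebra K \<Gamma>).
        ext_embedding K \<Lambda>
          (ext_map K \<Lambda> f (inv_into (carrier (ext_algebra K \<Gamma>)) (ext_embedding K \<Gamma>) x)))\<rparr>"

end

theory Submission
  imports Defs
begin

text \<open>Left adjoints preserve epimorphisms and right adjoints preserve monomorphisms. So, read with values
  in augmented algebras, a functor \<open>E\<close> with a right adjoint turns every epimorphism \<open>Z \<rightarrow> X\<close> into a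
  monomorphism \<open>E X \<rightarrow> E Z\<close>, and a functor \<open>E\<close> with a left adjoint turns every monomorphism
  \<open>X \<rightarrow> P\<close> into an epimorphism \<open>E P \<rightarrow> E X\<close>. Both fail for the dual numbers \<open>X = k[x]/x\<^sup>2\<close>, whose
  Ext algebra has a one-dimensional component in every degree.

  For the right adjoint, take \<open>Z = k[x]/x\<^sup>3\<close> with its projection onto \<open>X\<close>. Change of rings along
  it kills \<open>Ext\<^sup>2\<close>: all 2-extensions over \<open>X\<close>, regarded over \<open>Z\<close>, receive a morphism from one and
  the same extension (\<open>degree_two_vanishes_on_cubic_cover\<close>). A monomorphism of augmented algebras
  sends only scalars to scalars (\<open>mono_arrow_to_scalar\<close>), so \<open>E X \<rightarrow> E Z\<close> is not one.

  For the left adjoint, take \<open>P = k \<times> X\<close>, augmented through the first factor, and the injection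
  \<open>r \<mapsto> (\<epsilon> r, r)\<close>. Over \<open>P\<close> the module \<open>k\<close> is projective, being cut out by the idempotent \<open>(1, 0)\<close>,
  so only scalars of \<open>E X\<close> come from \<open>E P\<close> (\<open>product_kills_positive_degrees\<close>). A map
  with scalar image is an epimorphism only if its target consists of scalars
  (\<open>epi_arrow_from_scalars\<close>), which \<open>E X\<close> does not.

  What remains is to know \<open>E X\<close> well enough. Lifting \<open>1 \<in> k\<close> step by step through an \<open>n\<close>-extension
  over \<open>X\<close> gives \<open>e\<^sub>0, \<dots>, e\<^sub>n\<^sub>-\<^sub>1\<close> with \<open>d e\<^sub>j\<^sub>+\<^sub>1 = x e\<^sub>j\<close>, and \<open>x e\<^sub>n\<^sub>-\<^sub>1\<close> is the image of a scalar \<open>c\<close>.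
  This is the comparison of the extension with the periodic resolution
  \<open>\<dots> \<rightarrow> X \<rightarrow> X \<rightarrow> k\<close>, whose differentials are multiplication by \<open>x\<close>, and \<open>c\<close> is the resulting
  cocycle. The scalar \<open>c\<close> is well defined and determines the Yoneda class (\<open>ext_class_eq\<close>).
  Hence the elements of the Ext algebra of \<open>X\<close> are sequences of scalars; there are few enough of
  them for the transport into the universe to be injective, and
  the class with \<open>c = 1\<close> in degree two is not a scalar. That \<open>E X\<close> is an augmented algebra and that
  the maps \<open>E f\<close> are homomorphisms is contained in the functoriality that is part of an adjunction.\<close>

section \<open>Adjoints, epimorphisms and monomorphisms\<close>

definition epi_arrow :: "('o, 'a) category \<Rightarrow> 'o \<Rightarrow> 'o \<Rightarrow> 'a \<Rightarrow> bool" where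
  "epi_arrow C X Y f \<longleftrightarrow> f \<in> Mor C X Y \<and>
     (\<forall>Z\<in>Ob C. \<forall>g\<in>Mor C Y Z. \<forall>h\<in>Mor C Y Z. Comp C X Y Z g f = Comp C X Y Z h f \<longrightarrow> g = h)"

definition mono_arrow :: "('o, 'a) category \<Rightarrow> 'o \<Rightarrow> 'o \<Rightarrow> 'a \<Rightarrow> bool" where
  "mono_arrow C X Y f \<longleftrightarrow> f \<in> Mor C X Y \<and>
     (\<forall>W\<in>Ob C. \<forall>g\<in>Mor C W X. \<forall>h\<in>Mor C W X. Comp C W X Y f g = Comp C W X Y f h \<longrightarrow> g = h)"

text \<open>The adjunction bijection turns precomposition with \<open>F f\<close> into precomposition with \<open>f\<close>, where it
  can be cancelled.\<close>

lemma left_adjoint_preserves_epi: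
  assumes C: "is_category C" and D: "is_category D" and adj: "adjunction C D F G \<phi>"
    and X: "X \<in> Ob C" and Y: "Y \<in> Ob C" and f: "epi_arrow C X Y f"
  shows "epi_arrow D (obj_map F X) (obj_map F Y) (mor_map F X Y f)"
proof -
  have FF: "is_functor C D F" and GG: "is_functor D C G"
    using adj by (auto simp: adjunction_def)
  have fm: "f \<in> Mor C X Y" using f by (simp add: epi_arrow_def)
  have FX: "obj_map F X \<in> Ob D" and FY: "obj_map F Y \<in> Ob D"
    and Ff: "mor_map F X Y f \<in> Mor D (obj_map F X) (obj_map F Y)"
    using FF X Y fm by (auto simp: is_functor_def)
  have "g = h" if Z: "Z \<in> Ob D" and g: "g \<in> Mor D (obj_map F Y) Z"
    and h: "h \<in> Mor D (obj_map F Y) Z"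
    and eq: "Comp D (obj_map F X) (obj_map F Y) Z g (mor_map F X Y f)
           = Comp D (obj_map F X) (obj_map F Y) Z h (mor_map F X Y f)" for Z g h
  proof -
    have GZ: "obj_map G Z \<in> Ob C" using GG Z by (auto simp: is_functor_def)
    have idZ: "Id D Z \<in> Mor D Z Z" using D Z by (simp add: is_category_def)
    have Gid: "mor_map G Z Z (Id D Z) = Id C (obj_map G Z)"
      using GG Z by (simp add: is_functor_def)
    have bij: "bij_betw (\<phi> Y Z) (Mor D (obj_map F Y) Z) (Mor C Y (obj_map G Z))"
      using adj Y Z by (simp add: adjunction_def)
    have nat: "Comp C X Y (obj_map G Z) (\<phi> Y Z u) f
       = \<phi> X Z (Comp D (obj_map F X) (obj_map F Y) Z u (mor_map F X Y f))"
      if u: "u \<in> Mor D (obj_map F Y) Z" for u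
    proof -
      have "\<phi> Y Z u \<in> Mor C Y (obj_map G Z)" using bij u by (auto simp: bij_betw_def)
      then have 1: "Comp C X Y (obj_map G Z) (\<phi> Y Z u) f \<in> Mor C X (obj_map G Z)"
        using C X Y GZ fm by (simp add: is_category_def)
      have 2: "Comp D (obj_map F X) (obj_map F Y) Z u (mor_map F X Y f) \<in> Mor D (obj_map F X) Z"
        using D FX FY Z u Ff by (simp add: is_category_def)
      have "\<phi> X Z (Comp D (obj_map F X) Z Z (Id D Z)
              (Comp D (obj_map F X) (obj_map F Y) Z u (mor_map F X Y f)))
         = Comp C X (obj_map G Z) (obj_map G Z) (mor_map G Z Z (Id D Z))
              (Comp C X Y (obj_map G Z) (\<phi> Y Z u) f)"
        using adj X Y Z fm idZ u unfolding adjunction_def by blast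
      then show ?thesis
        using 1 2 C D X GZ FX Z Gid by (simp add: is_category_def)
    qed
    have "\<phi> Y Z g \<in> Mor C Y (obj_map G Z)" "\<phi> Y Z h \<in> Mor C Y (obj_map G Z)"
      using bij g h by (auto simp: bij_betw_def)
    moreover have "Comp C X Y (obj_map G Z) (\<phi> Y Z g) f = Comp C X Y (obj_map G Z) (\<phi> Y Z h) f"
      using nat g h eq by simp
    ultimately have "\<phi> Y Z g = \<phi> Y Z h"
      using f GZ unfolding epi_arrow_def by blast
    then show ?thesis using bij g h by (auto simp: bij_betw_def inj_on_def)
  qed
  then show ?thesis using Ff by (auto simp: epi_arrow_def)
qed

text \<open>Dually, the bijection turns postcomposition with \<open>f\<close> into postcomposition with \<open>G f\<close>.\<close>

lemma right_adjoint_preserves_mono: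
  assumes C: "is_category C" and D: "is_category D" and adj: "adjunction C D F G \<phi>"
    and X: "X \<in> Ob D" and Y: "Y \<in> Ob D" and f: "mono_arrow D X Y f"
  shows "mono_arrow C (obj_map G X) (obj_map G Y) (mor_map G X Y f)"
proof -
  have FF: "is_functor C D F" and GG: "is_functor D C G"
    using adj by (auto simp: adjunction_def)
  have fm: "f \<in> Mor D X Y" using f by (simp add: mono_arrow_def)
  have Gf: "mor_map G X Y f \<in> Mor C (obj_map G X) (obj_map G Y)"
    using GG X Y fm by (auto simp: is_functor_def)
  have "g = h" if W: "W \<in> Ob C" and g: "g \<in> Mor C W (obj_map G X)"
    and h: "h \<in> Mor C W (obj_map G X)"
    and eq: "Comp C W (obj_map G X) (obj_map G Y) (mor_map G X Y f) g
           = Comp C W (obj_map G X) (obj_map G Y) (mor_map G X Y f) h" for W g h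
  proof -
    have FW: "obj_map F W \<in> Ob D" using FF W by (auto simp: is_functor_def)
    have idW: "Id C W \<in> Mor C W W" using C W by (simp add: is_category_def)
    have Fid: "mor_map F W W (Id C W) = Id D (obj_map F W)"
      using FF W by (simp add: is_functor_def)
    have bij: "bij_betw (\<phi> W V) (Mor D (obj_map F W) V) (Mor C W (obj_map G V))"
      if "V \<in> Ob D" for V
      using adj W that by (simp add: adjunction_def)
    have nat: "\<phi> W Y (Comp D (obj_map F W) X Y f u)
       = Comp C W (obj_map G X) (obj_map G Y) (mor_map G X Y f) (\<phi> W X u)"
      if u: "u \<in> Mor D (obj_map F W) X" for u
    proof -
      have 1: "\<phi> W X u \<in> Mor C W (obj_map G X)" using bij[OF X] u by (auto simp: bij_betw_def)
      have "\<phi> W Y (Comp D (obj_map F W) X Y f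
              (Comp D (obj_map F W) (obj_map F W) X u (mor_map F W W (Id C W))))
         = Comp C W (obj_map G X) (obj_map G Y) (mor_map G X Y f)
              (Comp C W W (obj_map G X) (\<phi> W X u) (Id C W))"
        using adj X Y W fm idW u unfolding adjunction_def by blast
      moreover have "obj_map G X \<in> Ob C" using GG X by (auto simp: is_functor_def)
      ultimately show ?thesis
        using 1 u C D X W FW Fid by (simp add: is_category_def)
    qed
    have onto: "\<phi> W X ` Mor D (obj_map F W) X = Mor C W (obj_map G X)"
      using bij[OF X] by (rule bij_betw_imp_surj_on)
    have "g \<in> \<phi> W X ` Mor D (obj_map F W) X" using g onto by simp
    then obtain u where u: "g = \<phi> W X u" "u \<in> Mor D (obj_map F W) X" by (rule imageE)
    have "h \<in> \<phi> W X ` Mor D (obj_map F W) X" using h onto by simp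
    then obtain v where v: "h = \<phi> W X v" "v \<in> Mor D (obj_map F W) X" by (rule imageE)
    have "\<phi> W Y (Comp D (obj_map F W) X Y f u) = \<phi> W Y (Comp D (obj_map F W) X Y f v)"
      using nat u v eq by simp
    moreover have "Comp D (obj_map F W) X Y f u \<in> Mor D (obj_map F W) Y"
      "Comp D (obj_map F W) X Y f v \<in> Mor D (obj_map F W) Y"
      using D FW X Y fm u v by (simp_all add: is_category_def)
    ultimately have "Comp D (obj_map F W) X Y f u = Comp D (obj_map F W) X Y f v"
      using bij[OF Y] by (auto simp: bij_betw_def inj_on_def)
    then have "u = v" using f FW u v unfolding mono_arrow_def by blast
    then show ?thesis using u v by simp
  qed
  then show ?thesis using Gf by (auto simp: mono_arrow_def)
qed

lemma is_category_op: "is_category C \<Longrightarrow> is_category (op_cat C)"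
  unfolding is_category_def op_cat_def by simp

lemma epi_op_iff: "epi_arrow (op_cat C) X Y f \<longleftrightarrow> mono_arrow C Y X f"
  by (simp add: epi_arrow_def mono_arrow_def op_cat_def)

lemma mono_arrow_op_iff: "mono_arrow (op_cat C) X Y f \<longleftrightarrow> epi_arrow C Y X f"
  by (simp add: epi_arrow_def mono_arrow_def op_cat_def)


section \<open>Small sets\<close>

lemma universe_infinite:
  assumes "universe TYPE('u)"
  shows "infinite (UNIV :: 'u set)"
  using assms infinite_le_lepoll lesspoll_imp_lepoll unfolding universe_def by blast

lemma times_self_eqpoll:
  assumes "infinite A"
  shows "A \<times> A \<approx> A"
  using card_of_Times_same_infinite[OF assms] by (simp add: eqpoll_iff_card_of_ordIso)

lemma lepoll_linear: "A \<lesssim> B \<or> B \<lesssim> A"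
  using ordLeq_total[OF card_of_Well_order card_of_Well_order, of A B]
  by (simp add: lepoll_def card_of_ordLeq)

lemma times_lesspoll_universe:
  fixes A :: "'a set" and B :: "'b set"
  assumes U: "universe TYPE('u)" and A: "A \<prec> (UNIV :: 'u set)" and B: "B \<prec> (UNIV :: 'u set)"
  shows "A \<times> B \<prec> (UNIV :: 'u set)"
proof -
  have square: "C \<times> C \<prec> (UNIV :: 'u set)" if "C \<prec> (UNIV :: 'u set)" for C :: "'c set"
  proof (cases "finite C")
    case True
    then show ?thesis using universe_infinite[OF U] by (simp add: finite_lesspoll_infinite)
  next
    case False
    then show ?thesis using times_self_eqpoll that eq_lesspoll_trans by blast
  qed
  from lepoll_linear[of A B] show ?thesis
  proof
    assume "A \<lesssim> B"
    then have "A \<times> B \<lesssim> B \<times> B" by (simp add: times_lepoll_mono)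
    then show ?thesis using square[OF B] lesspoll_trans1 by blast
  next
    assume "B \<lesssim> A"
    then have "A \<times> B \<lesssim> A \<times> A" by (simp add: times_lepoll_mono)
    then show ?thesis using square[OF A] lesspoll_trans1 by blast
  qed
qed

lemma Pow_lesspoll_universe:
  fixes A :: "'a set"
  assumes U: "universe TYPE('u)" and A: "A \<prec> (UNIV :: 'u set)"
  shows "Pow A \<prec> (UNIV :: 'u set)"
proof -
  obtain f :: "'a \<Rightarrow> 'u" where f: "inj_on f A"
    using lesspoll_imp_lepoll[OF A] by (auto simp: lepoll_def)
  have "f ` A \<prec> (UNIV :: 'u set)" using f A by simp
  then have "Pow (f ` A) \<prec> (UNIV :: 'u set)" using U by (simp add: universe_def)
  moreover have "Pow A \<lesssim> Pow (f ` A)"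
    using inj_on_image_Pow[OF f] unfolding lepoll_def by blast
  ultimately show ?thesis using lesspoll_trans1 by blast
qed

text \<open>This bounds Ext algebras whose homogeneous components embed into \<open>B\<close>.\<close>

lemma sequences_lepoll_universe:
  fixes B :: "'b set"
  assumes U: "universe TYPE('u)" and B: "B \<prec> (UNIV :: 'u set)"
  shows "{s :: nat \<Rightarrow> 'b. range s \<subseteq> B} \<lesssim> (UNIV :: 'u set)"
proof -
  have "(UNIV :: nat set) \<prec> (UNIV :: 'u set)" using U by (simp add: universe_def)
  then have "Pow ((UNIV :: nat set) \<times> B) \<prec> (UNIV :: 'u set)"
    using Pow_lesspoll_universe times_lesspoll_universe U B by blast
  moreover have "{s :: nat \<Rightarrow> 'b. range s \<subseteq> B} \<lesssim> Pow ((UNIV :: nat set) \<times> B)"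
  proof -
    \<comment> \<open>a sequence is determined by its graph\<close>
    have "inj (\<lambda>s :: nat \<Rightarrow> 'b. range (\<lambda>n. (n, s n)))"
    proof (rule injI)
      fix s t :: "nat \<Rightarrow> 'b"
      assume eq: "range (\<lambda>n. (n, s n)) = range (\<lambda>n. (n, t n))"
      have "(n, s n) \<in> range (\<lambda>n. (n, t n))" for n unfolding eq[symmetric] by blast
      then show "s = t" by (intro ext) blast
    qed
    then have "inj_on (\<lambda>s. range (\<lambda>n. (n, s n))) {s :: nat \<Rightarrow> 'b. range s \<subseteq> B}"
      by (rule inj_on_subset) simp
    moreover have "(\<lambda>s. range (\<lambda>n. (n, s n))) ` {s :: nat \<Rightarrow> 'b. range s \<subseteq> B} \<subseteq> Pow (UNIV \<times> B)"
      by blast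
    ultimately show ?thesis unfolding lepoll_def by blast
  qed
  ultimately show ?thesis using lepoll_trans lesspoll_imp_lepoll by blast
qed


section \<open>Augmented algebras\<close>

locale augmented =
  fixes K :: "('k, 'm) ring_scheme" (structure) and A :: "('k, 'u) aug_alg"
  assumes augmented_algebra: "augmented_algebra K A"

sublocale augmented \<subseteq> K: cring K
  using augmented_algebra by (simp add: augmented_algebra_def module_def)

sublocale augmented \<subseteq> A: ring A
  using augmented_algebra by (simp add: augmented_algebra_def)

sublocale augmented \<subseteq> mod: module K A
  using augmented_algebra by (simp add: augmented_algebra_def)

context augmented
begin

lemma smult_mult_left:
  "\<lbrakk>c \<in> carrier K; x \<in> carrier A; y \<in> carrier A\<rbrakk> \<Longrightarrow> (c \<odot>\<^bsub>A\<^esub> x) \<otimes>\<^bsub>A\<^esub> y = c \<odot>\<^bsub>A\<^esub> (x \<otimes>\<^bsub>A\<^esub> y)"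
  using augmented_algebra by (simp add: augmented_algebra_def)

lemma smult_mult_right:
  "\<lbrakk>c \<in> carrier K; x \<in> carrier A; y \<in> carrier A\<rbrakk> \<Longrightarrow> x \<otimes>\<^bsub>A\<^esub> (c \<odot>\<^bsub>A\<^esub> y) = c \<odot>\<^bsub>A\<^esub> (x \<otimes>\<^bsub>A\<^esub> y)"
  using augmented_algebra unfolding augmented_algebra_def by metis

lemma aug_ring_hom: "aug A \<in> ring_hom A K"
  using augmented_algebra by (simp add: augmented_algebra_def)

lemma aug_closed [simp]: "x \<in> carrier A \<Longrightarrow> aug A x \<in> carrier K"
  using aug_ring_hom by (rule ring_hom_closed)

lemma aug_mult [simp]:
  "\<lbrakk>x \<in> carrier A; y \<in> carrier A\<rbrakk> \<Longrightarrow> aug A (x \<otimes>\<^bsub>A\<^esub> y) = aug A x \<otimes> aug A y"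
  using aug_ring_hom by (rule ring_hom_mult)

lemma aug_add [simp]:
  "\<lbrakk>x \<in> carrier A; y \<in> carrier A\<rbrakk> \<Longrightarrow> aug A (x \<oplus>\<^bsub>A\<^esub> y) = aug A x \<oplus> aug A y"
  using aug_ring_hom by (rule ring_hom_add)

lemma aug_one [simp]: "aug A \<one>\<^bsub>A\<^esub> = \<one>"
  using aug_ring_hom by (rule ring_hom_one)

lemma aug_smult [simp]:
  "\<lbrakk>c \<in> carrier K; x \<in> carrier A\<rbrakk> \<Longrightarrow> aug A (c \<odot>\<^bsub>A\<^esub> x) = c \<otimes> aug A x"
  using augmented_algebra by (simp add: augmented_algebra_def)

end

lemma aug_homD:
  assumes "f \<in> aug_hom K A B"
  shows "\<And>x. x \<in> carrier A \<Longrightarrow> f x \<in> carrier B"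
    and "\<And>x y. \<lbrakk>x \<in> carrier A; y \<in> carrier A\<rbrakk> \<Longrightarrow> f (x \<otimes>\<^bsub>A\<^esub> y) = f x \<otimes>\<^bsub>B\<^esub> f y"
    and "\<And>x y. \<lbrakk>x \<in> carrier A; y \<in> carrier A\<rbrakk> \<Longrightarrow> f (x \<oplus>\<^bsub>A\<^esub> y) = f x \<oplus>\<^bsub>B\<^esub> f y"
    and "f \<one>\<^bsub>A\<^esub> = \<one>\<^bsub>B\<^esub>"
    and "\<And>c x. \<lbrakk>c \<in> carrier K; x \<in> carrier A\<rbrakk> \<Longrightarrow> f (c \<odot>\<^bsub>A\<^esub> x) = c \<odot>\<^bsub>B\<^esub> f x"
    and "\<And>x. x \<in> carrier A \<Longrightarrow> aug B (f x) = aug A x"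
  using assms by (auto simp: aug_hom_def ring_hom_def)

lemma abelian_group_iso:
  assumes M: "abelian_group M" and h: "bij_betw h (carrier M) (carrier N)"
    and add: "\<And>x y. \<lbrakk>x \<in> carrier M; y \<in> carrier M\<rbrakk> \<Longrightarrow> h (x \<oplus>\<^bsub>M\<^esub> y) = h x \<oplus>\<^bsub>N\<^esub> h y"
    and zero: "h \<zero>\<^bsub>M\<^esub> = \<zero>\<^bsub>N\<^esub>"
  shows "abelian_group N"
proof -
  interpret M: abelian_group M by (rule M)
  have closed: "h x \<in> carrier N" if "x \<in> carrier M" for x
    using h that by (auto simp: bij_betw_def)
  have ex: "\<exists>x'\<in>carrier M. x = h x'" if "x \<in> carrier N" for x
    using h that by (auto simp: bij_betw_def)
  show ?thesis
  proof (rule abelian_groupI)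
    fix x y assume "x \<in> carrier N" "y \<in> carrier N"
    then show "x \<oplus>\<^bsub>N\<^esub> y \<in> carrier N" "x \<oplus>\<^bsub>N\<^esub> y = y \<oplus>\<^bsub>N\<^esub> x"
      by (auto dest!: ex simp: add[symmetric] closed M.a_comm)
  next
    show "\<zero>\<^bsub>N\<^esub> \<in> carrier N" using closed[of "\<zero>\<^bsub>M\<^esub>"] zero by simp
  next
    fix x y z assume "x \<in> carrier N" "y \<in> carrier N" "z \<in> carrier N"
    then show "x \<oplus>\<^bsub>N\<^esub> y \<oplus>\<^bsub>N\<^esub> z = x \<oplus>\<^bsub>N\<^esub> (y \<oplus>\<^bsub>N\<^esub> z)"
      by (auto dest!: ex simp: add[symmetric] closed M.a_assoc)
  next
    fix x assume "x \<in> carrier N"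
    then show "\<zero>\<^bsub>N\<^esub> \<oplus>\<^bsub>N\<^esub> x = x"
      by (auto dest!: ex simp: add[symmetric] zero[symmetric])
  next
    fix x assume "x \<in> carrier N"
    then obtain x' where "x' \<in> carrier M" "x = h x'" using ex by blast
    then show "\<exists>y\<in>carrier N. y \<oplus>\<^bsub>N\<^esub> x = \<zero>\<^bsub>N\<^esub>"
      by (intro bexI[of _ "h (\<ominus>\<^bsub>M\<^esub> x')"])
         (auto simp: add[symmetric] zero[symmetric] M.l_neg closed)
  qed
qed

lemma augmented_algebra_iso:
  assumes A: "augmented_algebra K A" and h: "bij_betw h (carrier A) (carrier B)"
    and add: "\<And>x y. \<lbrakk>x \<in> carrier A; y \<in> carrier A\<rbrakk> \<Longrightarrow> h (x \<oplus>\<^bsub>A\<^esub> y) = h x \<oplus>\<^bsub>B\<^esub> h y"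
    and zero: "h \<zero>\<^bsub>A\<^esub> = \<zero>\<^bsub>B\<^esub>"
    and mult: "\<And>x y. \<lbrakk>x \<in> carrier A; y \<in> carrier A\<rbrakk> \<Longrightarrow> h (x \<otimes>\<^bsub>A\<^esub> y) = h x \<otimes>\<^bsub>B\<^esub> h y"
    and one: "h \<one>\<^bsub>A\<^esub> = \<one>\<^bsub>B\<^esub>"
    and smult: "\<And>c x. \<lbrakk>c \<in> carrier K; x \<in> carrier A\<rbrakk> \<Longrightarrow> h (c \<odot>\<^bsub>A\<^esub> x) = c \<odot>\<^bsub>B\<^esub> h x"
    and aug: "\<And>x. x \<in> carrier A \<Longrightarrow> aug B (h x) = aug A x"
  shows "augmented_algebra K B"
proof -
  interpret A: augmented K A using A by (simp add: augmented_def)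
  have closed: "h x \<in> carrier B" if "x \<in> carrier A" for x
    using h that by (auto simp: bij_betw_def)
  have ex: "\<exists>x'\<in>carrier A. x = h x'" if "x \<in> carrier B" for x
    using h that by (auto simp: bij_betw_def)
  have ab: "abelian_group B"
    using A.A.is_abelian_group h add zero by (rule abelian_group_iso)
  have mon: "monoid B"
  proof (rule monoidI)
    show "\<one>\<^bsub>B\<^esub> \<in> carrier B" using closed[of "\<one>\<^bsub>A\<^esub>"] one by simp
  qed (auto dest!: ex simp: mult[symmetric] one[symmetric] closed A.A.m_assoc)
  have "ring B"
    by (rule ringI[OF ab mon])
       (auto dest!: ex simp: mult[symmetric] add[symmetric] closed A.A.l_distr A.A.r_distr)
  moreover have "module K B"
    by (rule moduleI[OF A.K.cring_axioms ab])
       (auto dest!: ex simp: smult[symmetric] add[symmetric] closed A.mod.smult_l_distr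
          A.mod.smult_r_distr A.mod.smult_assoc1)
  moreover have "aug B \<in> ring_hom B K"
    by (rule ring_hom_memI)
       (auto dest!: ex simp: mult[symmetric] add[symmetric] one[symmetric] aug closed)
  moreover have "aug B (c \<odot>\<^bsub>B\<^esub> x) = c \<otimes>\<^bsub>K\<^esub> aug B x" if "c \<in> carrier K" "x \<in> carrier B" for c x
    using that by (auto dest!: ex simp: smult[symmetric] aug)
  moreover have "c \<odot>\<^bsub>B\<^esub> (x \<otimes>\<^bsub>B\<^esub> y) = (c \<odot>\<^bsub>B\<^esub> x) \<otimes>\<^bsub>B\<^esub> y \<and> c \<odot>\<^bsub>B\<^esub> (x \<otimes>\<^bsub>B\<^esub> y) = x \<otimes>\<^bsub>B\<^esub> (c \<odot>\<^bsub>B\<^esub> y)"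
    if "c \<in> carrier K" "x \<in> carrier B" "y \<in> carrier B" for c x y
    using that by (auto dest!: ex simp: smult[symmetric] mult[symmetric] A.smult_mult_left
        A.smult_mult_right)
  ultimately show ?thesis unfolding augmented_algebra_def by blast
qed

lemma transport_simps:
  assumes "inj_on h (carrier A)"
  shows "carrier (transport h A) = h ` carrier A"
    and "\<one>\<^bsub>transport h A\<^esub> = h \<one>\<^bsub>A\<^esub>" and "\<zero>\<^bsub>transport h A\<^esub> = h \<zero>\<^bsub>A\<^esub>"
    and "\<And>x y. \<lbrakk>x \<in> carrier A; y \<in> carrier A\<rbrakk> \<Longrightarrow> h x \<otimes>\<^bsub>transport h A\<^esub> h y = h (x \<otimes>\<^bsub>A\<^esub> y)"
    and "\<And>x y. \<lbrakk>x \<in> carrier A; y \<in> carrier A\<rbrakk> \<Longrightarrow> h x \<oplus>\<^bsub>transport h A\<^esub> h y = h (x \<oplus>\<^bsub>A\<^esub> y)"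
    and "\<And>c x. x \<in> carrier A \<Longrightarrow> c \<odot>\<^bsub>transport h A\<^esub> h x = h (c \<odot>\<^bsub>A\<^esub> x)"
    and "\<And>x. x \<in> carrier A \<Longrightarrow> aug (transport h A) (h x) = aug A x"
  using assms by (simp_all add: transport_def Let_def)

lemma augmented_algebra_transport:
  assumes A: "augmented_algebra K A" and h: "inj_on h (carrier A)"
  shows "augmented_algebra K (transport h A)"
  using A by (rule augmented_algebra_iso[where h = h])
    (use h in \<open>auto simp: transport_simps bij_betw_def\<close>)

lemma augmented_algebra_subalgebra:
  assumes A: "augmented_algebra K A" and S: "S \<subseteq> carrier A" and one: "\<one>\<^bsub>A\<^esub> \<in> S"
    and add: "\<And>x y. \<lbrakk>x \<in> S; y \<in> S\<rbrakk> \<Longrightarrow> x \<oplus>\<^bsub>A\<^esub> y \<in> S"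
    and mult: "\<And>x y. \<lbrakk>x \<in> S; y \<in> S\<rbrakk> \<Longrightarrow> x \<otimes>\<^bsub>A\<^esub> y \<in> S"
    and smult: "\<And>c x. \<lbrakk>c \<in> carrier K; x \<in> S\<rbrakk> \<Longrightarrow> c \<odot>\<^bsub>A\<^esub> x \<in> S"
  shows "augmented_algebra K (A\<lparr>carrier := S\<rparr>)"
proof -
  interpret A: augmented K A using A by (simp add: augmented_def)
  have sub: "x \<in> carrier A" if "x \<in> S" for x using that S by blast
  have zero: "\<zero>\<^bsub>A\<^esub> \<in> S" using smult[of "\<zero>\<^bsub>K\<^esub>", OF _ one] by simp
  have neg: "\<exists>y\<in>S. y \<oplus>\<^bsub>A\<^esub> x = \<zero>\<^bsub>A\<^esub>" if "x \<in> S" for x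
  proof
    show "(\<ominus>\<^bsub>K\<^esub> \<one>\<^bsub>K\<^esub>) \<odot>\<^bsub>A\<^esub> x \<in> S" using smult that by simp
    have "(\<ominus>\<^bsub>K\<^esub> \<one>\<^bsub>K\<^esub>) \<odot>\<^bsub>A\<^esub> x \<oplus>\<^bsub>A\<^esub> \<one>\<^bsub>K\<^esub> \<odot>\<^bsub>A\<^esub> x = \<zero>\<^bsub>A\<^esub>"
      using sub[OF that]
      by (subst A.mod.smult_l_distr[symmetric]) (auto simp: A.K.l_neg)
    then show "(\<ominus>\<^bsub>K\<^esub> \<one>\<^bsub>K\<^esub>) \<odot>\<^bsub>A\<^esub> x \<oplus>\<^bsub>A\<^esub> x = \<zero>\<^bsub>A\<^esub>" using sub[OF that] by simp
  qed
  have ab: "abelian_group (A\<lparr>carrier := S\<rparr>)"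
    by (rule abelian_groupI) (use add zero neg in \<open>auto simp: sub A.A.a_ac\<close>)
  have mon: "monoid (A\<lparr>carrier := S\<rparr>)"
    by (rule monoidI) (use mult one in \<open>auto simp: sub A.A.m_assoc\<close>)
  have "ring (A\<lparr>carrier := S\<rparr>)"
    by (rule ringI[OF ab mon]) (auto simp: sub A.A.l_distr A.A.r_distr)
  moreover have "module K (A\<lparr>carrier := S\<rparr>)"
    by (rule moduleI[OF A.K.cring_axioms ab])
       (use smult in \<open>auto simp: sub A.mod.smult_l_distr A.mod.smult_r_distr A.mod.smult_assoc1\<close>)
  moreover have "aug A \<in> ring_hom (A\<lparr>carrier := S\<rparr>) K"
    by (rule ring_hom_memI) (auto simp: sub)
  ultimately show ?thesis
    by (auto simp: augmented_algebra_def sub A.smult_mult_left A.smult_mult_right)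
qed

lemma epi_arrow_cancel:
  "\<lbrakk>epi_arrow C X Y f; Z \<in> Ob C; g \<in> Mor C Y Z; h \<in> Mor C Y Z;
    Comp C X Y Z g f = Comp C X Y Z h f\<rbrakk> \<Longrightarrow> g = h"
  by (simp add: epi_arrow_def)

lemma mono_arrow_cancel:
  "\<lbrakk>mono_arrow C X Y f; W \<in> Ob C; g \<in> Mor C W X; h \<in> Mor C W X;
    Comp C W X Y f g = Comp C W X Y f h\<rbrakk> \<Longrightarrow> g = h"
  by (simp add: mono_arrow_def)

lemma Comp_aug_cat: "Comp (aug_cat K) A B C g f = compose (carrier A) g f"
  by (simp add: aug_cat_def)

lemma Mor_aug_cat: "Mor (aug_cat K) = aug_hom K"
  by (simp add: aug_cat_def)

lemma Ob_aug_cat: "A \<in> Ob (aug_cat K) \<longleftrightarrow> augmented_algebra K A \<and> small (carrier A)"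
  by (simp add: aug_cat_def)

lemma surjective_imp_epi_arrow:
  assumes f: "f \<in> aug_hom K A B" and surj: "f ` carrier A = carrier B"
  shows "epi_arrow (aug_cat K) A B f"
proof -
  have "g = h" if g: "g \<in> aug_hom K B C" and h: "h \<in> aug_hom K B C"
    and eq: "compose (carrier A) g f = compose (carrier A) h f" for C g h
  proof (rule extensionalityI[of _ "carrier B"])
    fix y assume "y \<in> carrier B"
    then obtain x where "x \<in> carrier A" "y = f x" using surj by blast
    then show "g y = h y" using fun_cong[OF eq, of x] by (simp add: compose_def)
  qed (use g h in \<open>auto simp: aug_hom_def\<close>)
  then show ?thesis using f by (auto simp: epi_arrow_def Mor_aug_cat Comp_aug_cat)
qed

lemma injective_imp_mono_arrow:
  assumes f: "f \<in> aug_hom K A B" and inj: "inj_on f (carrier A)"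
  shows "mono_arrow (aug_cat K) A B f"
proof -
  have "g = h" if g: "g \<in> aug_hom K C A" and h: "h \<in> aug_hom K C A"
    and eq: "compose (carrier C) f g = compose (carrier C) f h" for C g h
  proof (rule extensionalityI[of _ "carrier C"])
    fix y assume "y \<in> carrier C"
    then show "g y = h y"
      using fun_cong[OF eq, of y] inj aug_homD(1)[OF g] aug_homD(1)[OF h]
      by (simp add: compose_def inj_on_def)
  qed (use g h in \<open>auto simp: aug_hom_def\<close>)
  then show ?thesis using f by (auto simp: mono_arrow_def Mor_aug_cat Comp_aug_cat)
qed

text \<open>These two homomorphisms agree precisely on the scalars; they serve as test arrows below.\<close>

lemma subalgebra_inclusion_and_augmentation:
  assumes A: "augmented_algebra K A" and S: "S \<subseteq> carrier A" and one: "\<one>\<^bsub>A\<^esub> \<in> S"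
    and AS: "augmented_algebra K (A\<lparr>carrier := S\<rparr>)"
  shows "(\<lambda>u\<in>S. aug A u \<odot>\<^bsub>A\<^esub> \<one>\<^bsub>A\<^esub>) \<in> aug_hom K (A\<lparr>carrier := S\<rparr>) A"
    and "(\<lambda>u\<in>S. u) \<in> aug_hom K (A\<lparr>carrier := S\<rparr>) A"
proof -
  interpret A: augmented K A using A by (simp add: augmented_def)
  interpret S: augmented K "A\<lparr>carrier := S\<rparr>" using AS by (simp add: augmented_def)
  have sub: "x \<in> carrier A" if "x \<in> S" for x using that S by blast
  have closed: "x \<otimes>\<^bsub>A\<^esub> y \<in> S" "x \<oplus>\<^bsub>A\<^esub> y \<in> S" if "x \<in> S" "y \<in> S" for x y
    using S.A.m_closed[of x y] S.A.a_closed[of x y] that by simp_all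
  have sclosed: "c \<odot>\<^bsub>A\<^esub> x \<in> S" if "c \<in> carrier K" "x \<in> S" for c x
    using S.mod.smult_closed[of c x] that by simp
  show "(\<lambda>u\<in>S. aug A u \<odot>\<^bsub>A\<^esub> \<one>\<^bsub>A\<^esub>) \<in> aug_hom K (A\<lparr>carrier := S\<rparr>) A"
    using one by (auto simp: aug_hom_def ring_hom_def sub closed sclosed A.mod.smult_l_distr
        A.mod.smult_assoc1 A.smult_mult_left)
  show "(\<lambda>u\<in>S. u) \<in> aug_hom K (A\<lparr>carrier := S\<rparr>) A"
    using one by (auto simp: aug_hom_def ring_hom_def sub closed sclosed)
qed

text \<open>The identity of \<open>B\<close> and \<open>v \<mapsto> \<epsilon>(v) 1\<close> agree on scalars, hence after composition with \<open>f\<close>, hence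
  everywhere.\<close>

lemma epi_arrow_from_scalars:
  assumes B: "B \<in> Ob (aug_cat K)" and f: "epi_arrow (aug_cat K) A B f"
    and scal: "\<And>u. u \<in> carrier A \<Longrightarrow> \<exists>c\<in>carrier K. f u = c \<odot>\<^bsub>B\<^esub> \<one>\<^bsub>B\<^esub>"
    and v: "v \<in> carrier B"
  shows "v = aug B v \<odot>\<^bsub>B\<^esub> \<one>\<^bsub>B\<^esub>"
proof -
  interpret B: augmented K B using B by (simp add: augmented_def Ob_aug_cat)
  have "B\<lparr>carrier := carrier B\<rparr> = B" by simp
  then have homs: "(\<lambda>u\<in>carrier B. aug B u \<odot>\<^bsub>B\<^esub> \<one>\<^bsub>B\<^esub>) \<in> aug_hom K B B"
    "(\<lambda>u\<in>carrier B. u) \<in> aug_hom K B B"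
    using subalgebra_inclusion_and_augmentation[of K B "carrier B"] B.augmented_algebra by simp_all
  have "compose (carrier A) (\<lambda>u\<in>carrier B. aug B u \<odot>\<^bsub>B\<^esub> \<one>\<^bsub>B\<^esub>) f
      = compose (carrier A) (\<lambda>u\<in>carrier B. u) f"
  proof (rule extensionalityI[of _ "carrier A"])
    fix u assume u: "u \<in> carrier A"
    obtain c where c: "c \<in> carrier K" "f u = c \<odot>\<^bsub>B\<^esub> \<one>\<^bsub>B\<^esub>" using scal[OF u] by blast
    then show "compose (carrier A) (\<lambda>u\<in>carrier B. aug B u \<odot>\<^bsub>B\<^esub> \<one>\<^bsub>B\<^esub>) f u
             = compose (carrier A) (\<lambda>u\<in>carrier B. u) f u"
      using u by (simp add: compose_def)
  qed simp_all
  then have "(\<lambda>u\<in>carrier B. aug B u \<odot>\<^bsub>B\<^esub> \<one>\<^bsub>B\<^esub>) = (\<lambda>u\<in>carrier B. u)"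
    using f B homs epi_arrow_cancel[of "aug_cat K" A B f B] by (simp add: Mor_aug_cat Comp_aug_cat)
  from fun_cong[OF this, of v] show ?thesis using v by simp
qed

text \<open>The elements with scalar image form a subalgebra of \<open>A\<close>. Its inclusion and \<open>u \<mapsto> \<epsilon>(u) 1\<close> have
  the same composite with \<open>f\<close>, because \<open>f\<close> preserves augmentations, so they are equal. Using all
  elements with scalar image, not just the kernel, makes the subalgebra unital.\<close>

lemma mono_arrow_to_scalar:
  assumes A: "A \<in> Ob (aug_cat K)" and B: "B \<in> Ob (aug_cat K)"
    and f: "mono_arrow (aug_cat K) A B f"
    and u: "u \<in> carrier A" and c: "c \<in> carrier K" "f u = c \<odot>\<^bsub>B\<^esub> \<one>\<^bsub>B\<^esub>"
  shows "u = c \<odot>\<^bsub>A\<^esub> \<one>\<^bsub>A\<^esub>"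
proof -
  interpret A: augmented K A using A by (simp add: augmented_def Ob_aug_cat)
  interpret B: augmented K B using B by (simp add: augmented_def Ob_aug_cat)
  have f': "f \<in> aug_hom K A B" using f by (simp add: mono_arrow_def Mor_aug_cat)
  note f'D [simp] = aug_homD[OF f']
  define S where "S = {u \<in> carrier A. f u = aug A u \<odot>\<^bsub>B\<^esub> \<one>\<^bsub>B\<^esub>}"
  have S: "S \<subseteq> carrier A" by (auto simp: S_def)
  have one: "\<one>\<^bsub>A\<^esub> \<in> S" by (simp add: S_def)
  have AS: "augmented_algebra K (A\<lparr>carrier := S\<rparr>)"
    by (rule augmented_algebra_subalgebra[OF A.augmented_algebra S one])
       (auto simp: S_def B.mod.smult_l_distr B.mod.smult_assoc1 B.smult_mult_left)
  have "carrier (A\<lparr>carrier := S\<rparr>) \<lesssim> carrier A" using S by (simp add: subset_imp_lepoll)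
  then have "small (carrier (A\<lparr>carrier := S\<rparr>))"
    using A by (simp add: Ob_aug_cat lesspoll_trans1)
  then have ob: "A\<lparr>carrier := S\<rparr> \<in> Ob (aug_cat K)" using AS by (simp add: Ob_aug_cat)
  note homs = subalgebra_inclusion_and_augmentation[OF A.augmented_algebra S one AS]
  have "compose S f (\<lambda>u\<in>S. aug A u \<odot>\<^bsub>A\<^esub> \<one>\<^bsub>A\<^esub>) = compose S f (\<lambda>u\<in>S. u)"
    by (rule extensionalityI[of _ S]) (auto simp: compose_def S_def)
  then have "(\<lambda>u\<in>S. aug A u \<odot>\<^bsub>A\<^esub> \<one>\<^bsub>A\<^esub>) = (\<lambda>u\<in>S. u)"
    using f ob homs mono_arrow_cancel[of "aug_cat K" A B f "A\<lparr>carrier := S\<rparr>"]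
    by (simp add: Mor_aug_cat Comp_aug_cat)
  note eq = fun_cong[OF this, of u]
  have c': "c = aug A u"
    using f'D(6)[OF u] c B.aug_smult[of c "\<one>\<^bsub>B\<^esub>"] by simp
  then have "u \<in> S" using u c by (simp add: S_def)
  then show ?thesis using eq c' by simp
qed


section \<open>Left modules\<close>

locale left_mod =
  fixes R :: "('r, 'm) ring_scheme" (structure) and M :: "('r, 'a) module"
  assumes left_module: "left_module R M"

sublocale left_mod \<subseteq> R: ring R
  using left_module by (simp add: left_module_def)

sublocale left_mod \<subseteq> M: abelian_group M
  using left_module by (simp add: left_module_def)

context left_mod
begin

lemma smult_closed [simp]: "\<lbrakk>r \<in> carrier R; x \<in> carrier M\<rbrakk> \<Longrightarrow> r \<odot>\<^bsub>M\<^esub> x \<in> carrier M"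
  using left_module by (simp add: left_module_def)

lemma smult_l_distr:
  "\<lbrakk>r \<in> carrier R; s \<in> carrier R; x \<in> carrier M\<rbrakk>
     \<Longrightarrow> (r \<oplus> s) \<odot>\<^bsub>M\<^esub> x = r \<odot>\<^bsub>M\<^esub> x \<oplus>\<^bsub>M\<^esub> s \<odot>\<^bsub>M\<^esub> x"
  using left_module by (simp add: left_module_def)

lemma smult_r_distr:
  "\<lbrakk>r \<in> carrier R; x \<in> carrier M; y \<in> carrier M\<rbrakk>
     \<Longrightarrow> r \<odot>\<^bsub>M\<^esub> (x \<oplus>\<^bsub>M\<^esub> y) = r \<odot>\<^bsub>M\<^esub> x \<oplus>\<^bsub>M\<^esub> r \<odot>\<^bsub>M\<^esub> y"
  using left_module by (simp add: left_module_def)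

lemma smult_assoc:
  "\<lbrakk>r \<in> carrier R; s \<in> carrier R; x \<in> carrier M\<rbrakk>
     \<Longrightarrow> (r \<otimes> s) \<odot>\<^bsub>M\<^esub> x = r \<odot>\<^bsub>M\<^esub> (s \<odot>\<^bsub>M\<^esub> x)"
  using left_module by (simp add: left_module_def)

lemma smult_one [simp]: "x \<in> carrier M \<Longrightarrow> \<one> \<odot>\<^bsub>M\<^esub> x = x"
  using left_module by (simp add: left_module_def)

lemma smult_l_null [simp]:
  assumes "x \<in> carrier M"
  shows "\<zero> \<odot>\<^bsub>M\<^esub> x = \<zero>\<^bsub>M\<^esub>"
proof -
  have "\<zero> \<odot>\<^bsub>M\<^esub> x \<oplus>\<^bsub>M\<^esub> \<zero> \<odot>\<^bsub>M\<^esub> x = \<zero> \<odot>\<^bsub>M\<^esub> x"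
    using assms smult_l_distr[of \<zero> \<zero> x] by simp
  then show ?thesis using assms by simp
qed

lemma smult_r_null [simp]:
  assumes "r \<in> carrier R"
  shows "r \<odot>\<^bsub>M\<^esub> \<zero>\<^bsub>M\<^esub> = \<zero>\<^bsub>M\<^esub>"
proof -
  have "r \<odot>\<^bsub>M\<^esub> \<zero>\<^bsub>M\<^esub> \<oplus>\<^bsub>M\<^esub> r \<odot>\<^bsub>M\<^esub> \<zero>\<^bsub>M\<^esub> = r \<odot>\<^bsub>M\<^esub> \<zero>\<^bsub>M\<^esub>"
    using assms smult_r_distr[of r "\<zero>\<^bsub>M\<^esub>" "\<zero>\<^bsub>M\<^esub>"] by simp
  then show ?thesis using assms by simp
qed

lemma smult_r_minus:
  assumes "r \<in> carrier R" "x \<in> carrier M" "y \<in> carrier M"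
  shows "r \<odot>\<^bsub>M\<^esub> (x \<ominus>\<^bsub>M\<^esub> y) = r \<odot>\<^bsub>M\<^esub> x \<ominus>\<^bsub>M\<^esub> r \<odot>\<^bsub>M\<^esub> y"
proof -
  have "r \<odot>\<^bsub>M\<^esub> (x \<ominus>\<^bsub>M\<^esub> y) \<oplus>\<^bsub>M\<^esub> r \<odot>\<^bsub>M\<^esub> y = r \<odot>\<^bsub>M\<^esub> ((x \<ominus>\<^bsub>M\<^esub> y) \<oplus>\<^bsub>M\<^esub> y)"
    using assms by (simp add: smult_r_distr)
  also have "(x \<ominus>\<^bsub>M\<^esub> y) \<oplus>\<^bsub>M\<^esub> y = x"
    using assms by (simp add: M.minus_eq M.a_assoc M.l_neg)
  finally have "r \<odot>\<^bsub>M\<^esub> x \<ominus>\<^bsub>M\<^esub> r \<odot>\<^bsub>M\<^esub> y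
      = (r \<odot>\<^bsub>M\<^esub> (x \<ominus>\<^bsub>M\<^esub> y) \<oplus>\<^bsub>M\<^esub> r \<odot>\<^bsub>M\<^esub> y) \<ominus>\<^bsub>M\<^esub> r \<odot>\<^bsub>M\<^esub> y" by simp
  also have "\<dots> = r \<odot>\<^bsub>M\<^esub> (x \<ominus>\<^bsub>M\<^esub> y)"
    using assms by (simp add: M.minus_eq M.a_assoc M.r_neg)
  finally show ?thesis by simp
qed

end

lemma lin_mapsI:
  assumes "\<And>x. x \<in> carrier M \<Longrightarrow> f x \<in> carrier N"
    and "\<And>x y. \<lbrakk>x \<in> carrier M; y \<in> carrier M\<rbrakk> \<Longrightarrow> f (x \<oplus>\<^bsub>M\<^esub> y) = f x \<oplus>\<^bsub>N\<^esub> f y"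
    and "\<And>r x. \<lbrakk>r \<in> carrier R; x \<in> carrier M\<rbrakk> \<Longrightarrow> f (r \<odot>\<^bsub>M\<^esub> x) = r \<odot>\<^bsub>N\<^esub> f x"
  shows "f \<in> lin_maps R M N"
  using assms by (simp add: lin_maps_def)

lemma lin_mapsD:
  assumes "f \<in> lin_maps R M N"
  shows "\<And>x. x \<in> carrier M \<Longrightarrow> f x \<in> carrier N"
    and "\<And>x y. \<lbrakk>x \<in> carrier M; y \<in> carrier M\<rbrakk> \<Longrightarrow> f (x \<oplus>\<^bsub>M\<^esub> y) = f x \<oplus>\<^bsub>N\<^esub> f y"
    and "\<And>r x. \<lbrakk>r \<in> carrier R; x \<in> carrier M\<rbrakk> \<Longrightarrow> f (r \<odot>\<^bsub>M\<^esub> x) = r \<odot>\<^bsub>N\<^esub> f x"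
  using assms by (auto simp: lin_maps_def)

lemma lin_maps_comp:
  "\<lbrakk>f \<in> lin_maps R L M; g \<in> lin_maps R M N\<rbrakk> \<Longrightarrow> (\<lambda>x. g (f x)) \<in> lin_maps R L N"
  by (rule lin_mapsI) (simp_all add: lin_mapsD)

lemma lin_maps_zero:
  assumes "f \<in> lin_maps R M N" "left_module R M" "left_module R N"
  shows "f \<zero>\<^bsub>M\<^esub> = \<zero>\<^bsub>N\<^esub>"
proof -
  interpret M: left_mod R M using assms by (simp add: left_mod_def)
  interpret N: left_mod R N using assms by (simp add: left_mod_def)
  have "f \<zero>\<^bsub>M\<^esub> = f (\<zero>\<^bsub>R\<^esub> \<odot>\<^bsub>M\<^esub> \<zero>\<^bsub>M\<^esub>)" by simp
  also have "\<dots> = \<zero>\<^bsub>N\<^esub>" using lin_mapsD[OF assms(1)] by (simp del: M.smult_l_null M.smult_r_null)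
  finally show ?thesis .
qed

lemma lin_maps_minus:
  assumes f: "f \<in> lin_maps R M N" and M: "left_module R M" and N: "left_module R N"
    and xy: "x \<in> carrier M" "y \<in> carrier M"
  shows "f (x \<ominus>\<^bsub>M\<^esub> y) = f x \<ominus>\<^bsub>N\<^esub> f y"
proof -
  interpret M: left_mod R M using M by (simp add: left_mod_def)
  interpret N: left_mod R N using N by (simp add: left_mod_def)
  note f [simp] = lin_mapsD(1,2)[OF f]
  have "f (x \<ominus>\<^bsub>M\<^esub> y) \<oplus>\<^bsub>N\<^esub> f y = f ((x \<ominus>\<^bsub>M\<^esub> y) \<oplus>\<^bsub>M\<^esub> y)" using xy by simp
  also have "(x \<ominus>\<^bsub>M\<^esub> y) \<oplus>\<^bsub>M\<^esub> y = x" using xy by (simp add: M.M.minus_eq M.M.a_assoc M.M.l_neg)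
  finally have "f x \<ominus>\<^bsub>N\<^esub> f y = (f (x \<ominus>\<^bsub>M\<^esub> y) \<oplus>\<^bsub>N\<^esub> f y) \<ominus>\<^bsub>N\<^esub> f y" by simp
  also have "\<dots> = f (x \<ominus>\<^bsub>M\<^esub> y)" using xy by (simp add: N.M.minus_eq N.M.a_assoc N.M.r_neg)
  finally show ?thesis by simp
qed

definition transport_module :: "('a \<Rightarrow> 'b) \<Rightarrow> ('r, 'a) module \<Rightarrow> ('r, 'b) module" where
  "transport_module h M = (let h' = inv_into (carrier M) h in
     \<lparr>carrier = h ` carrier M, mult = undefined, one = undefined,
      zero = h \<zero>\<^bsub>M\<^esub>,
      add = (\<lambda>x y. h (h' x \<oplus>\<^bsub>M\<^esub> h' y)),
      smult = (\<lambda>r x. h (r \<odot>\<^bsub>M\<^esub> h' x))\<rparr>)"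

lemma transport_module_simps:
  assumes "inj_on h (carrier M)"
  shows "carrier (transport_module h M) = h ` carrier M"
    and "\<zero>\<^bsub>transport_module h M\<^esub> = h \<zero>\<^bsub>M\<^esub>"
    and "\<And>x y. \<lbrakk>x \<in> carrier M; y \<in> carrier M\<rbrakk>
           \<Longrightarrow> h x \<oplus>\<^bsub>transport_module h M\<^esub> h y = h (x \<oplus>\<^bsub>M\<^esub> y)"
    and "\<And>r x. x \<in> carrier M \<Longrightarrow> r \<odot>\<^bsub>transport_module h M\<^esub> h x = h (r \<odot>\<^bsub>M\<^esub> x)"
  using assms by (simp_all add: transport_module_def Let_def)

lemma left_module_transport:
  assumes M: "left_module R M" and h: "inj_on h (carrier M)"
  shows "left_module R (transport_module h M)"
proof -
  interpret M: left_mod R M using M by (simp add: left_mod_def)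
  note simps = transport_module_simps[OF h]
  have "abelian_group (transport_module h M)"
    by (rule abelian_group_iso[OF M.M.abelian_group_axioms, where h = h])
       (use h in \<open>auto simp: simps bij_betw_def\<close>)
  then show ?thesis
    by (auto simp: left_module_def simps M.R.ring_axioms M.smult_l_distr M.smult_r_distr M.smult_assoc)
qed

lemma transport_module_lin_maps:
  assumes M: "left_module R M" and h: "inj_on h (carrier M)"
  shows "h \<in> lin_maps R M (transport_module h M)"
    and "inv_into (carrier M) h \<in> lin_maps R (transport_module h M) M"
proof -
  interpret M: left_mod R M using M by (simp add: left_mod_def)
  note simps = transport_module_simps[OF h]
  show "h \<in> lin_maps R M (transport_module h M)"
    by (rule lin_mapsI) (auto simp: simps)
  show "inv_into (carrier M) h \<in> lin_maps R (transport_module h M) M"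
    by (rule lin_mapsI) (auto simp: simps h)
qed

lemma left_module_regular:
  assumes "augmented_algebra K A"
  shows "left_module A \<lparr>carrier = carrier A, mult = undefined, one = undefined,
           zero = \<zero>\<^bsub>A\<^esub>, add = add A, smult = mult A\<rparr>"
proof -
  interpret A: augmented K A using assms by (simp add: augmented_def)
  have "abelian_group \<lparr>carrier = carrier A, mult = undefined, one = undefined,
           zero = \<zero>\<^bsub>A\<^esub>, add = add A, smult = mult A\<rparr>"
    by (rule abelian_group_iso[OF A.A.abelian_group_axioms, where h = id]) auto
  then show ?thesis
    by (simp add: left_module_def A.A.ring_axioms A.A.l_distr A.A.r_distr A.A.m_assoc)
qed

lemma left_module_trivial:
  assumes "augmented_algebra K A"
  shows "left_module A (trivial_module K A)"
proof -
  interpret A: augmented K A using assms by (simp add: augmented_def)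
  have "abelian_group (trivial_module K A)"
    by (rule abelian_group_iso[OF A.K.abelian_group_axioms, where h = id])
       (auto simp: trivial_module_def)
  then show ?thesis
    by (simp add: left_module_def trivial_module_def A.A.ring_axioms A.K.l_distr A.K.r_distr
        A.K.m_assoc)
qed

lemma left_module_direct_sum:
  assumes M: "left_module R M" and N: "left_module R N"
  shows "left_module R (direct_sum M N)"
proof -
  interpret M: left_mod R M using M by (simp add: left_mod_def)
  interpret N: left_mod R N using N by (simp add: left_mod_def)
  have "abelian_group (direct_sum M N)"
  proof (rule abelian_groupI)
    fix x assume "x \<in> carrier (direct_sum M N)"
    then show "\<exists>y\<in>carrier (direct_sum M N). y \<oplus>\<^bsub>direct_sum M N\<^esub> x = \<zero>\<^bsub>direct_sum M N\<^esub>"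
      by (intro bexI[of _ "(\<ominus>\<^bsub>M\<^esub> fst x, \<ominus>\<^bsub>N\<^esub> snd x)"])
         (auto simp: direct_sum_def M.M.l_neg N.M.l_neg)
  qed (auto simp: direct_sum_def M.M.a_ac N.M.a_ac)
  then show ?thesis
    by (auto simp: left_module_def direct_sum_def M.R.ring_axioms M.smult_l_distr M.smult_r_distr
        M.smult_assoc N.smult_l_distr N.smult_r_distr N.smult_assoc)
qed

text \<open>Restriction of scalars along \<open>f\<close>, an endomap of the common carrier type of the two algebras.\<close>

definition pull_module :: "('r \<Rightarrow> 'r) \<Rightarrow> ('r, 'a) module \<Rightarrow> ('r, 'a) module" where
  "pull_module f M = M\<lparr>smult := (\<lambda>r x. f r \<odot>\<^bsub>M\<^esub> x)\<rparr>"

lemma pull_module_simps [simp]: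
  "carrier (pull_module f M) = carrier M" "zero (pull_module f M) = zero M"
  "add (pull_module f M) = add M" "smult (pull_module f M) = (\<lambda>r x. f r \<odot>\<^bsub>M\<^esub> x)"
  by (simp_all add: pull_module_def)

lemma left_module_pull:
  assumes A: "ring A" and f: "f \<in> ring_hom A B" and M: "left_module B M"
  shows "left_module A (pull_module f M)"
proof -
  interpret M: left_mod B M using M by (simp add: left_mod_def)
  have "abelian_group (pull_module f M)"
    by (rule abelian_group_iso[OF M.M.abelian_group_axioms, where h = id]) auto
  moreover have "f a \<in> carrier B" if "a \<in> carrier A" for a using ring_hom_closed[OF f that] .
  ultimately show ?thesis
    using ring_hom_mult[OF f] ring_hom_add[OF f] ring_hom_one[OF f]
    by (simp add: left_module_def A M.smult_l_distr M.smult_r_distr M.smult_assoc)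
qed

lemma lin_maps_pull:
  assumes "f \<in> ring_hom A B" "g \<in> lin_maps B M N"
  shows "g \<in> lin_maps A (pull_module f M) (pull_module f N)"
  using lin_mapsD[OF assms(2)] ring_hom_closed[OF assms(1)] by (intro lin_mapsI) simp_all


section \<open>Yoneda extensions and change of rings\<close>

text \<open>Exactness at \<open>N j\<close>: the incoming map is \<open>i\<close> at the left end \<open>j = n - 1\<close>, and the outgoing map is
  \<open>p\<close> at the right end \<open>j = 0\<close>.\<close>

definition exact_at ::
  "nat \<Rightarrow> ('u, 'a) module \<Rightarrow> ('u, 'b) module \<Rightarrow> (nat \<Rightarrow> ('u, 'u) module) \<Rightarrow> (nat \<Rightarrow> 'u \<Rightarrow> 'u) \<Rightarrow>
   ('b \<Rightarrow> 'u) \<Rightarrow> ('u \<Rightarrow> 'a) \<Rightarrow> nat \<Rightarrow> bool" where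
  "exact_at n A B N d i p j \<longleftrightarrow>
     (if Suc j = n then i ` carrier B else d j ` carrier (N (Suc j))) =
     {x \<in> carrier (N j). if j = 0 then p x = \<zero>\<^bsub>A\<^esub> else d (j - 1) x = \<zero>\<^bsub>N (j - 1)\<^esub>}"

lemma is_ext_Seq_iff:
  fixes N :: "nat \<Rightarrow> ('u, 'u) module"
  shows "is_ext \<Lambda> n A B (Seq N d i p) \<longleftrightarrow>
     0 < n \<and> (\<forall>j<n. left_module \<Lambda> (N j) \<and> small (carrier (N j))) \<and>
     i \<in> lin_maps \<Lambda> B (N (n - 1)) \<and>
     (\<forall>j. Suc j < n \<longrightarrow> d j \<in> lin_maps \<Lambda> (N (Suc j)) (N j)) \<and>
     p \<in> lin_maps \<Lambda> (N 0) A \<and> inj_on i (carrier B) \<and> p ` carrier (N 0) = carrier A \<and>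
     (\<forall>j<n. exact_at n A B N d i p j)"
  unfolding is_ext.simps exact_at_def by (rule refl)

lemma is_ext_SeqD:
  fixes N :: "nat \<Rightarrow> ('u, 'u) module"
  assumes "is_ext \<Lambda> n A B (Seq N d i p)"
  shows "0 < n" and "\<And>j. j < n \<Longrightarrow> left_module \<Lambda> (N j)" and "\<And>j. j < n \<Longrightarrow> small (carrier (N j))"
    and "i \<in> lin_maps \<Lambda> B (N (n - 1))"
    and "\<And>j. Suc j < n \<Longrightarrow> d j \<in> lin_maps \<Lambda> (N (Suc j)) (N j)"
    and "p \<in> lin_maps \<Lambda> (N 0) A" and "inj_on i (carrier B)" and "p ` carrier (N 0) = carrier A"
    and "\<And>j. j < n \<Longrightarrow> exact_at n A B N d i p j"
  using assms unfolding is_ext_Seq_iff by simp_all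

lemma aug_hom_ring_hom: "f \<in> aug_hom K A B \<Longrightarrow> f \<in> ring_hom A B"
  by (simp add: aug_hom_def)

lemma lin_maps_trivial_pull:
  assumes "f \<in> aug_hom K A B"
  shows "g \<in> lin_maps B (trivial_module K B) N \<Longrightarrow> g \<in> lin_maps A (trivial_module K A) (pull_module f N)"
    and "h \<in> lin_maps B M (trivial_module K B) \<Longrightarrow> h \<in> lin_maps A (pull_module f M) (trivial_module K A)"
    and "k \<in> lin_maps B (trivial_module K B) (trivial_module K B)
           \<Longrightarrow> k \<in> lin_maps A (trivial_module K A) (trivial_module K A)"
  using aug_homD(1,6)[OF assms]
  by (auto simp: lin_maps_def trivial_module_def) metis+

lemma restrict_scalars_Seq:
  "restrict_scalars f (Seq N d i p) = Seq (\<lambda>j. pull_module f (N j)) d i p"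
  by (simp add: pull_module_def)

lemma is_ext_restrict_scalars:
  assumes A: "augmented_algebra K A" and f: "f \<in> aug_hom K A B"
    and S: "is_ext B n (trivial_module K B) (trivial_module K B) S"
  shows "is_ext A n (trivial_module K A) (trivial_module K A) (restrict_scalars f S)"
proof -
  note r = aug_hom_ring_hom[OF f]
  have A': "ring A" using A by (simp add: augmented_algebra_def)
  have car: "carrier (trivial_module K A) = carrier (trivial_module K B)"
    and zero: "\<zero>\<^bsub>trivial_module K A\<^esub> = \<zero>\<^bsub>trivial_module K B\<^esub>"
    by (simp_all add: trivial_module_def)
  show ?thesis
  proof (cases S)
    case (Hom g)
    then show ?thesis using S lin_maps_trivial_pull(3)[OF f] by simp
  next
    case (Seq N d i p)
    note S' = is_ext_SeqD[OF S[unfolded Seq]]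
    have "exact_at n (trivial_module K A) (trivial_module K A) (\<lambda>j. pull_module f (N j)) d i p j"
      if "j < n" for j
      using S'(9)[OF that] by (simp only: exact_at_def car zero pull_module_simps)
    then show ?thesis
      unfolding Seq restrict_scalars_Seq is_ext_Seq_iff pull_module_simps car
      using S'(1,3,7,8) left_module_pull[OF A' r S'(2)] lin_maps_trivial_pull(1)[OF f S'(4)]
        lin_maps_trivial_pull(2)[OF f S'(6)] lin_maps_pull[OF r S'(5)]
      by (intro conjI allI impI) (simp_all only:)
  qed
qed

lemma exact_at_kernel:
  assumes "exact_at n A B N d i p j" "y \<in> carrier (N j)"
    and "j = 0 \<Longrightarrow> p y = \<zero>\<^bsub>A\<^esub>" "0 < j \<Longrightarrow> d (j - 1) y = \<zero>\<^bsub>N (j - 1)\<^esub>"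
  shows "Suc j = n \<Longrightarrow> \<exists>b\<in>carrier B. y = i b"
    and "Suc j \<noteq> n \<Longrightarrow> \<exists>z\<in>carrier (N (Suc j)). y = d j z"
proof -
  have "y \<in> {x \<in> carrier (N j). if j = 0 then p x = \<zero>\<^bsub>A\<^esub> else d (j - 1) x = \<zero>\<^bsub>N (j - 1)\<^esub>}"
    using assms(2-4) by auto
  then have "y \<in> (if Suc j = n then i ` carrier B else d j ` carrier (N (Suc j)))"
    using assms(1) by (simp only: exact_at_def)
  then show "Suc j = n \<Longrightarrow> \<exists>b\<in>carrier B. y = i b"
    and "Suc j \<noteq> n \<Longrightarrow> \<exists>z\<in>carrier (N (Suc j)). y = d j z"
    by auto
qed

lemma exact_at_image:
  assumes "exact_at n A B N d i p j"
  shows "\<lbrakk>Suc j = n; b \<in> carrier B; j = 0\<rbrakk> \<Longrightarrow> p (i b) = \<zero>\<^bsub>A\<^esub>"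
    and "\<lbrakk>Suc j = n; b \<in> carrier B; 0 < j\<rbrakk> \<Longrightarrow> d (j - 1) (i b) = \<zero>\<^bsub>N (j - 1)\<^esub>"
    and "\<lbrakk>Suc j \<noteq> n; z \<in> carrier (N (Suc j)); j = 0\<rbrakk> \<Longrightarrow> p (d j z) = \<zero>\<^bsub>A\<^esub>"
    and "\<lbrakk>Suc j \<noteq> n; z \<in> carrier (N (Suc j)); 0 < j\<rbrakk> \<Longrightarrow> d (j - 1) (d j z) = \<zero>\<^bsub>N (j - 1)\<^esub>"
proof -
  have *: "y \<in> {x \<in> carrier (N j). if j = 0 then p x = \<zero>\<^bsub>A\<^esub> else d (j - 1) x = \<zero>\<^bsub>N (j - 1)\<^esub>}"
    if "y \<in> (if Suc j = n then i ` carrier B else d j ` carrier (N (Suc j)))" for y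
    using that assms by (simp only: exact_at_def)
  show "\<lbrakk>Suc j = n; b \<in> carrier B; j = 0\<rbrakk> \<Longrightarrow> p (i b) = \<zero>\<^bsub>A\<^esub>"
    "\<lbrakk>Suc j = n; b \<in> carrier B; 0 < j\<rbrakk> \<Longrightarrow> d (j - 1) (i b) = \<zero>\<^bsub>N (j - 1)\<^esub>"
    using *[of "i b"] by auto
  show "\<lbrakk>Suc j \<noteq> n; z \<in> carrier (N (Suc j)); j = 0\<rbrakk> \<Longrightarrow> p (d j z) = \<zero>\<^bsub>A\<^esub>"
    "\<lbrakk>Suc j \<noteq> n; z \<in> carrier (N (Suc j)); 0 < j\<rbrakk> \<Longrightarrow> d (j - 1) (d j z) = \<zero>\<^bsub>N (j - 1)\<^esub>"
    using *[of "d j z"] by auto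
qed


section \<open>Extensions over the dual numbers\<close>

text \<open>An augmented algebra with basis \<open>1, x\<close> and \<open>\<epsilon>(x) = 0\<close>, where \<open>\<beta>\<close> is the coordinate of \<open>x\<close>. The relation
  \<open>x\<^sup>2 = 0\<close> follows, since \<open>\<beta>\<close> is a derivation along \<open>\<epsilon>\<close>. The injection \<open>pr\<close> provides small subsets of the
  universe as carriers of two-dimensional modules.\<close>

locale dual_numbers = augmented K X
  for K :: "('k, 'm) ring_scheme" (structure) and X :: "('k, 'u) aug_alg" +
  fixes x :: 'u and \<beta> :: "'u \<Rightarrow> 'k" and pr :: "'k \<times> 'k \<Rightarrow> 'u"
  assumes x_closed [simp]: "x \<in> carrier X"
    and aug_x [simp]: "aug X x = \<zero>"
    and coord_closed [simp]: "r \<in> carrier X \<Longrightarrow> \<beta> r \<in> carrier K"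
    and coord_add [simp]: "\<lbrakk>r \<in> carrier X; s \<in> carrier X\<rbrakk> \<Longrightarrow> \<beta> (r \<oplus>\<^bsub>X\<^esub> s) = \<beta> r \<oplus> \<beta> s"
    and coord_mult [simp]: "\<lbrakk>r \<in> carrier X; s \<in> carrier X\<rbrakk>
          \<Longrightarrow> \<beta> (r \<otimes>\<^bsub>X\<^esub> s) = aug X r \<otimes> \<beta> s \<oplus> \<beta> r \<otimes> aug X s"
    and coord_smult [simp]: "\<lbrakk>c \<in> carrier K; r \<in> carrier X\<rbrakk> \<Longrightarrow> \<beta> (c \<odot>\<^bsub>X\<^esub> r) = c \<otimes> \<beta> r"
    and coord_x [simp]: "\<beta> x = \<one>"
    and span: "r \<in> carrier X \<Longrightarrow> r = aug X r \<odot>\<^bsub>X\<^esub> \<one>\<^bsub>X\<^esub> \<oplus>\<^bsub>X\<^esub> \<beta> r \<odot>\<^bsub>X\<^esub> x"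
    and pr_inj: "inj_on pr (carrier K \<times> carrier K)"
    and pr_small: "small (pr ` (carrier K \<times> carrier K))"
begin

abbreviation kk :: "('u, 'k) module" where
  "kk \<equiv> trivial_module K X"

abbreviation up :: "'u \<Rightarrow> 'k \<times> 'k" where
  "up \<equiv> inv_into (carrier K \<times> carrier K) pr"

lemma kk_simps [simp]:
  "carrier kk = carrier K" "\<zero>\<^bsub>kk\<^esub> = \<zero>" "add kk = add K" "r \<odot>\<^bsub>kk\<^esub> c = aug X r \<otimes> c"
  by (simp_all add: trivial_module_def)

lemma left_module_kk: "left_module X kk"
  using augmented_algebra by (rule left_module_trivial)

lemma coord_one [simp]: "\<beta> \<one>\<^bsub>X\<^esub> = \<zero>"
proof -
  have "\<beta> \<one>\<^bsub>X\<^esub> \<oplus> \<beta> \<one>\<^bsub>X\<^esub> = \<beta> \<one>\<^bsub>X\<^esub>"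
    using coord_mult[of "\<one>\<^bsub>X\<^esub>" "\<one>\<^bsub>X\<^esub>"] by simp
  then show ?thesis by simp
qed

lemma x_square: "x \<otimes>\<^bsub>X\<^esub> x = \<zero>\<^bsub>X\<^esub>"
  using span[of "x \<otimes>\<^bsub>X\<^esub> x"] by simp

lemma mult_smult_x:
  assumes "r \<in> carrier X" "c \<in> carrier K"
  shows "r \<otimes>\<^bsub>X\<^esub> (c \<odot>\<^bsub>X\<^esub> x) = (aug X r \<otimes> c) \<odot>\<^bsub>X\<^esub> x"
proof -
  have "r \<otimes>\<^bsub>X\<^esub> x = (aug X r \<odot>\<^bsub>X\<^esub> \<one>\<^bsub>X\<^esub> \<oplus>\<^bsub>X\<^esub> \<beta> r \<odot>\<^bsub>X\<^esub> x) \<otimes>\<^bsub>X\<^esub> x"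
    using span[of r] assms by simp
  also have "\<dots> = aug X r \<odot>\<^bsub>X\<^esub> x"
    using assms by (simp add: A.l_distr smult_mult_left x_square)
  finally show ?thesis
    using assms by (simp add: smult_mult_right mod.smult_assoc1[symmetric] K.m_comm)
qed

lemma mult_scalar:
  assumes "r \<in> carrier X" "c \<in> carrier K"
  shows "r \<otimes>\<^bsub>X\<^esub> (c \<odot>\<^bsub>X\<^esub> \<one>\<^bsub>X\<^esub>)
       = (aug X r \<otimes> c) \<odot>\<^bsub>X\<^esub> \<one>\<^bsub>X\<^esub> \<oplus>\<^bsub>X\<^esub> (c \<otimes> \<beta> r) \<odot>\<^bsub>X\<^esub> x"
proof -
  have "r \<otimes>\<^bsub>X\<^esub> (c \<odot>\<^bsub>X\<^esub> \<one>\<^bsub>X\<^esub>) = c \<odot>\<^bsub>X\<^esub> r" using assms by (simp add: smult_mult_right)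
  also have "\<dots> = c \<odot>\<^bsub>X\<^esub> (aug X r \<odot>\<^bsub>X\<^esub> \<one>\<^bsub>X\<^esub> \<oplus>\<^bsub>X\<^esub> \<beta> r \<odot>\<^bsub>X\<^esub> x)"
    using span[of r] assms by simp
  finally show ?thesis
    using assms by (simp add: mod.smult_r_distr mod.smult_assoc1[symmetric] K.m_comm)
qed

text \<open>The module \<open>k\<^sup>2\<close> with \<open>x (a, e) = (0, c a)\<close>. It is the push-out of \<open>0 \<rightarrow> k \<rightarrow> X \<rightarrow> k \<rightarrow> 0\<close> along
  multiplication by \<open>c\<close>: the regular module for \<open>c = 1\<close>, and \<open>k \<oplus> k\<close> for \<open>c = 0\<close>.\<close>

definition jordan :: "'k \<Rightarrow> ('u, 'k \<times> 'k) module" where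
  "jordan c = \<lparr>carrier = carrier K \<times> carrier K, mult = undefined, one = undefined,
     zero = (\<zero>, \<zero>), add = (\<lambda>(a, e) (a', e'). (a \<oplus> a', e \<oplus> e')),
     smult = (\<lambda>r (a, e). (aug X r \<otimes> a, aug X r \<otimes> e \<oplus> c \<otimes> (\<beta> r \<otimes> a)))\<rparr>"

lemma left_module_jordan:
  assumes c: "c \<in> carrier K"
  shows "left_module X (jordan c)"
proof -
  have "abelian_group (jordan c)"
  proof (rule abelian_groupI)
    fix z assume "z \<in> carrier (jordan c)"
    then show "\<exists>y\<in>carrier (jordan c). y \<oplus>\<^bsub>jordan c\<^esub> z = \<zero>\<^bsub>jordan c\<^esub>"
      by (intro bexI[of _ "(\<ominus> fst z, \<ominus> snd z)"]) (auto simp: jordan_def K.l_neg)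
  qed (auto simp: jordan_def K.a_ac)
  then show ?thesis
    using c by (auto simp: left_module_def jordan_def A.ring_axioms K.cring_simprules)
qed

lemma lin_maps_fst_jordan: "c \<in> carrier K \<Longrightarrow> fst \<in> lin_maps X (jordan c) kk"
  by (auto simp: lin_maps_def jordan_def)

lemma lin_maps_Pair_jordan: "c \<in> carrier K \<Longrightarrow> Pair \<zero> \<in> lin_maps X kk (jordan c)"
  by (auto simp: lin_maps_def jordan_def)

text \<open>The universal property of the push-out: a map is given by the image \<open>v\<close> of \<open>(1, 0)\<close> and its
  restriction \<open>\<tau>\<close> to the submodule of the \<open>(0, e)\<close>, subject to \<open>x (1, 0) = (0, c)\<close>. Since the elements of \<open>M\<close>
  carry no action of \<open>k\<close> of their own, \<open>a v\<close> is written as \<open>(a 1) v\<close>.\<close>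

lemma lin_maps_from_jordan:
  assumes M: "left_module X M" and v: "v \<in> carrier M" and \<tau>: "\<tau> \<in> lin_maps X kk M"
    and c: "c \<in> carrier K" and xv: "x \<odot>\<^bsub>M\<^esub> v = \<tau> c"
  shows "(\<lambda>(a, e). (a \<odot>\<^bsub>X\<^esub> \<one>\<^bsub>X\<^esub>) \<odot>\<^bsub>M\<^esub> v \<oplus>\<^bsub>M\<^esub> \<tau> e) \<in> lin_maps X (jordan c) M"
proof -
  interpret M: left_mod X M using M by (simp add: left_mod_def)
  have t: "\<And>e. e \<in> carrier K \<Longrightarrow> \<tau> e \<in> carrier M"
    "\<And>e e'. \<lbrakk>e \<in> carrier K; e' \<in> carrier K\<rbrakk> \<Longrightarrow> \<tau> (e \<oplus> e') = \<tau> e \<oplus>\<^bsub>M\<^esub> \<tau> e'"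
    "\<And>r e. \<lbrakk>r \<in> carrier X; e \<in> carrier K\<rbrakk> \<Longrightarrow> \<tau> (aug X r \<otimes> e) = r \<odot>\<^bsub>M\<^esub> \<tau> e"
    using lin_mapsD[OF \<tau>] by simp_all
  have scal: "(q \<odot>\<^bsub>X\<^esub> x) \<odot>\<^bsub>M\<^esub> v = \<tau> (c \<otimes> q)" if q: "q \<in> carrier K" for q
  proof -
    have "(q \<odot>\<^bsub>X\<^esub> x) \<odot>\<^bsub>M\<^esub> v = ((q \<odot>\<^bsub>X\<^esub> \<one>\<^bsub>X\<^esub>) \<otimes>\<^bsub>X\<^esub> x) \<odot>\<^bsub>M\<^esub> v"
      using q by (simp add: smult_mult_left)
    also have "\<dots> = (q \<odot>\<^bsub>X\<^esub> \<one>\<^bsub>X\<^esub>) \<odot>\<^bsub>M\<^esub> \<tau> c" using q v by (subst M.smult_assoc) (simp_all add: xv)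
    also have "\<dots> = \<tau> (q \<otimes> c)" using t(3)[of "q \<odot>\<^bsub>X\<^esub> \<one>\<^bsub>X\<^esub>" c] q c by simp
    finally show ?thesis using q c by (simp add: K.m_comm)
  qed
  show ?thesis
  proof (rule lin_mapsI; clarsimp simp: jordan_def v t)
    fix a e a' e' assume K: "a \<in> carrier K" "e \<in> carrier K" "a' \<in> carrier K" "e' \<in> carrier K"
    then show "((a \<oplus> a') \<odot>\<^bsub>X\<^esub> \<one>\<^bsub>X\<^esub>) \<odot>\<^bsub>M\<^esub> v \<oplus>\<^bsub>M\<^esub> (\<tau> e \<oplus>\<^bsub>M\<^esub> \<tau> e') =
      (a \<odot>\<^bsub>X\<^esub> \<one>\<^bsub>X\<^esub>) \<odot>\<^bsub>M\<^esub> v \<oplus>\<^bsub>M\<^esub> \<tau> e \<oplus>\<^bsub>M\<^esub> ((a' \<odot>\<^bsub>X\<^esub> \<one>\<^bsub>X\<^esub>) \<odot>\<^bsub>M\<^esub> v \<oplus>\<^bsub>M\<^esub> \<tau> e')"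
      by (simp add: mod.smult_l_distr M.smult_l_distr v t M.M.a_ac)
  next
    fix r a e assume K: "r \<in> carrier X" "a \<in> carrier K" "e \<in> carrier K"
    have "r \<odot>\<^bsub>M\<^esub> ((a \<odot>\<^bsub>X\<^esub> \<one>\<^bsub>X\<^esub>) \<odot>\<^bsub>M\<^esub> v \<oplus>\<^bsub>M\<^esub> \<tau> e)
        = (r \<otimes>\<^bsub>X\<^esub> (a \<odot>\<^bsub>X\<^esub> \<one>\<^bsub>X\<^esub>)) \<odot>\<^bsub>M\<^esub> v \<oplus>\<^bsub>M\<^esub> r \<odot>\<^bsub>M\<^esub> \<tau> e"
      using K v t by (simp add: M.smult_r_distr M.smult_assoc)
    also have "\<dots> = ((aug X r \<otimes> a) \<odot>\<^bsub>X\<^esub> \<one>\<^bsub>X\<^esub>) \<odot>\<^bsub>M\<^esub> v \<oplus>\<^bsub>M\<^esub> \<tau> (c \<otimes> (a \<otimes> \<beta> r)) \<oplus>\<^bsub>M\<^esub> r \<odot>\<^bsub>M\<^esub> \<tau> e"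
      using K v c by (simp add: mult_scalar M.smult_l_distr scal)
    finally show "((aug X r \<otimes> a) \<odot>\<^bsub>X\<^esub> \<one>\<^bsub>X\<^esub>) \<odot>\<^bsub>M\<^esub> v \<oplus>\<^bsub>M\<^esub> \<tau> (aug X r \<otimes> e \<oplus> c \<otimes> (\<beta> r \<otimes> a)) =
      r \<odot>\<^bsub>M\<^esub> ((a \<odot>\<^bsub>X\<^esub> \<one>\<^bsub>X\<^esub>) \<odot>\<^bsub>M\<^esub> v \<oplus>\<^bsub>M\<^esub> \<tau> e)"
      using K v c t by (simp add: M.M.a_ac K.m_comm)
  qed
qed

lemma lin_maps_x:
  assumes M: "left_module X M" and v: "v \<in> carrier M"
  shows "(\<lambda>e. (e \<odot>\<^bsub>X\<^esub> x) \<odot>\<^bsub>M\<^esub> v) \<in> lin_maps X kk M"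
proof -
  interpret M: left_mod X M using M by (simp add: left_mod_def)
  show ?thesis
    using v by (intro lin_mapsI)
      (simp_all add: mod.smult_l_distr M.smult_l_distr mult_smult_x M.smult_assoc[symmetric])
qed

abbreviation std_mod :: "'k \<Rightarrow> ('u, 'u) module" where
  "std_mod c \<equiv> transport_module pr (jordan c)"

lemma jordan_carrier [simp]: "carrier (jordan c) = carrier K \<times> carrier K"
  by (simp add: jordan_def)

lemma left_module_std: "c \<in> carrier K \<Longrightarrow> left_module X (std_mod c)"
  using pr_inj by (intro left_module_transport left_module_jordan) simp_all

lemma std_mod_lin_maps:
  assumes "c \<in> carrier K"
  shows "pr \<in> lin_maps X (jordan c) (std_mod c)" and "up \<in> lin_maps X (std_mod c) (jordan c)"
  using transport_module_lin_maps[OF left_module_jordan[OF assms], of pr] pr_inj by simp_all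

text \<open>The truncation \<open>0 \<rightarrow> k \<rightarrow> X \<rightarrow> \<dots> \<rightarrow> X \<rightarrow> k \<rightarrow> 0\<close> of the periodic resolution, pushed out along
  multiplication by \<open>c\<close>. Only the leftmost module is affected by the push-out. All modules have the
  same carrier, and all maps are \<open>(a, e) \<mapsto> (0, a)\<close> or its two halves.\<close>

definition std_ext :: "nat \<Rightarrow> 'k \<Rightarrow> ('u, 'k, 'k) extn" where
  "std_ext n c = (if n = 0 then Hom (\<lambda>y. c \<otimes> y)
     else Seq (\<lambda>j. std_mod (if Suc j = n then c else \<one>)) (\<lambda>j z. pr (\<zero>, fst (up z)))
            (\<lambda>e. pr (\<zero>, e)) (\<lambda>z. fst (up z)))"

lemma up_pr [simp]: "\<lbrakk>a \<in> carrier K; e \<in> carrier K\<rbrakk> \<Longrightarrow> up (pr (a, e)) = (a, e)"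
  using pr_inj by simp

lemma is_ext_std:
  assumes c: "c \<in> carrier K"
  shows "is_ext X n kk kk (std_ext n c)"
proof (cases "n = 0")
  case True
  have "(\<lambda>y. c \<otimes> y) \<in> lin_maps X kk kk"
    using c by (intro lin_mapsI) (simp_all add: K.r_distr K.m_lcomm)
  then show ?thesis using True by (simp add: std_ext_def)
next
  case False
  define c' where "c' j = (if Suc j = n then c else \<one>)" for j
  have c': "c' j \<in> carrier K" for j using c by (simp add: c'_def)
  have car: "carrier (std_mod a) = pr ` (carrier K \<times> carrier K)" for a
    using pr_inj by (simp add: transport_module_simps)
  have zero: "\<zero>\<^bsub>std_mod a\<^esub> = pr (\<zero>, \<zero>)" for a
    by (simp add: transport_module_def Let_def) (simp add: jordan_def)
  have fstup: "(\<lambda>z. fst (up z)) \<in> lin_maps X (std_mod a) kk" if "a \<in> carrier K" for a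
    using lin_maps_comp[OF std_mod_lin_maps(2) lin_maps_fst_jordan] that by simp
  have incl: "(\<lambda>e. pr (\<zero>, e)) \<in> lin_maps X kk (std_mod a)" if "a \<in> carrier K" for a
    using lin_maps_comp[OF lin_maps_Pair_jordan std_mod_lin_maps(1)] that by simp
  have pr_eq: "pr (a, e) = pr (a', e') \<longleftrightarrow> a = a' \<and> e = e'"
    if "a \<in> carrier K" "e \<in> carrier K" "a' \<in> carrier K" "e' \<in> carrier K" for a e a' e'
    using inj_on_eq_iff[OF pr_inj, of "(a, e)" "(a', e')"] that by simp
  have ex: "exact_at n kk kk (\<lambda>j. std_mod (c' j)) (\<lambda>j z. pr (\<zero>, fst (up z)))
      (\<lambda>e. pr (\<zero>, e)) (\<lambda>z. fst (up z)) j" for j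
    \<comment> \<open>at each place, image and kernel consist of the pairs \<open>(0, e)\<close>\<close>
  proof -
    have "(\<lambda>e. pr (\<zero>, e)) ` carrier kk = {pr (\<zero>, e) | e. e \<in> carrier K}" by auto
    moreover have "(\<lambda>z. pr (\<zero>, fst (up z))) ` carrier (std_mod a) = {pr (\<zero>, e) | e. e \<in> carrier K}" for a
    proof -
      have "pr (\<zero>, e) \<in> (\<lambda>z. pr (\<zero>, fst (up z))) ` carrier (std_mod a)" if "e \<in> carrier K" for e
        by (rule image_eqI[of _ _ "pr (e, \<zero>)"]) (use that in \<open>auto simp: car\<close>)
      then show ?thesis by (auto simp: car)
    qed
    moreover have "{z \<in> carrier (std_mod a). fst (up z) = \<zero>} = {pr (\<zero>, e) | e. e \<in> carrier K}" for a
      by (auto simp: car)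
    moreover have "{z \<in> carrier (std_mod a). pr (\<zero>, fst (up z)) = \<zero>\<^bsub>std_mod b\<^esub>}
        = {pr (\<zero>, e) | e. e \<in> carrier K}" for a b
      by (auto simp: car zero pr_eq)
    ultimately show ?thesis
      by (cases "j = 0"; cases "Suc j = n") (simp_all add: exact_at_def)
  qed
  have "is_ext X n kk kk (Seq (\<lambda>j. std_mod (c' j)) (\<lambda>j z. pr (\<zero>, fst (up z)))
      (\<lambda>e. pr (\<zero>, e)) (\<lambda>z. fst (up z)))"
    unfolding is_ext_Seq_iff
  proof (intro conjI allI impI)
    show "0 < n" using False by simp
    show "left_module X (std_mod (c' j))" "small (carrier (std_mod (c' j)))" for j
      using c' pr_small by (simp_all add: left_module_std car)
    show "(\<lambda>e. pr (\<zero>, e)) \<in> lin_maps X kk (std_mod (c' (n - 1)))" using incl c' by blast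
    show "(\<lambda>z. pr (\<zero>, fst (up z))) \<in> lin_maps X (std_mod (c' (Suc j))) (std_mod (c' j))" for j
      using lin_maps_comp[OF fstup[OF c'] incl[OF c']] .
    show "(\<lambda>z. fst (up z)) \<in> lin_maps X (std_mod (c' 0)) kk" using fstup c' by blast
    show "inj_on (\<lambda>e. pr (\<zero>, e)) (carrier kk)" by (auto simp: inj_on_def pr_eq)
    show "(\<lambda>z. fst (up z)) ` carrier (std_mod (c' 0)) = carrier kk"
      by (auto simp: car image_iff intro!: bexI[of _ "\<zero>"])
  qed (rule ex)
  then show ?thesis using False by (simp add: std_ext_def c'_def)
qed

text \<open>The \<open>e j\<close> are the images of \<open>1\<close> under a comparison map from the periodic resolution of \<open>k\<close>, and \<open>c\<close> is
  the cocycle in degree \<open>n\<close> defined by it. For a map \<open>k \<rightarrow> k\<close> the cocycle is its value at \<open>1\<close>.\<close>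

definition has_coeff :: "nat \<Rightarrow> ('u, 'k, 'k) extn \<Rightarrow> 'k \<Rightarrow> bool" where
  "has_coeff n S c \<longleftrightarrow> (case S of
     Hom f \<Rightarrow> f \<one> = c
   | Seq N d i p \<Rightarrow> (\<exists>e. (\<forall>j<n. e j \<in> carrier (N j)) \<and> p (e 0) = \<one> \<and>
       (\<forall>j. Suc j < n \<longrightarrow> d j (e (Suc j)) = x \<odot>\<^bsub>N j\<^esub> e j) \<and>
       x \<odot>\<^bsub>N (n - 1)\<^esub> e (n - 1) = i c))"

lemma has_coeff_simps [simp]:
  "has_coeff n (Hom f) c \<longleftrightarrow> f \<one> = c"
  "has_coeff n (Seq N d i p) c \<longleftrightarrow> (\<exists>e. (\<forall>j<n. e j \<in> carrier (N j)) \<and> p (e 0) = \<one> \<and>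
       (\<forall>j. Suc j < n \<longrightarrow> d j (e (Suc j)) = x \<odot>\<^bsub>N j\<^esub> e j) \<and>
       x \<odot>\<^bsub>N (n - 1)\<^esub> e (n - 1) = i c)"
  by (simp_all add: has_coeff_def)

text \<open>The next lifting problem is solvable, because \<open>x e\<^sub>m\<close> is a cycle: for \<open>m = 0\<close> since \<open>x\<close> annihilates \<open>k\<close>,
  otherwise since \<open>d (x e\<^sub>m) = x\<^sup>2 e\<^sub>m\<^sub>-\<^sub>1 = 0\<close>.\<close>

lemma lift_cycle:
  assumes S: "is_ext X n kk kk (Seq N d i p)" and m: "m < n"
    and e: "\<And>j. j \<le> m \<Longrightarrow> e j \<in> carrier (N j)" "p (e 0) = \<one>"
      "\<And>j. j < m \<Longrightarrow> d j (e (Suc j)) = x \<odot>\<^bsub>N j\<^esub> e j"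
  shows "x \<odot>\<^bsub>N m\<^esub> e m \<in> carrier (N m)" and "m = 0 \<Longrightarrow> p (x \<odot>\<^bsub>N m\<^esub> e m) = \<zero>\<^bsub>kk\<^esub>"
    and "0 < m \<Longrightarrow> d (m - 1) (x \<odot>\<^bsub>N m\<^esub> e m) = \<zero>\<^bsub>N (m - 1)\<^esub>"
proof -
  note SD = is_ext_SeqD[OF S]
  interpret Nm: left_mod X "N m" using SD(2)[OF m] by (simp add: left_mod_def)
  show "x \<odot>\<^bsub>N m\<^esub> e m \<in> carrier (N m)" using e(1) by simp
  show "p (x \<odot>\<^bsub>N m\<^esub> e m) = \<zero>\<^bsub>kk\<^esub>" if "m = 0"
    using that lin_mapsD(3)[OF SD(6), of x "e 0"] e by simp
  show "d (m - 1) (x \<odot>\<^bsub>N m\<^esub> e m) = \<zero>\<^bsub>N (m - 1)\<^esub>" if m': "0 < m"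
  proof -
    obtain k where k: "m = Suc k" using m' gr0_conv_Suc by blast
    interpret Nk: left_mod X "N k" using SD(2)[of k] m k by (simp add: left_mod_def)
    have "d k (x \<odot>\<^bsub>N m\<^esub> e m) = x \<odot>\<^bsub>N k\<^esub> d k (e m)"
      using lin_mapsD(3)[OF SD(5)[of k], of x "e m"] m k e by simp
    also have "\<dots> = (x \<otimes>\<^bsub>X\<^esub> x) \<odot>\<^bsub>N k\<^esub> e k"
      using e(3)[of k] e(1)[of k] k by (subst Nk.smult_assoc) simp_all
    also have "\<dots> = \<zero>\<^bsub>N k\<^esub>" using e(1)[of k] k by (simp add: x_square)
    finally show ?thesis using k by simp
  qed
qed

lemma lift_sequence:
  assumes S: "is_ext X n kk kk (Seq N d i p)" and m: "m < n"
  shows "\<exists>e. (\<forall>j\<le>m. e j \<in> carrier (N j)) \<and> p (e 0) = \<one> \<and>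
       (\<forall>j<m. d j (e (Suc j)) = x \<odot>\<^bsub>N j\<^esub> e j)"
  using m
proof (induction m)
  case 0
  have "\<one> \<in> p ` carrier (N 0)" using is_ext_SeqD(8)[OF S] by simp
  then obtain e0 where "e0 \<in> carrier (N 0)" "p e0 = \<one>" by auto
  then show ?case by (intro exI[of _ "\<lambda>_. e0"]) simp
next
  case (Suc m)
  then have m: "m < n" by simp
  obtain e where e: "\<And>j. j \<le> m \<Longrightarrow> e j \<in> carrier (N j)" "p (e 0) = \<one>"
    "\<And>j. j < m \<Longrightarrow> d j (e (Suc j)) = x \<odot>\<^bsub>N j\<^esub> e j"
    using Suc by auto
  have "\<exists>z\<in>carrier (N (Suc m)). x \<odot>\<^bsub>N m\<^esub> e m = d m z"
    using exact_at_kernel(2)[OF is_ext_SeqD(9)[OF S m] lift_cycle[OF S m e]] Suc.prems by simp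
  then obtain z where z: "z \<in> carrier (N (Suc m))" "d m z = x \<odot>\<^bsub>N m\<^esub> e m" by auto
  show ?case
    by (rule exI[of _ "e(Suc m := z)"]) (use e z in \<open>auto simp: le_Suc_eq less_Suc_eq\<close>)
qed

lemma has_coeff_exists:
  assumes S: "is_ext X n kk kk S"
  shows "\<exists>c\<in>carrier K. has_coeff n S c"
proof (cases S)
  case (Hom f)
  then show ?thesis using S lin_mapsD(1)[of f X kk kk \<one>] by simp
next
  case (Seq N d i p)
  note S = S[unfolded Seq]
  obtain m where m: "n = Suc m" using is_ext_SeqD(1)[OF S] gr0_conv_Suc by blast
  then have mn: "m < n" by simp
  obtain e where e: "\<And>j. j \<le> m \<Longrightarrow> e j \<in> carrier (N j)" "p (e 0) = \<one>"
    "\<And>j. j < m \<Longrightarrow> d j (e (Suc j)) = x \<odot>\<^bsub>N j\<^esub> e j"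
    using lift_sequence[OF S mn] by auto
  have "\<exists>c\<in>carrier kk. x \<odot>\<^bsub>N m\<^esub> e m = i c"
    using exact_at_kernel(1)[OF is_ext_SeqD(9)[OF S mn] lift_cycle[OF S mn e]] m by simp
  then obtain c where c: "c \<in> carrier K" "x \<odot>\<^bsub>N m\<^esub> e m = i c" by auto
  then have "has_coeff n S c"
    unfolding Seq has_coeff_simps m by (intro exI[of _ e]) (use e in auto)
  then show ?thesis using c by blast
qed

text \<open>A comparison map lifting the zero map of \<open>k\<close> is null-homotopic, so its cocycle is zero. The \<open>g\<close> in the proof
  are the values at \<open>1\<close> of the homotopy.\<close>

lemma lift_of_zero:
  assumes S: "is_ext X n kk kk (Seq N d i p)"
    and y: "\<And>j. j < n \<Longrightarrow> y j \<in> carrier (N j)" "p (y 0) = \<zero>"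
      "\<And>j. Suc j < n \<Longrightarrow> d j (y (Suc j)) = x \<odot>\<^bsub>N j\<^esub> y j"
  shows "x \<odot>\<^bsub>N (n - 1)\<^esub> y (n - 1) = \<zero>\<^bsub>N (n - 1)\<^esub>"
proof -
  note SD = is_ext_SeqD[OF S]
  have mod: "left_mod X (N j)" if "j < n" for j using SD(2)[OF that] by (simp add: left_mod_def)
  have step: "x \<odot>\<^bsub>N j\<^esub> (y j \<ominus>\<^bsub>N j\<^esub> x \<odot>\<^bsub>N j\<^esub> g) = x \<odot>\<^bsub>N j\<^esub> y j"
    if "j < n" "g \<in> carrier (N j)" for j g
  proof -
    interpret Nj: left_mod X "N j" by (rule mod[OF that(1)])
    have "x \<odot>\<^bsub>N j\<^esub> (x \<odot>\<^bsub>N j\<^esub> g) = \<zero>\<^bsub>N j\<^esub>"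
      using that by (simp add: Nj.smult_assoc[symmetric] x_square)
    then have "x \<odot>\<^bsub>N j\<^esub> (y j \<ominus>\<^bsub>N j\<^esub> x \<odot>\<^bsub>N j\<^esub> g) = x \<odot>\<^bsub>N j\<^esub> y j \<ominus>\<^bsub>N j\<^esub> \<zero>\<^bsub>N j\<^esub>"
      using that y(1)[OF that(1)] by (simp add: Nj.smult_r_minus)
    then show ?thesis using y(1)[OF that(1)] by (simp add: Nj.M.minus_eq)
  qed
  \<comment> \<open>\<open>y j\<close> agrees with some \<open>x g\<close> up to a cycle; since \<open>x\<^sup>2 = 0\<close>, multiplication by \<open>x\<close> forgets \<open>g\<close>\<close>
  have claim: "\<exists>g\<in>carrier (N j). (j = 0 \<longrightarrow> p (y j \<ominus>\<^bsub>N j\<^esub> x \<odot>\<^bsub>N j\<^esub> g) = \<zero>) \<and>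
      (0 < j \<longrightarrow> d (j - 1) (y j \<ominus>\<^bsub>N j\<^esub> x \<odot>\<^bsub>N j\<^esub> g) = \<zero>\<^bsub>N (j - 1)\<^esub>)" if "j < n" for j
    using that
  proof (induction j)
    case 0
    interpret N0: left_mod X "N 0" by (rule mod[OF 0])
    have "y 0 \<ominus>\<^bsub>N 0\<^esub> x \<odot>\<^bsub>N 0\<^esub> \<zero>\<^bsub>N 0\<^esub> = y 0" using y(1)[OF 0] by (simp add: N0.M.minus_eq)
    then show ?case using y(2) by (intro bexI[of _ "\<zero>\<^bsub>N 0\<^esub>"]) simp_all
  next
    case (Suc j)
    interpret Nj: left_mod X "N j" using mod Suc.prems by simp
    interpret Nj': left_mod X "N (Suc j)" using mod Suc.prems by simp
    have yj: "y j \<in> carrier (N j)" "y (Suc j) \<in> carrier (N (Suc j))" using y(1) Suc.prems by simp_all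
    obtain g where g: "g \<in> carrier (N j)"
      "j = 0 \<Longrightarrow> p (y j \<ominus>\<^bsub>N j\<^esub> x \<odot>\<^bsub>N j\<^esub> g) = \<zero>"
      "0 < j \<Longrightarrow> d (j - 1) (y j \<ominus>\<^bsub>N j\<^esub> x \<odot>\<^bsub>N j\<^esub> g) = \<zero>\<^bsub>N (j - 1)\<^esub>"
      using Suc by auto
    have "\<exists>z\<in>carrier (N (Suc j)). y j \<ominus>\<^bsub>N j\<^esub> x \<odot>\<^bsub>N j\<^esub> g = d j z"
      by (rule exact_at_kernel(2)[OF SD(9)[of j]]) (use Suc.prems g yj in simp_all)
    then obtain z where z: "z \<in> carrier (N (Suc j))" "y j \<ominus>\<^bsub>N j\<^esub> x \<odot>\<^bsub>N j\<^esub> g = d j z" by blast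
    note dj = SD(5)[OF Suc.prems]
    have "d j (y (Suc j) \<ominus>\<^bsub>N (Suc j)\<^esub> x \<odot>\<^bsub>N (Suc j)\<^esub> z)
        = d j (y (Suc j)) \<ominus>\<^bsub>N j\<^esub> d j (x \<odot>\<^bsub>N (Suc j)\<^esub> z)"
      using lin_maps_minus[OF dj Nj'.left_module Nj.left_module] yj z by simp
    also have "\<dots> = x \<odot>\<^bsub>N j\<^esub> y j \<ominus>\<^bsub>N j\<^esub> x \<odot>\<^bsub>N j\<^esub> (y j \<ominus>\<^bsub>N j\<^esub> x \<odot>\<^bsub>N j\<^esub> g)"
      using y(3)[OF Suc.prems] lin_mapsD(3)[OF dj, of x z] z by simp
    also have "\<dots> = \<zero>\<^bsub>N j\<^esub>"
      using step[of j g] Suc.prems g yj by (simp add: Nj.M.minus_eq Nj.M.r_neg)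
    finally show ?case using z by (intro bexI[of _ z]) simp_all
  qed
  define m where "m = n - 1"
  have m: "m < n" "Suc m = n" using SD(1) by (simp_all add: m_def)
  interpret Nm: left_mod X "N m" by (rule mod[OF m(1)])
  obtain g where g: "g \<in> carrier (N m)"
    "m = 0 \<Longrightarrow> p (y m \<ominus>\<^bsub>N m\<^esub> x \<odot>\<^bsub>N m\<^esub> g) = \<zero>"
    "0 < m \<Longrightarrow> d (m - 1) (y m \<ominus>\<^bsub>N m\<^esub> x \<odot>\<^bsub>N m\<^esub> g) = \<zero>\<^bsub>N (m - 1)\<^esub>"
    using claim[OF m(1)] by auto
  have "\<exists>b\<in>carrier kk. y m \<ominus>\<^bsub>N m\<^esub> x \<odot>\<^bsub>N m\<^esub> g = i b"
    by (rule exact_at_kernel(1)[OF SD(9)[OF m(1)]]) (use m g y(1)[OF m(1)] in simp_all)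
  then obtain b where b: "b \<in> carrier K" "y m \<ominus>\<^bsub>N m\<^esub> x \<odot>\<^bsub>N m\<^esub> g = i b" by auto
  have "x \<odot>\<^bsub>N m\<^esub> y m = x \<odot>\<^bsub>N m\<^esub> i b" using step[OF m(1) g(1)] b by simp
  also have "\<dots> = i (\<zero> \<otimes> b)" using lin_mapsD(3)[OF SD(4), of x b] b by (simp add: m_def)
  also have "\<dots> = \<zero>\<^bsub>N m\<^esub>"
    using lin_maps_zero[OF SD(4) left_module_kk SD(2)] b m by (simp add: m_def)
  finally show ?thesis by (simp add: m_def)
qed

text \<open>The difference of two lifts of the identity of \<open>k\<close> is a lift of zero.\<close>

lemma has_coeff_unique:
  assumes S: "is_ext X n kk kk S" and c: "has_coeff n S c" "c \<in> carrier K"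
    and c': "has_coeff n S c'" "c' \<in> carrier K"
  shows "c = c'"
proof (cases S)
  case (Hom f)
  then show ?thesis using c c' by simp
next
  case (Seq N d i p)
  note S = S[unfolded Seq]
  note SD = is_ext_SeqD[OF S]
  have mod: "left_mod X (N j)" if "j < n" for j using SD(2)[OF that] by (simp add: left_mod_def)
  obtain e where e: "\<And>j. j < n \<Longrightarrow> e j \<in> carrier (N j)" "p (e 0) = \<one>"
    "\<And>j. Suc j < n \<Longrightarrow> d j (e (Suc j)) = x \<odot>\<^bsub>N j\<^esub> e j" "x \<odot>\<^bsub>N (n - 1)\<^esub> e (n - 1) = i c"
    using c unfolding Seq by auto
  obtain e' where e': "\<And>j. j < n \<Longrightarrow> e' j \<in> carrier (N j)" "p (e' 0) = \<one>"
    "\<And>j. Suc j < n \<Longrightarrow> d j (e' (Suc j)) = x \<odot>\<^bsub>N j\<^esub> e' j" "x \<odot>\<^bsub>N (n - 1)\<^esub> e' (n - 1) = i c'"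
    using c' unfolding Seq by auto
  define y where "y j = e j \<ominus>\<^bsub>N j\<^esub> e' j" for j
  define m where "m = n - 1"
  have m: "m < n" using SD(1) by (simp add: m_def)
  have "x \<odot>\<^bsub>N (n - 1)\<^esub> y (n - 1) = \<zero>\<^bsub>N (n - 1)\<^esub>"
  proof (rule lift_of_zero[OF S])
    fix j assume j: "j < n"
    interpret Nj: left_mod X "N j" by (rule mod[OF j])
    show "y j \<in> carrier (N j)" using e(1)[OF j] e'(1)[OF j] by (simp add: y_def)
  next
    interpret k: left_mod X kk using left_module_kk by (simp add: left_mod_def)
    have "p (y 0) = \<one> \<ominus>\<^bsub>kk\<^esub> \<one>"
      using lin_maps_minus[OF SD(6) SD(2)[OF SD(1)] left_module_kk e(1)[OF SD(1)] e'(1)[OF SD(1)]]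
        e(2) e'(2) by (simp add: y_def)
    also have "\<dots> = \<zero>\<^bsub>kk\<^esub>" unfolding k.M.minus_eq by (rule k.M.r_neg) simp
    finally show "p (y 0) = \<zero>" by simp
  next
    fix j assume j: "Suc j < n"
    then have j': "j < n" by simp
    interpret Nj: left_mod X "N j" by (rule mod[OF j'])
    show "d j (y (Suc j)) = x \<odot>\<^bsub>N j\<^esub> y j"
      using lin_maps_minus[OF SD(5)[OF j] SD(2)[OF j] SD(2)[OF j'] e(1)[OF j] e'(1)[OF j]]
        e(3)[OF j] e'(3)[OF j] e(1)[OF j'] e'(1)[OF j'] by (simp add: y_def Nj.smult_r_minus)
  qed
  then have y0: "x \<odot>\<^bsub>N m\<^esub> y m = \<zero>\<^bsub>N m\<^esub>" by (simp add: m_def)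
  interpret Nm: left_mod X "N m" by (rule mod[OF m])
  have ic: "i c \<in> carrier (N m)" "i c' \<in> carrier (N m)"
    using lin_mapsD(1)[OF SD(4)] c c' by (simp_all add: m_def)
  have "x \<odot>\<^bsub>N m\<^esub> y m = x \<odot>\<^bsub>N m\<^esub> e m \<ominus>\<^bsub>N m\<^esub> x \<odot>\<^bsub>N m\<^esub> e' m"
    using e(1)[OF m] e'(1)[OF m] by (simp add: y_def Nm.smult_r_minus)
  then have "i c \<ominus>\<^bsub>N m\<^esub> i c' = \<zero>\<^bsub>N m\<^esub>"
    using y0 e(4) e'(4) by (simp add: m_def)
  then have "\<ominus>\<^bsub>N m\<^esub> (\<ominus>\<^bsub>N m\<^esub> i c') = i c"
    using ic unfolding Nm.M.minus_eq by (intro Nm.M.minus_equality) simp_all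
  then have "i c = i c'" using ic by simp
  then show ?thesis using SD(7) c c' by (simp add: inj_on_def)
qed

lemma has_coeff_morphism:
  assumes ST: "ext_mor X n kk kk kk kk id b S T"
    and c: "has_coeff n S c" "c \<in> carrier K"
  shows "has_coeff n T (b c)"
proof (cases S)
  case (Hom f)
  then obtain g where T: "T = Hom g" using ST by (cases T) (auto simp: ext_mor_def)
  show ?thesis using ST c unfolding Hom T by (auto simp: ext_mor_def)
next
  case (Seq N d i p)
  then obtain N' d' i' p' where T: "T = Seq N' d' i' p'" using ST by (cases T) (auto simp: ext_mor_def)
  have S: "is_ext X n kk kk (Seq N d i p)" using ST Seq by (simp add: ext_mor_def del: is_ext.simps)
  note SD = is_ext_SeqD[OF S]
  have "ext_mor_comp X n kk kk id b (Seq N d i p) (Seq N' d' i' p')"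
    using ST unfolding Seq T ext_mor_def by blast
  then obtain h where h': "\<forall>j<n. h j \<in> lin_maps X (N j) (N' j)"
    "\<forall>y\<in>carrier kk. h (n - 1) (i y) = i' (b y)"
    "\<forall>j. Suc j < n \<longrightarrow> (\<forall>z\<in>carrier (N (Suc j)). h j (d j z) = d' j (h (Suc j) z))"
    "\<forall>z\<in>carrier (N 0). id (p z) = p' (h 0 z)"
    unfolding ext_mor_comp.simps by blast
  then have h: "\<And>j. j < n \<Longrightarrow> h j \<in> lin_maps X (N j) (N' j)"
    "\<And>y. y \<in> carrier K \<Longrightarrow> h (n - 1) (i y) = i' (b y)"
    "\<And>j z. \<lbrakk>Suc j < n; z \<in> carrier (N (Suc j))\<rbrakk> \<Longrightarrow> h j (d j z) = d' j (h (Suc j) z)"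
    "\<And>z. z \<in> carrier (N 0) \<Longrightarrow> p z = p' (h 0 z)"
    by simp_all
  obtain e where e: "\<And>j. j < n \<Longrightarrow> e j \<in> carrier (N j)" "p (e 0) = \<one>"
    "\<And>j. Suc j < n \<Longrightarrow> d j (e (Suc j)) = x \<odot>\<^bsub>N j\<^esub> e j" "x \<odot>\<^bsub>N (n - 1)\<^esub> e (n - 1) = i c"
    using c unfolding Seq by auto
  have n1: "n - 1 < n" using SD(1) by simp
  show ?thesis
    unfolding T has_coeff_simps
  proof (intro exI[of _ "\<lambda>j. h j (e j)"] conjI allI impI)
    show "h j (e j) \<in> carrier (N' j)" if "j < n" for j using lin_mapsD(1)[OF h(1)] e(1) that by simp
    show "p' (h 0 (e 0)) = \<one>" using h(4)[of "e 0"] e(1)[OF SD(1)] e(2) by simp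
    show "d' j (h (Suc j) (e (Suc j))) = x \<odot>\<^bsub>N' j\<^esub> h j (e j)" if "Suc j < n" for j
      using h(3)[OF that e(1)[OF that]] e(3)[OF that] lin_mapsD(3)[OF h(1), of j x "e j"] e(1)[of j] that
      by simp
    show "x \<odot>\<^bsub>N' (n - 1)\<^esub> h (n - 1) (e (n - 1)) = i' (b c)"
      using lin_mapsD(3)[OF h(1)[OF n1], of x "e (n - 1)"] e(1)[OF n1] e(4) h(2)[OF c(2)] by simp
  qed
qed

lemma std_ext_has_coeff:
  assumes c: "c \<in> carrier K"
  shows "has_coeff n (std_ext n c) c"
proof (cases "n = 0")
  case True
  then show ?thesis using c by (simp add: std_ext_def)
next
  case False
  have s: "r \<odot>\<^bsub>std_mod q\<^esub> pr (a, e) = pr (aug X r \<otimes> a, aug X r \<otimes> e \<oplus> q \<otimes> (\<beta> r \<otimes> a))"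
    if "a \<in> carrier K" "e \<in> carrier K" for r q a e
    using transport_module_simps(4)[of pr "jordan q" "(a, e)" r] pr_inj that by (simp add: jordan_def)
  show ?thesis
    using False c pr_inj
    by (simp add: std_ext_def s transport_module_simps, intro exI[of _ "\<lambda>_. pr (\<one>, \<zero>)"]) (simp add: s)
qed

text \<open>A lift of \<open>1\<close> with coefficient \<open>b c\<close> is the same as a comparison map from the standard extension inducing
  \<open>b\<close> on the left ends. The case \<open>b = id\<close> shows that extensions with equal coefficients are
  equivalent; general \<open>b\<close> describes push-outs.\<close>

lemma std_ext_morphism:
  assumes S: "is_ext X n kk kk S" and c': "has_coeff n S (b c)"
    and c: "c \<in> carrier K" and b: "b \<in> lin_maps X kk kk"
  shows "ext_mor X n kk kk kk kk id b (std_ext n c) S"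
proof (cases S)
  case (Hom f)
  have n: "n = 0" and f: "f \<in> lin_maps X kk kk" using S Hom by simp_all
  have lin: "g y = y \<otimes> g \<one>" if g: "g \<in> lin_maps X kk kk" and y: "y \<in> carrier K" for g y
    using lin_mapsD(3)[OF g, of "y \<odot>\<^bsub>X\<^esub> \<one>\<^bsub>X\<^esub>" \<one>] y by simp
  have "b (c \<otimes> y) = f y" if y: "y \<in> carrier K" for y
  proof -
    have "b \<one> \<in> carrier K" using lin_mapsD(1)[OF b] by simp
    then have "b (c \<otimes> y) = y \<otimes> b c" using lin[OF b, of "c \<otimes> y"] lin[OF b, of c] c y
      by (simp add: K.m_ac)
    then show ?thesis using lin[OF f y] c' Hom by simp
  qed
  then show ?thesis
    using is_ext_std[OF c, of n] S n unfolding Hom by (simp add: ext_mor_def std_ext_def)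
next
  case (Seq N d i p)
  have S': "is_ext X n kk kk (Seq N d i p)" using S Seq by simp
  note SD = is_ext_SeqD[OF S']
  obtain e where e: "\<And>j. j < n \<Longrightarrow> e j \<in> carrier (N j)" "p (e 0) = \<one>"
    "\<And>j. Suc j < n \<Longrightarrow> d j (e (Suc j)) = x \<odot>\<^bsub>N j\<^esub> e j" "x \<odot>\<^bsub>N (n - 1)\<^esub> e (n - 1) = i (b c)"
    using c' unfolding Seq by auto
  have bK: "b a \<in> carrier K" if "a \<in> carrier K" for a using lin_mapsD(1)[OF b] that by simp
  define q where "q j = (if Suc j = n then c else \<one>)" for j
  \<comment> \<open>on the pairs \<open>(0, a)\<close> the map is forced: at the left end by \<open>b\<close>, elsewhere by linearity\<close>
  define \<tau> where "\<tau> j = (if Suc j = n then (\<lambda>a. i (b a)) else (\<lambda>a. (a \<odot>\<^bsub>X\<^esub> x) \<odot>\<^bsub>N j\<^esub> e j))" for j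
  define H where "H j = (\<lambda>(a, a'). (a \<odot>\<^bsub>X\<^esub> \<one>\<^bsub>X\<^esub>) \<odot>\<^bsub>N j\<^esub> e j \<oplus>\<^bsub>N j\<^esub> \<tau> j a')" for j
  have qK: "q j \<in> carrier K" for j using c by (simp add: q_def)
  have \<tau>: "\<tau> j \<in> lin_maps X kk (N j)" if j: "j < n" for j
  proof (cases "Suc j = n")
    case True
    then have "j = n - 1" by simp
    then show ?thesis using True lin_maps_comp[OF b SD(4)] by (simp add: \<tau>_def)
  next
    case False
    then show ?thesis using lin_maps_x[OF SD(2)[OF j] e(1)[OF j]] by (simp add: \<tau>_def)
  qed
  have x\<tau>: "x \<odot>\<^bsub>N j\<^esub> e j = \<tau> j (q j)" if j: "j < n" for j
    using e(4) by (auto simp: \<tau>_def q_def)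
  have H: "H j \<in> lin_maps X (jordan (q j)) (N j)" if j: "j < n" for j
    unfolding H_def by (rule lin_maps_from_jordan[OF SD(2)[OF j] e(1)[OF j] \<tau>[OF j] qK x\<tau>[OF j]])
  have \<tau>0: "\<tau> j \<zero> = \<zero>\<^bsub>N j\<^esub>" if j: "j < n" for j
    using lin_maps_zero[OF \<tau>[OF j] left_module_kk SD(2)[OF j]] by simp
  have n1: "n - 1 < n" "Suc (n - 1) = n" "n \<noteq> 0" using SD(1) by simp_all
  have H0: "H j (\<zero>, a) = \<tau> j a" if j: "j < n" and a: "a \<in> carrier K" for j a
  proof -
    interpret Nj: left_mod X "N j" using SD(2)[OF j] by (simp add: left_mod_def)
    show ?thesis using e(1)[OF j] lin_mapsD(1)[OF \<tau>[OF j]] a by (simp add: H_def)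
  qed
  have car: "carrier (std_mod a) = pr ` (carrier K \<times> carrier K)" for a
    using pr_inj by (simp add: transport_module_simps)
  have "ext_mor_comp X n kk kk id b (std_ext n c) (Seq N d i p)"
    unfolding std_ext_def if_not_P[OF n1(3)] ext_mor_comp.simps q_def[symmetric]
  proof (intro exI[of _ "\<lambda>j z. H j (up z)"] conjI allI impI ballI)
    fix j assume j: "j < n"
    show "(\<lambda>z. H j (up z)) \<in> lin_maps X (std_mod (q j)) (N j)"
      using lin_maps_comp[OF std_mod_lin_maps(2)[OF qK] H[OF j]] .
  next
    fix y assume "y \<in> carrier kk"
    then show "H (n - 1) (up (pr (\<zero>, y))) = i (b y)"
      using H0[OF n1(1), of y] n1 by (simp add: \<tau>_def)
  next
    fix j z assume j: "Suc j < n" and z: "z \<in> carrier (std_mod (q (Suc j)))"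
    obtain a a' where a: "a \<in> carrier K" "a' \<in> carrier K" "z = pr (a, a')" using z car by auto
    interpret Nj: left_mod X "N j" using SD(2)[of j] j by (simp add: left_mod_def)
    interpret Nj': left_mod X "N (Suc j)" using SD(2)[OF j] by (simp add: left_mod_def)
    note dD = lin_mapsD[OF SD(5)[OF j]]
    have ej: "e j \<in> carrier (N j)" "e (Suc j) \<in> carrier (N (Suc j))" using e(1) j by simp_all
    have \<tau>a: "\<tau> (Suc j) a' \<in> carrier (N (Suc j))" using lin_mapsD(1)[OF \<tau>[OF j]] a by simp
    have "d j (\<tau> (Suc j) a') = \<zero>\<^bsub>N j\<^esub>"
    proof (cases "Suc (Suc j) = n")
      case True
      then show ?thesis
        using exact_at_image(2)[OF SD(9)[OF j], of "b a'"] bK[OF a(2)] by (simp add: \<tau>_def)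
    next
      case False
      then have "d j (\<tau> (Suc j) a') = (a' \<odot>\<^bsub>X\<^esub> x) \<odot>\<^bsub>N j\<^esub> (x \<odot>\<^bsub>N j\<^esub> e j)"
        using dD(3)[of "a' \<odot>\<^bsub>X\<^esub> x" "e (Suc j)"] a ej e(3)[OF j] by (simp add: \<tau>_def)
      also have "\<dots> = \<zero>\<^bsub>N j\<^esub>"
        using a ej by (simp add: Nj.smult_assoc[symmetric] smult_mult_left x_square)
      finally show ?thesis .
    qed
    then have "d j (H (Suc j) (a, a')) = (a \<odot>\<^bsub>X\<^esub> \<one>\<^bsub>X\<^esub>) \<odot>\<^bsub>N j\<^esub> (x \<odot>\<^bsub>N j\<^esub> e j)"
      using a ej \<tau>a dD(2,3) e(3)[OF j] by (simp add: H_def)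
    also have "\<dots> = \<tau> j a"
      using a ej j by (simp add: \<tau>_def Nj.smult_assoc[symmetric] smult_mult_left)
    finally show "H j (up (pr (\<zero>, fst (up z)))) = d j (H (Suc j) (up z))"
      using a H0[of j a] j by simp
  next
    fix z assume z: "z \<in> carrier (std_mod (q 0))"
    obtain a a' where a: "a \<in> carrier K" "a' \<in> carrier K" "z = pr (a, a')" using z car by auto
    interpret N0: left_mod X "N 0" using SD(2)[OF SD(1)] by (simp add: left_mod_def)
    note pD = lin_mapsD[OF SD(6)]
    have e0: "e 0 \<in> carrier (N 0)" using e(1) SD(1) by simp
    have \<tau>a: "\<tau> 0 a' \<in> carrier (N 0)" using lin_mapsD(1)[OF \<tau>[OF SD(1)]] a by simp
    have "p (\<tau> 0 a') = \<zero>"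
    proof (cases "Suc 0 = n")
      case True
      then show ?thesis
        using exact_at_image(1)[OF SD(9)[OF SD(1)], of "b a'"] bK[OF a(2)] by (simp add: \<tau>_def)
    next
      case False
      then show ?thesis using pD(3)[of "a' \<odot>\<^bsub>X\<^esub> x" "e 0"] a e0 e(2) by (simp add: \<tau>_def)
    qed
    then have "p (H 0 (a, a')) = a"
      using pD(2)[of "(a \<odot>\<^bsub>X\<^esub> \<one>\<^bsub>X\<^esub>) \<odot>\<^bsub>N 0\<^esub> e 0" "\<tau> 0 a'"] pD(3)[of "a \<odot>\<^bsub>X\<^esub> \<one>\<^bsub>X\<^esub>" "e 0"] a e0 \<tau>a e(2)
      by (simp add: H_def)
    then show "id (fst (up z)) = p (H 0 (up z))" using a by simp
  qed
  then show ?thesis using is_ext_std[OF c, of n] S' unfolding Seq ext_mor_def by blast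
qed

end


section \<open>The Ext algebra of the dual numbers\<close>

lemma ext_class_cong:
  assumes "equivclp (ext_mor \<Lambda> n A B A B id id) S T"
  shows "ext_class \<Lambda> n A B S = ext_class \<Lambda> n A B T"
  using assms equivclp_trans equivclp_sym unfolding ext_class_def by fast

context dual_numbers
begin

definition coeff_class :: "nat \<Rightarrow> 'k \<Rightarrow> ('u, 'k, 'k) extn set" where
  "coeff_class n c = {S. is_ext X n kk kk S \<and> has_coeff n S c}"

text \<open>The coefficient is a complete invariant: morphisms preserve it, and two extensions with the same
  coefficient receive morphisms from the same standard extension.\<close>

lemma ext_class_eq:
  assumes S: "is_ext X n kk kk S" and c: "has_coeff n S c" "c \<in> carrier K"
  shows "ext_class X n kk kk S = coeff_class n c"
proof (intro equalityI subsetI)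
  fix T assume "T \<in> ext_class X n kk kk S"
  then have T: "is_ext X n kk kk T" and eq: "equivclp (ext_mor X n kk kk kk kk id id) S T"
    by (simp_all add: ext_class_def)
  from eq have "has_coeff n T c"
  proof (induction rule: equivclp_induct)
    case base
    show ?case by (rule c(1))
  next
    case (step U V)
    from step(2) show ?case
    proof
      assume "ext_mor X n kk kk kk kk id id U V"
      from has_coeff_morphism[OF this step.IH c(2)] show ?thesis by simp
    next
      assume VU: "ext_mor X n kk kk kk kk id id V U"
      then have V: "is_ext X n kk kk V" and U: "is_ext X n kk kk U" by (simp_all add: ext_mor_def)
      obtain c' where c': "c' \<in> carrier K" "has_coeff n V c'" using has_coeff_exists[OF V] by blast
      from has_coeff_morphism[OF VU c'(2,1)] have "has_coeff n U c'" by simp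
      then have "c' = c" using has_coeff_unique[OF U] step.IH c c' by blast
      then show ?thesis using c' by simp
    qed
  qed
  then show "T \<in> coeff_class n c" using T by (simp add: coeff_class_def)
next
  fix T assume "T \<in> coeff_class n c"
  then have T: "is_ext X n kk kk T" "has_coeff n T c" by (simp_all add: coeff_class_def)
  have "id \<in> lin_maps X kk kk" by (simp add: lin_maps_def)
  then have "ext_mor X n kk kk kk kk id id (std_ext n c) S"
    "ext_mor X n kk kk kk kk id id (std_ext n c) T"
    using std_ext_morphism[of n S id c] std_ext_morphism[of n T id c] S T c by simp_all
  then have "equivclp (ext_mor X n kk kk kk kk id id) S T"
    by (blast intro: equivclp_trans[OF converse_r_into_equivclp r_into_equivclp])
  then show "T \<in> ext_class X n kk kk S" using T by (simp add: ext_class_def)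
qed

lemma std_ext_in_coeff_class: "c \<in> carrier K \<Longrightarrow> std_ext n c \<in> coeff_class n c"
  using is_ext_std std_ext_has_coeff by (simp add: coeff_class_def)

lemma coeff_class_inj:
  assumes "coeff_class n c = coeff_class n c'" "c \<in> carrier K" "c' \<in> carrier K"
  shows "c = c'"
proof -
  have "std_ext n c \<in> coeff_class n c'" using assms std_ext_in_coeff_class by blast
  then have "has_coeff n (std_ext n c) c'" by (simp add: coeff_class_def)
  then show ?thesis using has_coeff_unique[OF is_ext_std std_ext_has_coeff] assms by blast
qed

lemma ext_classes_eq: "ext_classes X n kk kk = coeff_class n ` carrier K"
proof (intro equalityI subsetI)
  fix \<alpha> assume "\<alpha> \<in> ext_classes X n kk kk"
  then obtain S where S: "is_ext X n kk kk S" "\<alpha> = ext_class X n kk kk S"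
    by (auto simp: ext_classes_def)
  then show "\<alpha> \<in> coeff_class n ` carrier K"
    using has_coeff_exists[OF S(1)] ext_class_eq[OF S(1)] by auto
next
  fix \<alpha> assume "\<alpha> \<in> coeff_class n ` carrier K"
  then obtain c where c: "c \<in> carrier K" "\<alpha> = coeff_class n c" by blast
  then have "\<alpha> = ext_class X n kk kk (std_ext n c)"
    using ext_class_eq[OF is_ext_std std_ext_has_coeff] by simp
  then show "\<alpha> \<in> ext_classes X n kk kk" using is_ext_std[OF c(1)] by (auto simp: ext_classes_def)
qed

text \<open>The set \<open>\<alpha>\<close> need not be a single class. This allows the zero class, which is defined by pushing out all
  extensions along \<open>0\<close>, to be treated together with the classes \<open>b\<^sub>* [S]\<close>.\<close>

lemma ext_push_eq:
  assumes b: "b \<in> lin_maps X kk kk" and c: "c \<in> carrier K" and \<alpha>: "coeff_class n c \<subseteq> \<alpha>"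
    and bc: "\<And>S. S \<in> \<alpha> \<Longrightarrow> \<exists>c'\<in>carrier K. has_coeff n S c' \<and> b c' = b c"
  shows "ext_push K X n b \<alpha> = coeff_class n (b c)"
proof -
  have bcK: "b c \<in> carrier K" using lin_mapsD(1)[OF b] c by simp
  have "ext_class X n kk kk T = coeff_class n (b c)"
    if S: "S \<in> \<alpha>" and ST: "ext_mor X n kk kk kk kk id b S T" for S T
  proof -
    have T: "is_ext X n kk kk T" using ST by (simp add: ext_mor_def)
    obtain c' where "c' \<in> carrier K" "has_coeff n S c'" "b c' = b c" using bc[OF S] by blast
    then have "has_coeff n T (b c)" using has_coeff_morphism[OF ST] by metis
    then show ?thesis using ext_class_eq[OF T] bcK by blast
  qed
  moreover have "\<exists>S T. S \<in> \<alpha> \<and> ext_mor X n kk kk kk kk id b S T"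
    using std_ext_morphism[OF is_ext_std std_ext_has_coeff c b] bcK
      std_ext_in_coeff_class[OF c] \<alpha> by blast
  ultimately show ?thesis unfolding ext_push_def Let_def by blast
qed

lemma ext_push_coeff_class:
  assumes "b \<in> lin_maps X kk kk" "c \<in> carrier K"
  shows "ext_push K X n b (coeff_class n c) = coeff_class n (b c)"
  by (rule ext_push_eq) (use assms in \<open>auto simp: coeff_class_def\<close>)

lemma ext_zero_eq: "ext_zero K X n = coeff_class n \<zero>"
  unfolding ext_zero_def Let_def
proof (rule ext_push_eq[of "\<lambda>_. \<zero>" \<zero> n])
  show "(\<lambda>_. \<zero>) \<in> lin_maps X kk kk" by (simp add: lin_maps_def)
  show "coeff_class n \<zero> \<subseteq> {S. is_ext X n kk kk S}" by (auto simp: coeff_class_def)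
qed (use has_coeff_exists in auto)

lemma ext_module_simps:
  "carrier (ext_module K X n) = coeff_class n ` carrier K"
  "\<zero>\<^bsub>ext_module K X n\<^esub> = coeff_class n \<zero>"
  "\<lbrakk>c \<in> carrier K; a \<in> carrier K\<rbrakk>
     \<Longrightarrow> c \<odot>\<^bsub>ext_module K X n\<^esub> coeff_class n a = coeff_class n (c \<otimes> a)"
proof -
  show "c \<odot>\<^bsub>ext_module K X n\<^esub> coeff_class n a = coeff_class n (c \<otimes> a)"
    if "c \<in> carrier K" "a \<in> carrier K"
  proof -
    have "(\<lambda>y. c \<otimes> y) \<in> lin_maps X kk kk"
      using that by (intro lin_mapsI) (simp_all add: K.r_distr K.m_lcomm)
    then show ?thesis using ext_push_coeff_class that by (simp add: ext_module_def)
  qed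
qed (simp_all add: ext_module_def ext_classes_eq ext_zero_eq)

definition coeff_family :: "(nat \<Rightarrow> 'k) \<Rightarrow> nat \<Rightarrow> ('u, 'k, 'k) extn set" where
  "coeff_family s = (\<lambda>n. coeff_class n (s n))"

lemma coeff_family_inj:
  assumes "coeff_family s = coeff_family t" "range s \<subseteq> carrier K" "range t \<subseteq> carrier K"
  shows "s = t"
proof
  fix n show "s n = t n"
    using fun_cong[OF assms(1), of n] range_subsetD[OF assms(2)] range_subsetD[OF assms(3)]
    by (intro coeff_class_inj[of n]) (simp_all add: coeff_family_def)
qed

lemma ext_algebra_carrier:
  "carrier (ext_algebra K X) = coeff_family ` {s. range s \<subseteq> carrier K \<and> finite {n. s n \<noteq> \<zero>}}"
proof -
  have neq: "coeff_class n a \<noteq> coeff_class n \<zero> \<longleftrightarrow> a \<noteq> \<zero>" if "a \<in> carrier K" for n a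
    using coeff_class_inj[of n a \<zero>] that by auto
  show ?thesis
  proof (intro equalityI subsetI)
    fix u assume u: "u \<in> carrier (ext_algebra K X)"
    then have "\<forall>n. \<exists>c\<in>carrier K. u n = coeff_class n c"
      by (auto simp: ext_algebra_def ext_module_simps)
    then obtain s where s: "\<And>n. s n \<in> carrier K" "\<And>n. u n = coeff_class n (s n)" by metis
    then have "u = coeff_family s" by (auto simp: coeff_family_def)
    moreover have "finite {n. s n \<noteq> \<zero>}"
      using u s by (simp add: ext_algebra_def ext_module_simps neq)
    ultimately show "u \<in> coeff_family ` {s. range s \<subseteq> carrier K \<and> finite {n. s n \<noteq> \<zero>}}"
      using s by blast
  next
    fix u assume "u \<in> coeff_family ` {s. range s \<subseteq> carrier K \<and> finite {n. s n \<noteq> \<zero>}}"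
    then obtain s where s: "\<And>n. s n \<in> carrier K" "finite {n. s n \<noteq> \<zero>}" "u = coeff_family s" by auto
    then show "u \<in> carrier (ext_algebra K X)"
      by (simp add: ext_algebra_def ext_module_simps coeff_family_def neq)
  qed
qed

text \<open>The embedding is chosen as an injection if there is one. As every class is named by a scalar, the Ext algebra
  is no larger than the set of sequences of scalars, which fits into the universe.\<close>

lemma inj_ext_embedding:
  assumes "universe TYPE('u)" "carrier K \<prec> (UNIV :: 'u set)"
  shows "inj_on (ext_embedding K X) (carrier (ext_algebra K X))"
proof -
  have "carrier (ext_algebra K X) \<subseteq> coeff_family ` {s. range s \<subseteq> carrier K}"
    unfolding ext_algebra_carrier by blast
  then have "carrier (ext_algebra K X) \<lesssim> {s :: nat \<Rightarrow> 'k. range s \<subseteq> carrier K}"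
    by (rule subset_image_lepoll)
  then have "carrier (ext_algebra K X) \<lesssim> (UNIV :: 'u set)"
    using sequences_lepoll_universe[OF assms] lepoll_trans by blast
  then have "\<exists>h :: _ \<Rightarrow> 'u. inj_on h (carrier (ext_algebra K X))"
    by (auto simp: lepoll_def)
  then show ?thesis unfolding ext_embedding_def by (rule someI_ex)
qed

lemma ext_algebra_one: "\<one>\<^bsub>ext_algebra K X\<^esub> = coeff_family (\<lambda>n. if n = 0 then \<one> else \<zero>)"
proof -
  have "is_ext X 0 kk kk (Hom id)" by (simp add: lin_maps_def)
  then have "ext_class X 0 kk kk (Hom id) = coeff_class 0 \<one>"
    by (rule ext_class_eq) simp_all
  then show ?thesis by (simp add: ext_algebra_def ext_module_simps coeff_family_def fun_eq_iff)
qed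

lemma ext_algebra_zero: "\<zero>\<^bsub>ext_algebra K X\<^esub> = coeff_family (\<lambda>n. \<zero>)"
  by (simp add: ext_algebra_def ext_module_simps coeff_family_def fun_eq_iff)

lemma ext_algebra_scalar:
  assumes "c \<in> carrier K"
  shows "c \<odot>\<^bsub>ext_algebra K X\<^esub> \<one>\<^bsub>ext_algebra K X\<^esub> = coeff_family (\<lambda>n. if n = 0 then c else \<zero>)"
  unfolding ext_algebra_one using assms
  by (simp add: ext_algebra_def ext_module_simps coeff_family_def fun_eq_iff)

text \<open>Change of rings is given on representatives, so it has scalar values as soon as it gives coefficient
  zero to all extensions of positive degree. The scalar is the value at \<open>1\<close> of the component
  in degree \<open>0\<close>.\<close>

lemma ext_map_to_scalar:
  assumes f: "f \<in> aug_hom K X \<Gamma>" and w: "w \<in> carrier (ext_algebra K \<Gamma>)"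
    and van: "\<And>n S. \<lbrakk>0 < n; is_ext \<Gamma> n (trivial_module K \<Gamma>) (trivial_module K \<Gamma>) S\<rbrakk>
                \<Longrightarrow> has_coeff n (restrict_scalars f S) \<zero>"
  shows "\<exists>c\<in>carrier K. ext_map K X f w = coeff_family (\<lambda>n. if n = 0 then c else \<zero>)"
proof -
  let ?k = "trivial_module K \<Gamma>"
  have "\<exists>S. is_ext \<Gamma> n ?k ?k S \<and> w n = ext_class \<Gamma> n ?k ?k S" for n
    using w by (auto simp: ext_algebra_def ext_module_def ext_classes_def)
  then obtain S where S: "\<And>n. is_ext \<Gamma> n ?k ?k (S n)" "\<And>n. w n = ext_class \<Gamma> n ?k ?k (S n)"
    by metis
  have Sw: "S n \<in> w n" for n using S by (simp add: ext_class_def)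
  have ext: "is_ext \<Gamma> n ?k ?k T" if "T \<in> w n" for n T using that S by (simp add: ext_class_def)
  obtain g where g: "S 0 = Hom g" using S(1)[of 0] by (cases "S 0") auto
  have g0: "\<exists>g'. T = Hom g' \<and> g' \<one> = g \<one>" if "T \<in> w 0" for T
  proof -
    have "equivclp (ext_mor \<Gamma> 0 ?k ?k ?k ?k id id) (Hom g) T"
      using that S(2)[of 0] g by (simp add: ext_class_def)
    then show ?thesis
    proof (induction rule: equivclp_induct)
      case base
      show ?case by simp
    next
      case (step U V)
      then obtain g' where "U = Hom g'" "g' \<one> = g \<one>" by blast
      then show ?case using step(2)
        by (cases V) (auto simp: ext_mor_def trivial_module_def)
    qed
  qed
  have g1: "g \<one> \<in> carrier K"
    using S(1)[of 0] g lin_mapsD(1)[of g \<Gamma> ?k ?k \<one>] by (simp add: trivial_module_def)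
  define c where "c n = (if n = 0 then g \<one> else \<zero>)" for n :: nat
  have "ext_class X n kk kk (restrict_scalars f T) = coeff_class n (c n)" if T: "T \<in> w n" for n T
  proof (rule ext_class_eq)
    show "is_ext X n kk kk (restrict_scalars f T)"
      using is_ext_restrict_scalars[OF augmented_algebra f ext[OF T]] .
    show "has_coeff n (restrict_scalars f T) (c n)"
      using g0[of T] van[OF _ ext[OF T]] T by (cases "n = 0") (auto simp: c_def)
    show "c n \<in> carrier K" using g1 by (simp add: c_def)
  qed
  then have "ext_map K X f w = coeff_family c"
    using Sw by (fastforce simp: ext_map_def Let_def coeff_family_def fun_eq_iff)
  then show ?thesis using g1 unfolding c_def by blast
qed

end


section \<open>Three small algebras\<close>

lemma lesspoll_inj:
  assumes "A \<prec> (UNIV :: 'u set)"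
  obtains h :: "'a \<Rightarrow> 'u" where "inj_on h A" "small (h ` A)"
  using lesspoll_imp_lepoll[OF assms] assms that by (auto simp: lepoll_def)

subsection \<open>The dual numbers\<close>

text \<open>The pair \<open>(a, b)\<close> stands for \<open>a + b x\<close>.\<close>

definition dual_algebra :: "('k, 'm) ring_scheme \<Rightarrow> ('k, 'k \<times> 'k) aug_alg" where
  "dual_algebra K = \<lparr>carrier = carrier K \<times> carrier K,
     mult = (\<lambda>(a, b) (a', b'). (a \<otimes>\<^bsub>K\<^esub> a', a \<otimes>\<^bsub>K\<^esub> b' \<oplus>\<^bsub>K\<^esub> b \<otimes>\<^bsub>K\<^esub> a')),
     one = (\<one>\<^bsub>K\<^esub>, \<zero>\<^bsub>K\<^esub>), zero = (\<zero>\<^bsub>K\<^esub>, \<zero>\<^bsub>K\<^esub>),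
     add = (\<lambda>(a, b) (a', b'). (a \<oplus>\<^bsub>K\<^esub> a', b \<oplus>\<^bsub>K\<^esub> b')),
     smult = (\<lambda>c (a, b). (c \<otimes>\<^bsub>K\<^esub> a, c \<otimes>\<^bsub>K\<^esub> b)), aug = fst\<rparr>"

lemma augmented_dual_algebra:
  assumes "cring K"
  shows "augmented_algebra K (dual_algebra K)"
proof -
  interpret K: cring K by fact
  have ab: "abelian_group (dual_algebra K)"
  proof (rule abelian_groupI)
    fix z assume "z \<in> carrier (dual_algebra K)"
    then show "\<exists>y\<in>carrier (dual_algebra K). y \<oplus>\<^bsub>dual_algebra K\<^esub> z = \<zero>\<^bsub>dual_algebra K\<^esub>"
      by (intro bexI[of _ "(\<ominus>\<^bsub>K\<^esub> fst z, \<ominus>\<^bsub>K\<^esub> snd z)"]) (auto simp: dual_algebra_def K.l_neg)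
  qed (auto simp: dual_algebra_def K.a_ac)
  have mon: "monoid (dual_algebra K)"
    by (rule monoidI) (auto simp: dual_algebra_def K.cring_simprules)
  have "ring (dual_algebra K)"
    by (rule ringI[OF ab mon]) (auto simp: dual_algebra_def K.cring_simprules)
  moreover have "module K (dual_algebra K)"
    by (rule moduleI[OF K.cring_axioms ab]) (auto simp: dual_algebra_def K.cring_simprules)
  moreover have "aug (dual_algebra K) \<in> ring_hom (dual_algebra K) K"
    by (rule ring_hom_memI) (auto simp: dual_algebra_def)
  ultimately show ?thesis
    by (auto simp: augmented_algebra_def) (auto simp: dual_algebra_def K.cring_simprules)
qed

lemma dual_numbers_exist:
  fixes K :: "('k, 'm) ring_scheme"
  assumes K: "cring K" and U: "universe TYPE('u)" and sm: "carrier K \<prec> (UNIV :: 'u set)"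
  shows "\<exists>(X :: ('k, 'u) aug_alg) x \<beta> pr. dual_numbers K X x \<beta> pr \<and> small (carrier X)"
proof -
  interpret K: cring K by fact
  obtain pr :: "'k \<times> 'k \<Rightarrow> 'u" where pr: "inj_on pr (carrier K \<times> carrier K)"
    "small (pr ` (carrier K \<times> carrier K))"
    using lesspoll_inj[OF times_lesspoll_universe[OF U sm sm]] by blast
  have car: "carrier (dual_algebra K) = carrier K \<times> carrier K" by (simp add: dual_algebra_def)
  have pr': "inj_on pr (carrier (dual_algebra K))" using pr by (simp add: car)
  let ?X = "transport pr (dual_algebra K)"
  let ?\<beta> = "\<lambda>r. snd (inv_into (carrier K \<times> carrier K) pr r)"
  note ts = transport_simps[OF pr', unfolded car]
  have aug: "augmented_algebra K ?X"
    by (rule augmented_algebra_transport[OF augmented_dual_algebra[OF K] pr'])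
  have X2: "pr (a, b) \<oplus>\<^bsub>?X\<^esub> pr (a', b') = pr (a \<oplus>\<^bsub>K\<^esub> a', b \<oplus>\<^bsub>K\<^esub> b')"
    "pr (a, b) \<otimes>\<^bsub>?X\<^esub> pr (a', b') = pr (a \<otimes>\<^bsub>K\<^esub> a', a \<otimes>\<^bsub>K\<^esub> b' \<oplus>\<^bsub>K\<^esub> b \<otimes>\<^bsub>K\<^esub> a')"
    if "a \<in> carrier K" "b \<in> carrier K" "a' \<in> carrier K" "b' \<in> carrier K" for a b a' b'
    using that by (simp_all add: ts) (simp_all add: dual_algebra_def)
  have X1: "c \<odot>\<^bsub>?X\<^esub> pr (a, b) = pr (c \<otimes>\<^bsub>K\<^esub> a, c \<otimes>\<^bsub>K\<^esub> b)" "aug ?X (pr (a, b)) = a"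
    if "a \<in> carrier K" "b \<in> carrier K" for a b c
    using that by (simp_all add: ts) (simp_all add: dual_algebra_def)
  have X0: "\<one>\<^bsub>?X\<^esub> = pr (\<one>\<^bsub>K\<^esub>, \<zero>\<^bsub>K\<^esub>)" by (simp add: ts) (simp add: dual_algebra_def)
  have "dual_numbers K ?X (pr (\<zero>\<^bsub>K\<^esub>, \<one>\<^bsub>K\<^esub>)) ?\<beta> pr"
    by (intro dual_numbers.intro augmented.intro dual_numbers_axioms.intro aug pr)
       (use pr in \<open>auto simp: ts(1) X0 X1 X2\<close>)
  moreover have "small (carrier ?X)" using pr by (simp add: ts)
  ultimately show ?thesis by blast
qed

subsection \<open>The algebra \<open>k[x]/x\<^sup>3\<close> over the dual numbers\<close>

text \<open>The triple \<open>(a, b, c)\<close> stands for \<open>a + b x + c x\<^sup>2\<close>.\<close>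

definition cubic_algebra :: "('k, 'm) ring_scheme \<Rightarrow> ('k, 'k \<times> 'k \<times> 'k) aug_alg" where
  "cubic_algebra K = \<lparr>carrier = carrier K \<times> carrier K \<times> carrier K,
     mult = (\<lambda>(a, b, c) (a', b', c'). (a \<otimes>\<^bsub>K\<^esub> a', a \<otimes>\<^bsub>K\<^esub> b' \<oplus>\<^bsub>K\<^esub> b \<otimes>\<^bsub>K\<^esub> a',
               a \<otimes>\<^bsub>K\<^esub> c' \<oplus>\<^bsub>K\<^esub> b \<otimes>\<^bsub>K\<^esub> b' \<oplus>\<^bsub>K\<^esub> c \<otimes>\<^bsub>K\<^esub> a')),
     one = (\<one>\<^bsub>K\<^esub>, \<zero>\<^bsub>K\<^esub>, \<zero>\<^bsub>K\<^esub>), zero = (\<zero>\<^bsub>K\<^esub>, \<zero>\<^bsub>K\<^esub>, \<zero>\<^bsub>K\<^esub>),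
     add = (\<lambda>(a, b, c) (a', b', c'). (a \<oplus>\<^bsub>K\<^esub> a', b \<oplus>\<^bsub>K\<^esub> b', c \<oplus>\<^bsub>K\<^esub> c')),
     smult = (\<lambda>k (a, b, c). (k \<otimes>\<^bsub>K\<^esub> a, k \<otimes>\<^bsub>K\<^esub> b, k \<otimes>\<^bsub>K\<^esub> c)), aug = fst\<rparr>"

lemma augmented_cubic_algebra:
  assumes "cring K"
  shows "augmented_algebra K (cubic_algebra K)"
proof -
  interpret K: cring K by fact
  have ab: "abelian_group (cubic_algebra K)"
  proof (rule abelian_groupI)
    fix z assume "z \<in> carrier (cubic_algebra K)"
    then show "\<exists>y\<in>carrier (cubic_algebra K). y \<oplus>\<^bsub>cubic_algebra K\<^esub> z = \<zero>\<^bsub>cubic_algebra K\<^esub>"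
      by (intro bexI[of _ "(\<ominus>\<^bsub>K\<^esub> fst z, \<ominus>\<^bsub>K\<^esub> fst (snd z), \<ominus>\<^bsub>K\<^esub> snd (snd z))"])
         (auto simp: cubic_algebra_def K.l_neg)
  qed (auto simp: cubic_algebra_def K.a_ac)
  have mon: "monoid (cubic_algebra K)"
    by (rule monoidI) (auto simp: cubic_algebra_def K.cring_simprules)
  have "ring (cubic_algebra K)"
    by (rule ringI[OF ab mon]) (auto simp: cubic_algebra_def K.cring_simprules)
  moreover have "module K (cubic_algebra K)"
    by (rule moduleI[OF K.cring_axioms ab]) (auto simp: cubic_algebra_def K.cring_simprules)
  moreover have "aug (cubic_algebra K) \<in> ring_hom (cubic_algebra K) K"
    by (rule ring_hom_memI) (auto simp: cubic_algebra_def)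
  ultimately show ?thesis
    by (auto simp: augmented_algebra_def) (auto simp: cubic_algebra_def K.cring_simprules)
qed

definition regular_module :: "('k, 'u) aug_alg \<Rightarrow> ('u, 'u) module" where
  "regular_module A = \<lparr>carrier = carrier A, mult = undefined, one = undefined,
     zero = \<zero>\<^bsub>A\<^esub>, add = add A, smult = mult A\<rparr>"

lemma regular_module_simps [simp]:
  "carrier (regular_module A) = carrier A" "\<zero>\<^bsub>regular_module A\<^esub> = \<zero>\<^bsub>A\<^esub>"
  "add (regular_module A) = add A" "smult (regular_module A) = mult A"
  by (simp_all add: regular_module_def)

context dual_numbers
begin

text \<open>Here \<open>f\<close> is the projection \<open>k[x]/x\<^sup>3 \<rightarrow> k[x]/x\<^sup>2\<close>. The map \<open>\<sigma>\<close> is multiplication by \<open>x\<close>, which is well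
  defined from \<open>k[x]/x\<^sup>2\<close> to \<open>k[x]/x\<^sup>3\<close> and identifies the regular module of \<open>X\<close> with the
  augmentation ideal of \<open>Z\<close>.\<close>

lemma cubic_cover:
  assumes U: "universe TYPE('u)" and sm: "carrier K \<prec> (UNIV :: 'u set)"
  obtains Z :: "('k, 'u) aug_alg" and f \<sigma> where
    "augmented_algebra K Z" "small (carrier Z)"
    "f \<in> aug_hom K Z X" "f ` carrier Z = carrier X"
    "\<sigma> \<in> lin_maps Z (pull_module f (regular_module X)) (regular_module Z)"
    "inj_on \<sigma> (carrier X)" "\<sigma> ` carrier X = {z \<in> carrier Z. aug Z z = \<zero>}"
    "\<And>r. r \<in> carrier X \<Longrightarrow> f (\<sigma> r) = r \<otimes>\<^bsub>X\<^esub> x"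
proof -
  let ?C = "carrier K \<times> carrier K \<times> carrier K"
  obtain h :: "'k \<times> 'k \<times> 'k \<Rightarrow> 'u" where h: "inj_on h ?C" "small (h ` ?C)"
    using lesspoll_inj[OF times_lesspoll_universe[OF U sm times_lesspoll_universe[OF U sm sm]]] by blast
  have car: "carrier (cubic_algebra K) = ?C" by (simp add: cubic_algebra_def)
  have h': "inj_on h (carrier (cubic_algebra K))" using h by (simp add: car)
  define Z where "Z = transport h (cubic_algebra K)"
  note ts = transport_simps[OF h', unfolded car, folded Z_def]
  have Z: "augmented_algebra K Z" unfolding Z_def
    by (rule augmented_algebra_transport[OF augmented_cubic_algebra[OF K.cring_axioms] h'])
  interpret Z: augmented K Z using Z by (simp add: augmented_def)
  define f where "f = (\<lambda>z\<in>carrier Z. case inv_into ?C h z of (a, b, c) \<Rightarrow> a \<odot>\<^bsub>X\<^esub> \<one>\<^bsub>X\<^esub> \<oplus>\<^bsub>X\<^esub> b \<odot>\<^bsub>X\<^esub> x)"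
  define \<sigma> where "\<sigma> r = h (\<zero>, aug X r, \<beta> r)" for r
  have f_h: "f (h (a, b, c)) = a \<odot>\<^bsub>X\<^esub> \<one>\<^bsub>X\<^esub> \<oplus>\<^bsub>X\<^esub> b \<odot>\<^bsub>X\<^esub> x"
    if "a \<in> carrier K" "b \<in> carrier K" "c \<in> carrier K" for a b c
    using that h by (simp add: f_def ts)
  have carZ: "\<exists>a\<in>carrier K. \<exists>b\<in>carrier K. \<exists>c\<in>carrier K. z = h (a, b, c)" if "z \<in> carrier Z" for z
    using that by (auto simp: ts)
  have mem: "h (a, b, c) \<in> carrier Z"
    if "a \<in> carrier K" "b \<in> carrier K" "c \<in> carrier K" for a b c
    using that by (simp add: ts)
  have h_eq: "h (a, b, c) = h (a', b', c') \<longleftrightarrow> a = a' \<and> b = b' \<and> c = c'"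
    if "a \<in> carrier K" "b \<in> carrier K" "c \<in> carrier K" "a' \<in> carrier K" "b' \<in> carrier K" "c' \<in> carrier K"
    for a b c a' b' c'
    using inj_on_eq_iff[OF h(1), of "(a, b, c)" "(a', b', c')"] that by simp
  have addZ_multZ: "h (a, b, c) \<oplus>\<^bsub>Z\<^esub> h (a', b', c') = h (a \<oplus> a', b \<oplus> b', c \<oplus> c')"
    "h (a, b, c) \<otimes>\<^bsub>Z\<^esub> h (a', b', c')
          = h (a \<otimes> a', a \<otimes> b' \<oplus> b \<otimes> a', a \<otimes> c' \<oplus> b \<otimes> b' \<oplus> c \<otimes> a')"
    if "a \<in> carrier K" "b \<in> carrier K" "c \<in> carrier K" "a' \<in> carrier K" "b' \<in> carrier K" "c' \<in> carrier K"
    for a b c a' b' c'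
    using that by (simp_all add: ts) (simp_all add: cubic_algebra_def)
  have smultZ: "k \<odot>\<^bsub>Z\<^esub> h (a, b, c) = h (k \<otimes> a, k \<otimes> b, k \<otimes> c)" and augZ: "aug Z (h (a, b, c)) = a"
    if "a \<in> carrier K" "b \<in> carrier K" "c \<in> carrier K" for a b c k
    using that by (simp_all add: ts) (simp_all add: cubic_algebra_def)
  note addZ = addZ_multZ(1) and multZ = addZ_multZ(2)
  have oneZ: "\<one>\<^bsub>Z\<^esub> = h (\<one>, \<zero>, \<zero>)" by (simp add: ts) (simp add: cubic_algebra_def)
  \<comment> \<open>elements of \<open>X\<close> are determined by their two coordinates\<close>
  have fmult: "(a \<odot>\<^bsub>X\<^esub> \<one>\<^bsub>X\<^esub> \<oplus>\<^bsub>X\<^esub> b \<odot>\<^bsub>X\<^esub> x) \<otimes>\<^bsub>X\<^esub> (a' \<odot>\<^bsub>X\<^esub> \<one>\<^bsub>X\<^esub> \<oplus>\<^bsub>X\<^esub> b' \<odot>\<^bsub>X\<^esub> x)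
      = (a \<otimes> a') \<odot>\<^bsub>X\<^esub> \<one>\<^bsub>X\<^esub> \<oplus>\<^bsub>X\<^esub> (a \<otimes> b' \<oplus> b \<otimes> a') \<odot>\<^bsub>X\<^esub> x" (is "?l = ?r")
    if K: "a \<in> carrier K" "b \<in> carrier K" "a' \<in> carrier K" "b' \<in> carrier K" for a b a' b'
  proof -
    have "?l = aug X ?l \<odot>\<^bsub>X\<^esub> \<one>\<^bsub>X\<^esub> \<oplus>\<^bsub>X\<^esub> \<beta> ?l \<odot>\<^bsub>X\<^esub> x" using K by (intro span) simp
    then show ?thesis using K by simp
  qed
  have f: "f \<in> aug_hom K Z X"
    unfolding aug_hom_def
  proof (intro CollectI conjI ballI ring_hom_memI)
    show "f \<in> extensional (carrier Z)" by (simp add: f_def)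
    show "f z \<in> carrier X" if "z \<in> carrier Z" for z using carZ[OF that] f_h by auto
    show "f (y \<otimes>\<^bsub>Z\<^esub> z) = f y \<otimes>\<^bsub>X\<^esub> f z" if "y \<in> carrier Z" "z \<in> carrier Z" for y z
      using carZ[OF that(1)] carZ[OF that(2)] by (auto simp: multZ f_h fmult)
    show "f (y \<oplus>\<^bsub>Z\<^esub> z) = f y \<oplus>\<^bsub>X\<^esub> f z" if "y \<in> carrier Z" "z \<in> carrier Z" for y z
      using carZ[OF that(1)] carZ[OF that(2)] by (auto simp: addZ f_h mod.smult_l_distr A.a_ac)
    show "f \<one>\<^bsub>Z\<^esub> = \<one>\<^bsub>X\<^esub>" by (simp add: oneZ f_h)
    show "f (k \<odot>\<^bsub>Z\<^esub> z) = k \<odot>\<^bsub>X\<^esub> f z" if "k \<in> carrier K" "z \<in> carrier Z" for k z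
      using carZ[OF that(2)] that(1)
      by (auto simp: smultZ f_h mod.smult_r_distr mod.smult_assoc1)
    show "aug X (f z) = aug Z z" if "z \<in> carrier Z" for z
      using carZ[OF that] by (auto simp: augZ f_h)
  qed
  show thesis
  proof (rule that[OF Z _ f, of \<sigma>])
    show "small (carrier Z)" using h by (simp add: ts)
    show "f ` carrier Z = carrier X"
    proof (intro equalityI subsetI)
      fix r assume r: "r \<in> carrier X"
      show "r \<in> f ` carrier Z"
        by (rule image_eqI[of _ _ "h (aug X r, \<beta> r, \<zero>)"]) (use r span[OF r] in \<open>auto simp: f_h mem\<close>)
    qed (use aug_homD(1)[OF f] in auto)
    show "\<sigma> \<in> lin_maps Z (pull_module f (regular_module X)) (regular_module Z)"
    proof (rule lin_mapsI)
      fix z r assume z: "z \<in> carrier Z" and "r \<in> carrier (pull_module f (regular_module X))"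
      then have r: "r \<in> carrier X" by simp
      from carZ[OF z] r
      show "\<sigma> (z \<odot>\<^bsub>pull_module f (regular_module X)\<^esub> r) = z \<odot>\<^bsub>regular_module Z\<^esub> \<sigma> r"
        by (auto simp: \<sigma>_def f_h multZ)
    qed (simp_all add: \<sigma>_def mem addZ)
    show "inj_on \<sigma> (carrier X)"
    proof (rule inj_onI)
      fix r s assume r: "r \<in> carrier X" and s: "s \<in> carrier X" and "\<sigma> r = \<sigma> s"
      then have "aug X r = aug X s" "\<beta> r = \<beta> s" by (simp_all add: \<sigma>_def h_eq)
      then show "r = s" using span[OF r] span[OF s] by simp
    qed
    show "\<sigma> ` carrier X = {z \<in> carrier Z. aug Z z = \<zero>}"
    proof (intro equalityI subsetI)
      fix z assume "z \<in> {z \<in> carrier Z. aug Z z = \<zero>}"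
      then have z: "z \<in> carrier Z" "aug Z z = \<zero>" by simp_all
      obtain b c where bc: "b \<in> carrier K" "c \<in> carrier K" "z = h (\<zero>, b, c)"
        using carZ[OF z(1)] z(2) by (auto simp: augZ)
      show "z \<in> \<sigma> ` carrier X"
        by (rule image_eqI[of _ _ "b \<odot>\<^bsub>X\<^esub> \<one>\<^bsub>X\<^esub> \<oplus>\<^bsub>X\<^esub> c \<odot>\<^bsub>X\<^esub> x"]) (use bc in \<open>simp_all add: \<sigma>_def\<close>)
    qed (auto simp: \<sigma>_def mem augZ)
    show "f (\<sigma> r) = r \<otimes>\<^bsub>X\<^esub> x" if r: "r \<in> carrier X" for r
    proof -
      have "r \<otimes>\<^bsub>X\<^esub> x = aug X r \<odot>\<^bsub>X\<^esub> x" using mult_smult_x[OF r, of \<one>] r by simp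
      then show ?thesis using r by (simp add: \<sigma>_def f_h)
    qed
  qed
qed

text \<open>The extension \<open>T\<close> is \<open>0 \<rightarrow> k \<rightarrow> k \<oplus> X \<rightarrow> Z \<rightarrow> k \<rightarrow> 0\<close> with \<open>(b, r) \<mapsto> \<sigma> r\<close> in the middle. Given a 2-extension over \<open>X\<close>
  with a lift \<open>e\<^sub>0, e\<^sub>1\<close> of \<open>1\<close>, the maps \<open>z \<mapsto> f(z) e\<^sub>0\<close> and \<open>(b, r) \<mapsto> i b + r e\<^sub>1\<close> form a morphism from \<open>T\<close>. This
  works for every value of the coefficient \<open>c\<close>, because \<open>\<sigma>\<close> is injective: if it were replaced by multiplication
  by \<open>x\<close> on \<open>X\<close>, then \<open>(0, x)\<close> would lie in the kernel but be sent to \<open>x e\<^sub>1 = i c\<close>.\<close>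

lemma degree_two_vanishes_on_cubic_cover:
  assumes U: "universe TYPE('u)" and sm: "carrier K \<prec> (UNIV :: 'u set)" and X: "small (carrier X)"
  obtains Z :: "('k, 'u) aug_alg" and f and T where
    "augmented_algebra K Z" "small (carrier Z)"
    "f \<in> aug_hom K Z X" "f ` carrier Z = carrier X"
    "\<And>S. is_ext X 2 kk kk S \<Longrightarrow>
       ext_mor Z 2 (trivial_module K Z) (trivial_module K Z) (trivial_module K Z) (trivial_module K Z)
         id id T (restrict_scalars f S)"
proof -
  obtain Z :: "('k, 'u) aug_alg" and f \<sigma> where Z: "augmented_algebra K Z" "small (carrier Z)"
    and f: "f \<in> aug_hom K Z X" "f ` carrier Z = carrier X"
    and \<sigma>: "\<sigma> \<in> lin_maps Z (pull_module f (regular_module X)) (regular_module Z)"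
    "inj_on \<sigma> (carrier X)" "\<sigma> ` carrier X = {z \<in> carrier Z. aug Z z = \<zero>}"
    "\<And>r. r \<in> carrier X \<Longrightarrow> f (\<sigma> r) = r \<otimes>\<^bsub>X\<^esub> x"
    by (rule cubic_cover[OF U sm]) (rule that)
  interpret Z: augmented K Z using Z by (simp add: augmented_def)
  let ?k = "trivial_module K Z"
  obtain h :: "'k \<times> 'u \<Rightarrow> 'u" where h: "inj_on h (carrier K \<times> carrier X)"
    "small (h ` (carrier K \<times> carrier X))"
    using lesspoll_inj[OF times_lesspoll_universe[OF U sm X]] by blast
  define D where "D = direct_sum ?k (pull_module f (regular_module X))"
  have Dcar: "carrier D = carrier K \<times> carrier X"
    by (simp add: D_def direct_sum_def trivial_module_def)
  have hD: "inj_on h (carrier D)" using h by (simp add: Dcar)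
  note rf = aug_hom_ring_hom[OF f(1)]
  have regX: "left_module X (regular_module X)" and regZ: "left_module Z (regular_module Z)"
    using left_module_regular[OF augmented_algebra] left_module_regular[OF Z(1)]
    by (simp_all add: regular_module_def)
  have D: "left_module Z D" unfolding D_def
    by (intro left_module_direct_sum left_module_trivial[OF Z(1)]
        left_module_pull[OF Z.A.ring_axioms rf regX])
  define D' where "D' = transport_module h D"
  note ts = transport_module_simps[OF hD, folded D'_def]
  note hl = transport_module_lin_maps[OF D hD, folded D'_def]
  let ?up = "inv_into (carrier D) h"
  have D': "left_module Z D'" unfolding D'_def by (rule left_module_transport[OF D hD])
  have snd: "snd \<in> lin_maps Z D (pull_module f (regular_module X))"
    and inl: "(\<lambda>b. (b, \<zero>\<^bsub>X\<^esub>)) \<in> lin_maps Z ?k D"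
    using aug_homD(1)[OF f(1)]
    by (auto simp: D_def direct_sum_def trivial_module_def intro!: lin_mapsI)
  define N where "N j = (if j = 0 then regular_module Z else D')" for j :: nat
  define T :: "('u, 'k, 'k) extn" where
    "T = Seq N (\<lambda>_ z. \<sigma> (snd (?up z))) (\<lambda>b. h (b, \<zero>\<^bsub>X\<^esub>)) (aug Z)"
  have carD': "carrier D' = h ` (carrier K \<times> carrier X)" by (simp add: ts Dcar)
  have up: "?up (h (b, r)) = (b, r)" if "b \<in> carrier K" "r \<in> carrier X" for b r
    using that hD by (simp add: Dcar)
  have p: "aug Z \<in> lin_maps Z (regular_module Z) ?k"
    by (rule lin_mapsI) (simp_all add: trivial_module_def)
  have d: "(\<lambda>z. \<sigma> (snd (?up z))) \<in> lin_maps Z D' (regular_module Z)"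
    using lin_maps_comp[OF lin_maps_comp[OF hl(2) snd] \<sigma>(1)] .
  have i: "(\<lambda>b. h (b, \<zero>\<^bsub>X\<^esub>)) \<in> lin_maps Z ?k D'"
    using lin_maps_comp[OF inl hl(1)] .
  have \<sigma>0: "\<sigma> r = \<zero>\<^bsub>Z\<^esub> \<longleftrightarrow> r = \<zero>\<^bsub>X\<^esub>" if "r \<in> carrier X" for r
  proof -
    have "\<sigma> \<zero>\<^bsub>X\<^esub> = \<zero>\<^bsub>Z\<^esub>"
      using lin_maps_zero[OF \<sigma>(1) left_module_pull[OF Z.A.ring_axioms rf regX] regZ] by simp
    then show ?thesis using \<sigma>(2) that by (metis A.zero_closed inj_onD)
  qed
  have T_ext: "is_ext Z 2 ?k ?k T"
    unfolding T_def is_ext_Seq_iff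
  proof (intro conjI allI impI)
    fix j :: nat
    show "left_module Z (N j)" "small (carrier (N j))"
      using regZ D' Z(2) h(2) by (simp_all add: N_def carD')
    show "(\<lambda>b. h (b, \<zero>\<^bsub>X\<^esub>)) \<in> lin_maps Z ?k (N (2 - 1))" using i by (simp add: N_def)
    show "aug Z \<in> lin_maps Z (N 0) ?k" using p by (simp add: N_def)
    show "inj_on (\<lambda>b. h (b, \<zero>\<^bsub>X\<^esub>)) (carrier ?k)"
      by (rule inj_onI) (auto simp: trivial_module_def dest!: inj_onD[OF h(1)])
    show "aug Z ` carrier (N 0) = carrier ?k"
    proof (intro equalityI subsetI)
      fix c assume "c \<in> carrier ?k"
      then show "c \<in> aug Z ` carrier (N 0)"
        by (intro image_eqI[of _ _ "c \<odot>\<^bsub>Z\<^esub> \<one>\<^bsub>Z\<^esub>"]) (simp_all add: N_def trivial_module_def)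
    qed (auto simp: N_def trivial_module_def)
  next
    fix j :: nat assume "Suc j < 2"
    then show "(\<lambda>z. \<sigma> (snd (?up z))) \<in> lin_maps Z (N (Suc j)) (N j)" using d by (simp add: N_def)
  next
    fix j :: nat assume "j < 2"
    then consider "j = 0" | "j = 1" by linarith
    then show "exact_at 2 ?k ?k N (\<lambda>_ z. \<sigma> (snd (?up z))) (\<lambda>b. h (b, \<zero>\<^bsub>X\<^esub>)) (aug Z) j"
    proof cases
      case 1
      have "(\<lambda>z. \<sigma> (snd (?up z))) ` carrier D' = \<sigma> ` carrier X"
      proof (intro equalityI subsetI)
        fix z assume "z \<in> \<sigma> ` carrier X"
        then obtain r where "r \<in> carrier X" "z = \<sigma> r" by blast
        then show "z \<in> (\<lambda>z. \<sigma> (snd (?up z))) ` carrier D'"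
          by (intro image_eqI[of _ _ "h (\<zero>, r)"]) (simp_all add: up carD')
      qed (auto simp: carD' up)
      then show ?thesis using 1 \<sigma>(3) by (simp add: exact_at_def N_def trivial_module_def)
    next
      case 2
      have "(\<lambda>b. h (b, \<zero>\<^bsub>X\<^esub>)) ` carrier K = {z \<in> carrier D'. \<sigma> (snd (?up z)) = \<zero>\<^bsub>Z\<^esub>}"
        by (auto simp: carD' up \<sigma>0)
      then show ?thesis using 2 by (simp add: exact_at_def N_def trivial_module_def)
    qed
  qed simp
  have mor: "ext_mor Z 2 ?k ?k ?k ?k id id T (restrict_scalars f S)" if S: "is_ext X 2 kk kk S" for S
  proof (cases S)
    case (Hom g)
    then show ?thesis using S by simp
  next
    case (Seq M d' i' p')
    note S' = S[unfolded Seq]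
    note SD = is_ext_SeqD[OF S']
    obtain e where e': "\<forall>j\<le>1. e j \<in> carrier (M j)" "p' (e 0) = \<one>"
      "\<forall>j<1. d' j (e (Suc j)) = x \<odot>\<^bsub>M j\<^esub> e j"
      using lift_sequence[OF S', of 1] by auto
    have e: "e 0 \<in> carrier (M 0)" "e (Suc 0) \<in> carrier (M (Suc 0))" "d' 0 (e (Suc 0)) = x \<odot>\<^bsub>M 0\<^esub> e 0"
      using e'(1,3) by simp_all
    interpret M0: left_mod X "M 0" using SD(2)[of 0] by (simp add: left_mod_def)
    interpret M1: left_mod X "M (Suc 0)" using SD(2)[of "Suc 0"] by (simp add: left_mod_def)
    note fD = aug_homD[OF f(1)]
    have i': "\<And>b. b \<in> carrier K \<Longrightarrow> i' b \<in> carrier (M (Suc 0))"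
      "\<And>b c. \<lbrakk>b \<in> carrier K; c \<in> carrier K\<rbrakk> \<Longrightarrow> i' (b \<oplus> c) = i' b \<oplus>\<^bsub>M (Suc 0)\<^esub> i' c"
      "\<And>r b. \<lbrakk>r \<in> carrier X; b \<in> carrier K\<rbrakk> \<Longrightarrow> i' (aug X r \<otimes> b) = r \<odot>\<^bsub>M (Suc 0)\<^esub> i' b"
      using lin_mapsD[OF SD(4)] by simp_all
    define H0 where "H0 z = f z \<odot>\<^bsub>M 0\<^esub> e 0" for z
    define H1 where "H1 = (\<lambda>(b, r). i' b \<oplus>\<^bsub>M (Suc 0)\<^esub> r \<odot>\<^bsub>M (Suc 0)\<^esub> e (Suc 0))"
    have H0: "H0 \<in> lin_maps Z (regular_module Z) (pull_module f (M 0))"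
      by (rule lin_mapsI) (simp_all add: H0_def fD e M0.smult_l_distr M0.smult_assoc)
    have H1: "H1 \<in> lin_maps Z D (pull_module f (M (Suc 0)))"
    proof (rule lin_mapsI)
      show "H1 z \<in> carrier (pull_module f (M (Suc 0)))" if "z \<in> carrier D" for z
        using that e by (auto simp: H1_def Dcar i')
      show "H1 (y \<oplus>\<^bsub>D\<^esub> z) = H1 y \<oplus>\<^bsub>pull_module f (M (Suc 0))\<^esub> H1 z"
        if "y \<in> carrier D" "z \<in> carrier D" for y z
        using that e unfolding Dcar
        by (auto simp: H1_def D_def direct_sum_def trivial_module_def i' M1.smult_l_distr M1.M.a_ac)
      show "H1 (c \<odot>\<^bsub>D\<^esub> z) = c \<odot>\<^bsub>pull_module f (M (Suc 0))\<^esub> H1 z"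
        if "c \<in> carrier Z" "z \<in> carrier D" for c z
        using that e i'(3)[OF fD(1)] unfolding Dcar
        by (auto simp: H1_def D_def direct_sum_def trivial_module_def i'(1) fD M1.smult_r_distr
            M1.smult_assoc)
    qed
    have ii: "d' 0 (i' b) = \<zero>\<^bsub>M 0\<^esub>" if "b \<in> carrier K" for b
      using exact_at_image(2)[OF SD(9)[of 1], of b] that by simp
    have H01: "H0 (\<sigma> (snd z)) = d' 0 (H1 z)" if "z \<in> carrier D" for z
    proof -
      obtain b r where br: "b \<in> carrier K" "r \<in> carrier X" "z = (b, r)" using \<open>z \<in> carrier D\<close> Dcar by auto
      have "d' 0 (H1 z) = d' 0 (i' b) \<oplus>\<^bsub>M 0\<^esub> r \<odot>\<^bsub>M 0\<^esub> d' 0 (e (Suc 0))"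
        using lin_mapsD(2,3)[OF SD(5)[of 0]] br e i' by (simp add: H1_def)
      also have "\<dots> = (r \<otimes>\<^bsub>X\<^esub> x) \<odot>\<^bsub>M 0\<^esub> e 0"
        using br e by (simp add: ii M0.smult_assoc)
      finally show ?thesis using br by (simp add: H0_def \<sigma>(4))
    qed
    have ph: "aug Z z = p' (H0 z)" if "z \<in> carrier Z" for z
      using lin_mapsD(3)[OF SD(6), of "f z" "e 0"] e e'(2) fD(1,6)[OF that] that by (simp add: H0_def)
    define H where "H j = (if j = 0 then H0 else (\<lambda>z. H1 (?up z)))" for j :: nat
    have "ext_mor_comp Z 2 ?k ?k id id T (restrict_scalars f S)"
      unfolding T_def Seq restrict_scalars_Seq ext_mor_comp.simps
    proof (intro exI[of _ H] conjI allI impI ballI)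
      fix j :: nat assume "j < 2"
      then consider "j = 0" | "j = 1" by linarith
      then show "H j \<in> lin_maps Z (N j) (pull_module f (M j))"
        using H0 lin_maps_comp[OF hl(2) H1] by cases (simp_all add: H_def N_def)
    next
      fix y assume "y \<in> carrier ?k"
      then have "y \<in> carrier K" by (simp add: trivial_module_def)
      then show "H (2 - 1) (h (y, \<zero>\<^bsub>X\<^esub>)) = i' (id y)"
        using e by (simp add: H_def up H1_def i')
    next
      fix j :: nat and z assume j: "Suc j < 2" and z: "z \<in> carrier (N (Suc j))"
      then have "?up z \<in> carrier D" by (auto simp: N_def carD' up[unfolded Dcar] Dcar)
      then show "H j (\<sigma> (snd (?up z))) = d' j (H (Suc j) z)" using H01 j by (simp add: H_def)
    next
      fix z assume "z \<in> carrier (N 0)"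
      then show "id (aug Z z) = p' (H 0 z)" using ph by (simp add: N_def H_def)
    qed
    then show ?thesis
      using T_ext is_ext_restrict_scalars[OF Z(1) f(1) S] by (simp only: ext_mor_def)
  qed
  show thesis using that Z f mor by blast
qed

subsection \<open>The product \<open>k \<times> X\<close>\<close>

definition product_algebra :: "('k, 'k \<times> 'u) aug_alg" where
  "product_algebra = \<lparr>carrier = carrier K \<times> carrier X,
     mult = (\<lambda>(a, r) (a', r'). (a \<otimes> a', r \<otimes>\<^bsub>X\<^esub> r')),
     one = (\<one>, \<one>\<^bsub>X\<^esub>), zero = (\<zero>, \<zero>\<^bsub>X\<^esub>),
     add = (\<lambda>(a, r) (a', r'). (a \<oplus> a', r \<oplus>\<^bsub>X\<^esub> r')),
     smult = (\<lambda>c (a, r). (c \<otimes> a, c \<odot>\<^bsub>X\<^esub> r)), aug = fst\<rparr>"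

lemma augmented_product_algebra: "augmented_algebra K product_algebra"
proof -
  have ab: "abelian_group product_algebra"
  proof (rule abelian_groupI)
    fix z assume "z \<in> carrier product_algebra"
    then show "\<exists>y\<in>carrier product_algebra. y \<oplus>\<^bsub>product_algebra\<^esub> z = \<zero>\<^bsub>product_algebra\<^esub>"
      by (intro bexI[of _ "(\<ominus> fst z, \<ominus>\<^bsub>X\<^esub> snd z)"]) (auto simp: product_algebra_def K.l_neg A.l_neg)
  qed (auto simp: product_algebra_def K.a_ac A.a_ac)
  have mon: "monoid product_algebra"
    by (rule monoidI) (auto simp: product_algebra_def K.m_assoc A.m_assoc)
  have "ring product_algebra"
    by (rule ringI[OF ab mon])
       (auto simp: product_algebra_def K.l_distr K.r_distr A.l_distr A.r_distr)
  moreover have "module K product_algebra"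
    by (rule moduleI[OF K.cring_axioms ab])
       (auto simp: product_algebra_def K.l_distr K.r_distr K.m_assoc mod.smult_l_distr
          mod.smult_r_distr mod.smult_assoc1)
  moreover have "aug product_algebra \<in> ring_hom product_algebra K"
    by (rule ring_hom_memI) (auto simp: product_algebra_def)
  ultimately show ?thesis
    unfolding augmented_algebra_def
    by (auto simp: product_algebra_def K.m_assoc K.m_lcomm smult_mult_left smult_mult_right)
qed

text \<open>Acting with the idempotent \<open>\<epsilon> = (1, 0)\<close> on a preimage of \<open>1\<close> gives a preimage \<open>e\<^sub>0\<close> with \<open>x e\<^sub>0 = 0\<close>, since
  \<open>x\<close> acts as \<open>(0, x)\<close>. The lift then continues by zeros and has coefficient zero.\<close>

lemma product_kills_positive_degrees:
  assumes U: "universe TYPE('u)" and sm: "carrier K \<prec> (UNIV :: 'u set)" and X: "small (carrier X)"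
  obtains P :: "('k, 'u) aug_alg" and f where
    "augmented_algebra K P" "small (carrier P)" "f \<in> aug_hom K X P" "inj_on f (carrier X)"
    "\<And>n S. \<lbrakk>0 < n; is_ext P n (trivial_module K P) (trivial_module K P) S\<rbrakk>
       \<Longrightarrow> has_coeff n (restrict_scalars f S) \<zero>"
proof -
  let ?C = "carrier K \<times> carrier X"
  obtain h :: "'k \<times> 'u \<Rightarrow> 'u" where h: "inj_on h ?C" "small (h ` ?C)"
    using lesspoll_inj[OF times_lesspoll_universe[OF U sm X]] by blast
  have car: "carrier product_algebra = ?C" by (simp add: product_algebra_def)
  have h': "inj_on h (carrier product_algebra)" using h by (simp add: car)
  define P where "P = transport h product_algebra"
  note ts = transport_simps[OF h', unfolded car, folded P_def]
  have P: "augmented_algebra K P" unfolding P_def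
    by (rule augmented_algebra_transport[OF augmented_product_algebra h'])
  interpret P: augmented K P using P by (simp add: augmented_def)
  have Pop: "h (a, r) \<oplus>\<^bsub>P\<^esub> h (a', r') = h (a \<oplus> a', r \<oplus>\<^bsub>X\<^esub> r')"
    "h (a, r) \<otimes>\<^bsub>P\<^esub> h (a', r') = h (a \<otimes> a', r \<otimes>\<^bsub>X\<^esub> r')"
    if "a \<in> carrier K" "r \<in> carrier X" "a' \<in> carrier K" "r' \<in> carrier X" for a r a' r'
    using that by (simp_all add: ts) (simp_all add: product_algebra_def)
  have Pop1: "c \<odot>\<^bsub>P\<^esub> h (a, r) = h (c \<otimes> a, c \<odot>\<^bsub>X\<^esub> r)" "aug P (h (a, r)) = a"
    if "a \<in> carrier K" "r \<in> carrier X" for a r c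
    using that by (simp_all add: ts) (simp_all add: product_algebra_def)
  have Pc: "\<one>\<^bsub>P\<^esub> = h (\<one>, \<one>\<^bsub>X\<^esub>)" "\<zero>\<^bsub>P\<^esub> = h (\<zero>, \<zero>\<^bsub>X\<^esub>)"
    by (simp_all add: ts) (simp_all add: product_algebra_def)
  have mem: "h (a, r) \<in> carrier P" if "a \<in> carrier K" "r \<in> carrier X" for a r
    using that by (simp add: ts)
  define f where "f = (\<lambda>r\<in>carrier X. h (aug X r, r))"
  have f: "f \<in> aug_hom K X P"
    by (auto simp: aug_hom_def f_def Pop Pop1 Pc mem intro!: ring_hom_memI)
  have inj: "inj_on f (carrier X)"
    by (rule inj_onI) (auto simp: f_def dest!: inj_onD[OF h(1)])
  define \<epsilon> where "\<epsilon> = h (\<one>, \<zero>\<^bsub>X\<^esub>)"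
  have \<epsilon>: "\<epsilon> \<in> carrier P" "aug P \<epsilon> = \<one>" "f x \<otimes>\<^bsub>P\<^esub> \<epsilon> = \<zero>\<^bsub>P\<^esub>" "f x \<in> carrier P"
    by (simp_all add: \<epsilon>_def f_def Pop Pop1 Pc mem)
  have "has_coeff n (restrict_scalars f S) \<zero>"
    if n: "0 < n" and S: "is_ext P n (trivial_module K P) (trivial_module K P) S" for n S
  proof (cases S)
    case (Hom g)
    then show ?thesis using n S by simp
  next
    case (Seq N d i p)
    note SD = is_ext_SeqD[OF S[unfolded Seq]]
    have mod: "left_mod P (N j)" if "j < n" for j using SD(2)[OF that] by (simp add: left_mod_def)
    have "\<one> \<in> p ` carrier (N 0)" using SD(8) by (simp add: trivial_module_def)
    then obtain v where v: "v \<in> carrier (N 0)" "p v = \<one>" by auto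
    define e where "e j = (if j = 0 then \<epsilon> \<odot>\<^bsub>N 0\<^esub> v else \<zero>\<^bsub>N j\<^esub>)" for j :: nat
    have e: "e j \<in> carrier (N j)" and xe: "f x \<odot>\<^bsub>N j\<^esub> e j = \<zero>\<^bsub>N j\<^esub>" if j: "j < n" for j
    proof -
      interpret Nj: left_mod P "N j" by (rule mod[OF j])
      show "e j \<in> carrier (N j)" using v \<epsilon> Nj.smult_closed[of \<epsilon> v]
        by (cases "j = 0") (auto simp: e_def)
      show "f x \<odot>\<^bsub>N j\<^esub> e j = \<zero>\<^bsub>N j\<^esub>"
        using v \<epsilon> Nj.smult_assoc[of "f x" \<epsilon> v, symmetric] Nj.smult_l_null[of v]
        by (cases "j = 0") (auto simp: e_def)
    qed
    have z: "d j \<zero>\<^bsub>N (Suc j)\<^esub> = \<zero>\<^bsub>N j\<^esub>" if "Suc j < n" for j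
      using lin_maps_zero[OF SD(5)[OF that] SD(2) SD(2)] that by simp
    have iz: "i \<zero> = \<zero>\<^bsub>N (n - 1)\<^esub>"
      using lin_maps_zero[OF SD(4) left_module_trivial[OF P] SD(2)] n by (simp add: trivial_module_def)
    show ?thesis
      unfolding Seq restrict_scalars_Seq has_coeff_simps
    proof (intro exI[of _ e] conjI allI impI)
      show "e j \<in> carrier (pull_module f (N j))" if "j < n" for j using e[OF that] by simp
      show "p (e 0) = \<one>"
        using lin_mapsD(3)[OF SD(6) \<epsilon>(1) v(1)] v \<epsilon> by (simp add: e_def trivial_module_def)
      show "d j (e (Suc j)) = x \<odot>\<^bsub>pull_module f (N j)\<^esub> e j" if j: "Suc j < n" for j
      proof -
        have "e (Suc j) = \<zero>\<^bsub>N (Suc j)\<^esub>" by (simp add: e_def)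
        then show ?thesis using z[OF j] xe[of j] j by simp
      qed
      show "x \<odot>\<^bsub>pull_module f (N (n - 1))\<^esub> e (n - 1) = i \<zero>"
        using xe[of "n - 1"] n iz by simp
    qed
  qed
  then show thesis using that P h f inj by (simp add: ts)
qed

end


section \<open>The functor \<open>E\<close> has no adjoints\<close>

lemma obj_map_E: "obj_map (E_functor K) X = transport (ext_embedding K X) (ext_algebra K X)"
  by (simp add: E_functor_def)

lemma mor_map_E:
  assumes "v \<in> carrier (transport (ext_embedding K \<Gamma>) (ext_algebra K \<Gamma>))"
  obtains w where "w \<in> carrier (ext_algebra K \<Gamma>)"
    "mor_map (E_functor K) \<Lambda> \<Gamma> f v = ext_embedding K \<Lambda> (ext_map K \<Lambda> f w)"
  using assms that[of "inv_into (carrier (ext_algebra K \<Gamma>)) (ext_embedding K \<Gamma>) v"]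
  by (simp add: E_functor_def transport_def Let_def inv_into_into)

context dual_numbers
begin

abbreviation E_dual :: "('k, 'u) aug_alg" where
  "E_dual \<equiv> transport (ext_embedding K X) (ext_algebra K X)"

lemma E_dual_scalar:
  assumes h: "inj_on (ext_embedding K X) (carrier (ext_algebra K X))" and c: "c \<in> carrier K"
  shows "c \<odot>\<^bsub>E_dual\<^esub> \<one>\<^bsub>E_dual\<^esub> = ext_embedding K X (coeff_family (\<lambda>n. if n = 0 then c else \<zero>))"
proof -
  have fin: "finite {n :: nat. (if n = 0 then \<one> else \<zero>) \<noteq> \<zero>}"
    by (rule finite_subset[of _ "{0}"]) auto
  then have "\<one>\<^bsub>ext_algebra K X\<^esub> \<in> carrier (ext_algebra K X)"
    unfolding ext_algebra_carrier ext_algebra_one by auto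
  then show ?thesis by (simp add: transport_simps[OF h] ext_algebra_scalar[OF c])
qed

definition degree_two :: "nat \<Rightarrow> ('u, 'k, 'k) extn set" where
  "degree_two = coeff_family (\<lambda>n. if n = 2 then \<one> else \<zero>)"

lemma coeff_family_mem:
  assumes "a \<in> carrier K"
  shows "coeff_family (\<lambda>n. if n = m then a else \<zero>) \<in> carrier (ext_algebra K X)"
proof -
  have "finite {n :: nat. (if n = m then a else \<zero>) \<noteq> \<zero>}"
    by (rule finite_subset[of _ "{m}"]) auto
  then show ?thesis unfolding ext_algebra_carrier using assms by (intro imageI) auto
qed

lemma degree_two_not_scalar:
  assumes h: "inj_on (ext_embedding K X) (carrier (ext_algebra K X))" and c: "c \<in> carrier K"
    and one: "\<one> \<noteq> \<zero>"
  shows "ext_embedding K X degree_two \<noteq> c \<odot>\<^bsub>E_dual\<^esub> \<one>\<^bsub>E_dual\<^esub>"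
proof
  assume "ext_embedding K X degree_two = c \<odot>\<^bsub>E_dual\<^esub> \<one>\<^bsub>E_dual\<^esub>"
  then have "degree_two = coeff_family (\<lambda>n. if n = 0 then c else \<zero>)"
    unfolding E_dual_scalar[OF h c] degree_two_def
    using h coeff_family_mem[of \<one> 2] coeff_family_mem[OF c, of 0] by (auto dest: inj_onD)
  then have "(\<lambda>n. if n = 2 then \<one> else \<zero>) = (\<lambda>n. if n = (0 :: nat) then c else \<zero>)"
    unfolding degree_two_def by (rule coeff_family_inj) (use c in auto)
  from fun_cong[OF this, of 2] show False using one by simp
qed

text \<open>The class of coefficient \<open>1\<close> in degree two and the zero element have the same image in \<open>E Z\<close>.\<close>

lemma right_adjoint_impossible:
  assumes U: "universe TYPE('u)" and sm: "carrier K \<prec> (UNIV :: 'u set)" and X: "small (carrier X)"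
    and one: "\<one> \<noteq> \<zero>"
    and adj: "adjunction (aug_cat K :: (('k, 'u) aug_alg, 'u \<Rightarrow> 'u) category)
                (op_cat (aug_cat K)) (E_functor K) G \<phi>"
  shows False
proof -
  let ?C = "aug_cat K :: (('k, 'u) aug_alg, 'u \<Rightarrow> 'u) category"
  let ?h = "ext_embedding K X"
  obtain Z :: "('k, 'u) aug_alg" and f T where Z: "augmented_algebra K Z" "small (carrier Z)"
    and f: "f \<in> aug_hom K Z X" "f ` carrier Z = carrier X"
    and T: "\<And>S. is_ext X 2 kk kk S \<Longrightarrow>
       ext_mor Z 2 (trivial_module K Z) (trivial_module K Z) (trivial_module K Z) (trivial_module K Z)
         id id T (restrict_scalars f S)"
    by (rule degree_two_vanishes_on_cubic_cover[OF U sm X]) (rule that)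
  have obX: "X \<in> Ob ?C" and obZ: "Z \<in> Ob ?C"
    using Z X augmented_algebra by (simp_all add: Ob_aug_cat)
  have E: "is_functor ?C (op_cat ?C) (E_functor K)" using adj by (simp add: adjunction_def)
  have obEA: "E_dual \<in> Ob ?C" "obj_map (E_functor K) Z \<in> Ob ?C"
    using E obX obZ by (auto simp: is_functor_def op_cat_def obj_map_E)
  have h: "inj_on ?h (carrier (ext_algebra K X))" by (rule inj_ext_embedding[OF U sm])
  have "epi_arrow (op_cat ?C) (obj_map (E_functor K) Z) (obj_map (E_functor K) X)
          (mor_map (E_functor K) Z X f)"
    using left_adjoint_preserves_epi[OF is_category_aug_cat is_category_op[OF is_category_aug_cat]
        adj obZ obX surjective_imp_epi_arrow[OF f]] .
  then have mono: "mono_arrow ?C E_dual (obj_map (E_functor K) Z) (mor_map (E_functor K) Z X f)"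
    by (simp add: epi_op_iff obj_map_E)
  have mem: "degree_two \<in> carrier (ext_algebra K X)" "\<zero>\<^bsub>ext_algebra K X\<^esub> \<in> carrier (ext_algebra K X)"
    using coeff_family_mem[of \<one> 2] coeff_family_mem[of \<zero> 0]
    by (simp_all add: degree_two_def ext_algebra_zero)
  have "ext_map K Z f degree_two n = ext_map K Z f \<zero>\<^bsub>ext_algebra K X\<^esub> n" for n
  proof (cases "n = 2")
    case True
    let ?k = "trivial_module K Z"
    \<comment> \<open>change of rings takes every class of degree two to the class of \<open>T\<close>\<close>
    have all: "\<Union> (ext_class Z 2 ?k ?k ` restrict_scalars f ` coeff_class 2 c) = ext_class Z 2 ?k ?k T"
      if "c \<in> carrier K" for c
    proof -
      have "ext_class Z 2 ?k ?k (restrict_scalars f S) = ext_class Z 2 ?k ?k T"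
        if "S \<in> coeff_class 2 c" for S
        using T[of S] that ext_class_cong[OF r_into_equivclp, of Z 2 ?k ?k T "restrict_scalars f S"]
        by (simp add: coeff_class_def)
      then show ?thesis using std_ext_in_coeff_class[OF \<open>c \<in> carrier K\<close>, of 2] by blast
    qed
    show ?thesis
      using all[of \<one>] all[of \<zero>] True
      by (simp add: ext_map_def Let_def degree_two_def coeff_family_def ext_algebra_zero)
  next
    case False
    then show ?thesis
      by (simp add: ext_map_def degree_two_def coeff_family_def ext_algebra_zero)
  qed
  then have eq: "ext_map K Z f degree_two = ext_map K Z f \<zero>\<^bsub>ext_algebra K X\<^esub>" by blast
  have Ef: "mor_map (E_functor K) Z X f (?h w) = ext_embedding K Z (ext_map K Z f w)"
    if "w \<in> carrier (ext_algebra K X)" for w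
    using that h by (simp add: E_functor_def)
  interpret E_dual: augmented K E_dual using obEA by (simp add: augmented_def Ob_aug_cat)
  interpret EZ: augmented K "obj_map (E_functor K) Z" using obEA by (simp add: augmented_def Ob_aug_cat)
  have hom: "mor_map (E_functor K) Z X f \<in> aug_hom K E_dual (obj_map (E_functor K) Z)"
    using mono by (simp add: mono_arrow_def Mor_aug_cat)
  have z: "?h \<zero>\<^bsub>ext_algebra K X\<^esub> = \<zero> \<odot>\<^bsub>E_dual\<^esub> \<one>\<^bsub>E_dual\<^esub>"
    using E_dual.mod.smult_l_null[OF E_dual.A.one_closed] transport_simps(3)[OF h] by simp
  have "mor_map (E_functor K) Z X f (?h degree_two)
      = \<zero> \<odot>\<^bsub>obj_map (E_functor K) Z\<^esub> \<one>\<^bsub>obj_map (E_functor K) Z\<^esub>"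
    using Ef[OF mem(1)] Ef[OF mem(2)] eq z aug_homD(5)[OF hom, of \<zero> "\<one>\<^bsub>E_dual\<^esub>"] aug_homD(4)[OF hom]
    by (simp del: E_dual.mod.smult_l_null EZ.mod.smult_l_null)
  then have "?h degree_two = \<zero> \<odot>\<^bsub>E_dual\<^esub> \<one>\<^bsub>E_dual\<^esub>"
    using mono_arrow_to_scalar[OF obEA(1,2) mono] mem by (simp add: transport_simps[OF h])
  then show False using degree_two_not_scalar[OF h _ one] by blast
qed

text \<open>All of \<open>E X\<close> would consist of scalars.\<close>

lemma left_adjoint_impossible:
  assumes U: "universe TYPE('u)" and sm: "carrier K \<prec> (UNIV :: 'u set)" and X: "small (carrier X)"
    and one: "\<one> \<noteq> \<zero>"
    and adj: "adjunction (op_cat (aug_cat K))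
                (aug_cat K :: (('k, 'u) aug_alg, 'u \<Rightarrow> 'u) category) L (E_functor K) \<phi>"
  shows False
proof -
  let ?C = "aug_cat K :: (('k, 'u) aug_alg, 'u \<Rightarrow> 'u) category"
  let ?h = "ext_embedding K X"
  obtain P :: "('k, 'u) aug_alg" and f where P: "augmented_algebra K P" "small (carrier P)"
    and f: "f \<in> aug_hom K X P" "inj_on f (carrier X)"
    and van: "\<And>n S. \<lbrakk>0 < n; is_ext P n (trivial_module K P) (trivial_module K P) S\<rbrakk>
       \<Longrightarrow> has_coeff n (restrict_scalars f S) \<zero>"
    by (rule product_kills_positive_degrees[OF U sm X]) (rule that)
  have obX: "X \<in> Ob ?C" and obP: "P \<in> Ob ?C"
    using P X augmented_algebra by (simp_all add: Ob_aug_cat)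
  have E: "is_functor ?C (op_cat ?C) (E_functor K)" using adj by (simp add: adjunction_def)
  have E_dual: "E_dual \<in> Ob ?C" using E obX by (auto simp: is_functor_def op_cat_def obj_map_E)
  have h: "inj_on ?h (carrier (ext_algebra K X))" by (rule inj_ext_embedding[OF U sm])
  interpret E_dual: augmented K E_dual using E_dual by (simp add: augmented_def Ob_aug_cat)
  have "mono_arrow (op_cat ?C) (obj_map (E_functor K) X) (obj_map (E_functor K) P)
          (mor_map (E_functor K) X P f)"
    using right_adjoint_preserves_mono[OF is_category_op[OF is_category_aug_cat] is_category_aug_cat
        adj obX obP injective_imp_mono_arrow[OF f]] .
  then have epi: "epi_arrow ?C (obj_map (E_functor K) P) E_dual (mor_map (E_functor K) X P f)"
    by (simp add: mono_arrow_op_iff obj_map_E)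
  have scal: "\<exists>c\<in>carrier K. mor_map (E_functor K) X P f v = c \<odot>\<^bsub>E_dual\<^esub> \<one>\<^bsub>E_dual\<^esub>"
    if "v \<in> carrier (obj_map (E_functor K) P)" for v
  proof -
    from that have "v \<in> carrier (transport (ext_embedding K P) (ext_algebra K P))"
      by (simp add: obj_map_E)
    then obtain w where w: "w \<in> carrier (ext_algebra K P)"
      "mor_map (E_functor K) X P f v = ?h (ext_map K X f w)" by (rule mor_map_E)
    then show ?thesis using ext_map_to_scalar[OF f(1) w(1) van] E_dual_scalar[OF h] by auto
  qed
  have "?h degree_two \<in> carrier E_dual"
    using coeff_family_mem[of \<one> 2] by (simp add: transport_simps[OF h] degree_two_def)
  then have "?h degree_two = aug E_dual (?h degree_two) \<odot>\<^bsub>E_dual\<^esub> \<one>\<^bsub>E_dual\<^esub>"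
    and "aug E_dual (?h degree_two) \<in> carrier K"
    using epi_arrow_from_scalars[OF E_dual epi scal] by simp_all
  then show False using degree_two_not_scalar[OF h _ one] by metis
qed

end

theorem lemma2p7:
  fixes K :: "('k, 'm) ring_scheme"
  assumes "field K"
    and "universe TYPE('u)"
    and "carrier K \<prec> (UNIV :: 'u set)"
  shows "\<not> has_right_adjoint (aug_cat K :: (('k, 'u) aug_alg, 'u \<Rightarrow> 'u) category)
            (op_cat (aug_cat K)) (E_functor K) \<and>
         \<not> has_left_adjoint (aug_cat K :: (('k, 'u) aug_alg, 'u \<Rightarrow> 'u) category)
            (op_cat (aug_cat K)) (E_functor K)"
proof -
  interpret K: field K by fact
  obtain X :: "('k, 'u) aug_alg" and x \<beta> pr where "dual_numbers K X x \<beta> pr" and X: "small (carrier X)"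
    using dual_numbers_exist[OF K.cring_axioms assms(2,3)] by blast
  then interpret dual_numbers K X x \<beta> pr by simp
  show ?thesis
    using right_adjoint_impossible[OF assms(2,3) X K.one_not_zero]
      left_adjoint_impossible[OF assms(2,3) X K.one_not_zero]
    by (auto simp: has_right_adjoint_def has_left_adjoint_def)
qed

end
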